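(* Let $(r_n)$ be a sequence of binary strings such that $|r_n|=n$ for all $n$ and there is a constant $d$ with $\mathrm{C}(r_n)\ge n-d$ for all $n$. Then there exists a constant $c$ such that the theory $\mathsf{PA}$ plus the axioms "$\mathrm{C}(r_n)\ge n-c\log_2 n$" (for all $n\ge 2$) does not prove all true $\mathrm{\Pi}_1$-statements.
   Context: $\mathsf{PA}$ is Peano arithmetic; "true" means true in the standard model. $\mathrm{C}$ is plain Kolmogorov complexity, represented in $\mathsf{PA}$ as $\mathrm{C}_D(x)=\min\{|p|:D(p)=x\}$ for a provably optimal interpreter $D$ (for every partial computable $D'$ there is $c'$ with $\mathsf{PA}\vdash\forall x\,[\mathrm{C}_D(x)\le\mathrm{C}_{D'}(x)+c']$). *)

theory Defs
  imports "HOL-Library.Extended_Nat" "HOL-Number_Theory.Cong" Complex_Main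
begin

section \<open>First-order arithmetic\<close>

text \<open>De Bruijn indices: \<open>Var 0\<close> is bound by the innermost \<open>All\<close>.\<close>

datatype tm = Var nat | Zero | Succ tm | Add tm tm | Mul tm tm

datatype fm = Fls | Eq tm tm | Lt tm tm | Imp fm fm | All fm

abbreviation Neg :: "fm \<Rightarrow> fm" where "Neg \<phi> \<equiv> Imp \<phi> Fls"
abbreviation Con :: "fm \<Rightarrow> fm \<Rightarrow> fm" where "Con \<phi> \<psi> \<equiv> Neg (Imp \<phi> (Neg \<psi>))"
abbreviation Iff :: "fm \<Rightarrow> fm \<Rightarrow> fm" where "Iff \<phi> \<psi> \<equiv> Con (Imp \<phi> \<psi>) (Imp \<psi> \<phi>)"
abbreviation Ex :: "fm \<Rightarrow> fm" where "Ex \<phi> \<equiv> Neg (All (Neg \<phi>))"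

primrec num_tm :: "nat \<Rightarrow> tm" where
  "num_tm 0 = Zero"
| "num_tm (Suc n) = Succ (num_tm n)"

subsection \<open>Simultaneous substitution\<close>

primrec subst_tm :: "(nat \<Rightarrow> tm) \<Rightarrow> tm \<Rightarrow> tm" where
  "subst_tm \<sigma> (Var i) = \<sigma> i"
| "subst_tm \<sigma> Zero = Zero"
| "subst_tm \<sigma> (Succ t) = Succ (subst_tm \<sigma> t)"
| "subst_tm \<sigma> (Add s t) = Add (subst_tm \<sigma> s) (subst_tm \<sigma> t)"
| "subst_tm \<sigma> (Mul s t) = Mul (subst_tm \<sigma> s) (subst_tm \<sigma> t)"

abbreviation lift :: "tm \<Rightarrow> tm" where
  "lift \<equiv> subst_tm (\<lambda>i. Var (Suc i))"

primrec subst :: "(nat \<Rightarrow> tm) \<Rightarrow> fm \<Rightarrow> fm" where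
  "subst \<sigma> Fls = Fls"
| "subst \<sigma> (Eq s t) = Eq (subst_tm \<sigma> s) (subst_tm \<sigma> t)"
| "subst \<sigma> (Lt s t) = Lt (subst_tm \<sigma> s) (subst_tm \<sigma> t)"
| "subst \<sigma> (Imp \<phi> \<psi>) = Imp (subst \<sigma> \<phi>) (subst \<sigma> \<psi>)"
| "subst \<sigma> (All \<phi>) = All (subst (case_nat (Var 0) (\<lambda>i. lift (\<sigma> i))) \<phi>)"

definition lift_fm :: "fm \<Rightarrow> fm" where
  "lift_fm \<phi> = subst (\<lambda>i. Var (Suc i)) \<phi>"

definition inst :: "fm \<Rightarrow> tm \<Rightarrow> fm" where
  "inst \<phi> t = subst (case_nat t Var) \<phi>"

text \<open>\<open>inst2 \<phi> s t\<close> is \<open>\<phi>(s,t)\<close> for a formula \<open>\<phi>\<close> in the free variables 0 and 1.\<close>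

definition inst2 :: "fm \<Rightarrow> tm \<Rightarrow> tm \<Rightarrow> fm" where
  "inst2 \<phi> s t = subst (case_nat s (case_nat t Var)) \<phi>"

primrec fv_tm :: "tm \<Rightarrow> nat set" where
  "fv_tm (Var i) = {i}"
| "fv_tm Zero = {}"
| "fv_tm (Succ t) = fv_tm t"
| "fv_tm (Add s t) = fv_tm s \<union> fv_tm t"
| "fv_tm (Mul s t) = fv_tm s \<union> fv_tm t"

primrec fv :: "fm \<Rightarrow> nat set" where
  "fv Fls = {}"
| "fv (Eq s t) = fv_tm s \<union> fv_tm t"
| "fv (Lt s t) = fv_tm s \<union> fv_tm t"
| "fv (Imp \<phi> \<psi>) = fv \<phi> \<union> fv \<psi>"
| "fv (All \<phi>) = {i. Suc i \<in> fv \<phi>}"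

definition sentence :: "fm \<Rightarrow> bool" where
  "sentence \<phi> \<longleftrightarrow> fv \<phi> = {}"

subsection \<open>The standard model\<close>

primrec tval :: "(nat \<Rightarrow> nat) \<Rightarrow> tm \<Rightarrow> nat" where
  "tval e (Var i) = e i"
| "tval e Zero = 0"
| "tval e (Succ t) = Suc (tval e t)"
| "tval e (Add s t) = tval e s + tval e t"
| "tval e (Mul s t) = tval e s * tval e t"

primrec sat :: "(nat \<Rightarrow> nat) \<Rightarrow> fm \<Rightarrow> bool" where
  "sat e Fls \<longleftrightarrow> False"
| "sat e (Eq s t) \<longleftrightarrow> tval e s = tval e t"
| "sat e (Lt s t) \<longleftrightarrow> tval e s < tval e t"
| "sat e (Imp \<phi> \<psi>) \<longleftrightarrow> (sat e \<phi> \<longrightarrow> sat e \<psi>)"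
| "sat e (All \<phi>) \<longleftrightarrow> (\<forall>x. sat (case_nat x e) \<phi>)"

definition true_in_N :: "fm \<Rightarrow> bool" where
  "true_in_N \<phi> \<longleftrightarrow> (\<forall>e. sat e \<phi>)"

subsection \<open>The arithmetical hierarchy\<close>

inductive delta0 :: "fm \<Rightarrow> bool" where
  "delta0 Fls"
| "delta0 (Eq s t)"
| "delta0 (Lt s t)"
| "delta0 \<phi> \<Longrightarrow> delta0 \<psi> \<Longrightarrow> delta0 (Imp \<phi> \<psi>)"
| "delta0 \<phi> \<Longrightarrow> delta0 (All (Imp (Lt (Var 0) (lift t)) \<phi>))"

inductive sigma1 :: "fm \<Rightarrow> bool" where
  "delta0 \<phi> \<Longrightarrow> sigma1 \<phi>"
| "sigma1 \<phi> \<Longrightarrow> sigma1 (Ex \<phi>)"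

inductive pi1 :: "fm \<Rightarrow> bool" where
  "delta0 \<phi> \<Longrightarrow> pi1 \<phi>"
| "pi1 \<phi> \<Longrightarrow> pi1 (All \<phi>)"

subsection \<open>Provability\<close>

text \<open>
  A Hilbert calculus for classical first-order logic with equality. Generalization is
  unrestricted, so an axiom with free variables stands for its universal closure.
\<close>

inductive prv :: "fm set \<Rightarrow> fm \<Rightarrow> bool" (infix "\<turnstile>" 50) for T :: "fm set" where
  Ax: "\<phi> \<in> T \<Longrightarrow> T \<turnstile> \<phi>"
| ImpK: "T \<turnstile> Imp \<phi> (Imp \<psi> \<phi>)"
| ImpS: "T \<turnstile> Imp (Imp \<phi> (Imp \<psi> \<chi>)) (Imp (Imp \<phi> \<psi>) (Imp \<phi> \<chi>))"
| DNeg: "T \<turnstile> Imp (Neg (Neg \<phi>)) \<phi>"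
| AllE: "T \<turnstile> Imp (All \<phi>) (inst \<phi> t)"
| AllImp: "T \<turnstile> Imp (All (Imp \<phi> \<psi>)) (Imp (All \<phi>) (All \<psi>))"
| AllI: "T \<turnstile> Imp \<phi> (All (lift_fm \<phi>))"
| EqRefl: "T \<turnstile> Eq t t"
| EqSubst: "T \<turnstile> Imp (Eq s t) (Imp (inst \<phi> s) (inst \<phi> t))"
| MP: "T \<turnstile> Imp \<phi> \<psi> \<Longrightarrow> T \<turnstile> \<phi> \<Longrightarrow> T \<turnstile> \<psi>"
| Gen: "T \<turnstile> \<phi> \<Longrightarrow> T \<turnstile> All \<phi>"

inductive_set PA :: "fm set" where
  "Neg (Eq (Succ (Var 0)) Zero) \<in> PA"
| "Imp (Eq (Succ (Var 0)) (Succ (Var 1))) (Eq (Var 0) (Var 1)) \<in> PA"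
| "Eq (Add (Var 0) Zero) (Var 0) \<in> PA"
| "Eq (Add (Var 0) (Succ (Var 1))) (Succ (Add (Var 0) (Var 1))) \<in> PA"
| "Eq (Mul (Var 0) Zero) Zero \<in> PA"
| "Eq (Mul (Var 0) (Succ (Var 1))) (Add (Mul (Var 0) (Var 1)) (Var 0)) \<in> PA"
| "Iff (Lt (Var 0) (Var 1)) (Ex (Eq (Add (Var 1) (Succ (Var 0))) (Var 2))) \<in> PA"
| "Imp (inst \<phi> Zero)
     (Imp (All (Imp \<phi> (subst (case_nat (Succ (Var 0)) (\<lambda>i. Var (Suc i))) \<phi>))) (All \<phi>)) \<in> PA"


section \<open>Binary strings and partial computable functions\<close>

text \<open>Bijective base-2 notation, a bijection between binary strings and natural numbers.\<close>

primrec code :: "bool list \<Rightarrow> nat" where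
  "code [] = 0"
| "code (b # bs) = 2 * code bs + (if b then 2 else 1)"

datatype recf = ZeroF | SuccF | Proj nat | Comp recf "recf list" | PrimRec recf recf | Mu recf

inductive computes :: "recf \<Rightarrow> nat list \<Rightarrow> nat \<Rightarrow> bool" where
  "computes ZeroF xs 0"
| "computes SuccF (x # xs) (Suc x)"
| "i < length xs \<Longrightarrow> computes (Proj i) xs (xs ! i)"
| "list_all2 (\<lambda>g y. computes g xs y) gs ys \<Longrightarrow> computes f ys z \<Longrightarrow> computes (Comp f gs) xs z"
| "computes f xs y \<Longrightarrow> computes (PrimRec f g) (0 # xs) y"
| "computes (PrimRec f g) (n # xs) y \<Longrightarrow> computes g (n # y # xs) z
     \<Longrightarrow> computes (PrimRec f g) (Suc n # xs) z"
| "computes f (n # xs) 0 \<Longrightarrow> (\<And>m. m < n \<Longrightarrow> \<exists>k. computes f (m # xs) (Suc k))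
     \<Longrightarrow> computes (Mu f) xs n"

definition partial_computable :: "(bool list \<Rightarrow> bool list option) \<Rightarrow> bool" where
  "partial_computable D \<longleftrightarrow>
     (\<exists>f. \<forall>p y. computes f [code p] y \<longleftrightarrow> (\<exists>x. D p = Some x \<and> y = code x))"

text \<open>Plain complexity; it is infinite if no program produces \<open>x\<close>.\<close>

definition plain_complexity :: "(bool list \<Rightarrow> bool list option) \<Rightarrow> bool list \<Rightarrow> enat" where
  "plain_complexity D x = (INF p\<in>{p. D p = Some x}. enat (length p))"


section \<open>Complexity in the language of arithmetic\<close>

text \<open>\<open>r = a mod m\<close>\<close>

definition mod_fm :: "tm \<Rightarrow> tm \<Rightarrow> tm \<Rightarrow> fm" where
  "mod_fm a m r = Con (Lt r m) (Ex (Eq (lift a) (Add (Mul (Var 0) (lift m)) (lift r))))"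

text \<open>Goedel's beta function: \<open>v = a mod (1 + (i + 1) * b)\<close>\<close>

definition beta_fm :: "tm \<Rightarrow> tm \<Rightarrow> tm \<Rightarrow> tm \<Rightarrow> fm" where
  "beta_fm a b i v = mod_fm a (Succ (Mul (Succ i) b)) v"

text \<open>\<open>u = 2 ^ k\<close>: some pair \<open>(a, b)\<close> codes a sequence that starts with 1, doubles at each
  of the first \<open>k\<close> steps, and has \<open>k\<close>-th entry \<open>u\<close>.\<close>

definition pow2_fm :: "tm \<Rightarrow> tm \<Rightarrow> fm" where
  "pow2_fm k u = Ex (Ex (Con (beta_fm (Var 1) (Var 0) Zero (Succ Zero))
     (Con (All (Imp (Lt (Var 0) (lift (lift (lift k))))
             (All (Imp (beta_fm (Var 3) (Var 2) (Var 1) (Var 0))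
                       (beta_fm (Var 3) (Var 2) (Succ (Var 1)) (Add (Var 0) (Var 0)))))))
          (beta_fm (Var 1) (Var 0) (lift (lift k)) (lift (lift u))))))"

text \<open>The string with code \<open>p\<close> has length \<open>k\<close>, i.e. \<open>2 ^ k \<le> p + 1 < 2 ^ (k + 1)\<close>.\<close>

definition len_fm :: "tm \<Rightarrow> tm \<Rightarrow> fm" where
  "len_fm p k = Ex (Con (pow2_fm (lift k) (Var 0))
     (Con (Neg (Lt (Succ (lift p)) (Var 0))) (Lt (Succ (lift p)) (Add (Var 0) (Var 0)))))"

text \<open>\<open>k = min {|p| : D(p) = x}\<close>, where \<open>\<delta>(p,x)\<close> represents \<open>D(p) = x\<close>.\<close>

definition complexity_fm :: "fm \<Rightarrow> tm \<Rightarrow> tm \<Rightarrow> fm" where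
  "complexity_fm \<delta> x k =
     Con (Ex (Con (inst2 \<delta> (Var 0) (lift x)) (len_fm (Var 0) (lift k))))
         (All (All (Imp (Con (inst2 \<delta> (Var 1) (lift (lift x))) (len_fm (Var 1) (Var 0)))
                        (Neg (Lt (Var 0) (lift (lift k)))))))"

text \<open>\<open>C(x) \<ge> t\<close> for a real \<open>t\<close>; as complexities are natural numbers, this is
  \<open>C(x) \<ge> max 0 \<lceil>t\<rceil>\<close>.\<close>

definition complexity_ge :: "fm \<Rightarrow> bool list \<Rightarrow> real \<Rightarrow> fm" where
  "complexity_ge \<delta> x t =
     All (Imp (complexity_fm \<delta> (num_tm (code x)) (Var 0))
              (Neg (Lt (Var 0) (num_tm (nat \<lceil>t\<rceil>)))))"

text \<open>
  A representation of \<open>D\<close> in arithmetic: a \<open>\<Sigma>\<^sub>1\<close> formula that defines the graph of \<open>D\<close>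
  and is functional provably in \<open>PA\<close>. The formulas obtained from algorithms are of this form;
  conversely, each formula of this form is provably equivalent to the one obtained
  from the algorithm searching for an output together with a witness.
\<close>

definition represents :: "fm \<Rightarrow> (bool list \<Rightarrow> bool list option) \<Rightarrow> bool" where
  "represents \<delta> D \<longleftrightarrow>
     sigma1 \<delta> \<and> fv \<delta> \<subseteq> {0, 1} \<and>
     (\<forall>p x e. sat (case_nat (code p) (case_nat (code x) e)) \<delta> \<longleftrightarrow> D p = Some x) \<and>
     PA \<turnstile> All (All (All (Imp (inst2 \<delta> (Var 2) (Var 1))
                        (Imp (inst2 \<delta> (Var 2) (Var 0)) (Eq (Var 1) (Var 0))))))"

definition provably_optimal :: "fm \<Rightarrow> bool" where
  "provably_optimal \<delta> \<longleftrightarrow>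
     (\<forall>D' \<delta>'. partial_computable D' \<longrightarrow> represents \<delta>' D' \<longrightarrow>
        (\<exists>c'. PA \<turnstile> All (All (Imp (complexity_fm \<delta>' (Var 1) (Var 0))
                (Ex (Con (complexity_fm \<delta> (Var 2) (Var 0))
                         (Neg (Lt (Add (Var 1) (num_tm c')) (Var 0)))))))))"


section \<open>Adequacy in the standard model\<close>

lemma tval_subst: "tval e (subst_tm \<sigma> t) = tval (\<lambda>i. tval e (\<sigma> i)) t"
  by (induction t) auto

lemma sat_subst: "sat e (subst \<sigma> \<phi>) \<longleftrightarrow> sat (\<lambda>i. tval e (\<sigma> i)) \<phi>"
proof (induction \<phi> arbitrary: e \<sigma>)
  case (All \<phi>)
  have "(\<lambda>i. tval (case_nat x e) (case_nat (Var 0) (\<lambda>i. lift (\<sigma> i)) i))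
      = case_nat x (\<lambda>i. tval e (\<sigma> i))" for x
    by (auto simp: fun_eq_iff tval_subst split: nat.split)
  then show ?case by (simp add: All)
qed (auto simp: tval_subst)

lemma tval_lift [simp]: "tval (case_nat x e) (lift t) = tval e t"
  by (simp add: tval_subst)

lemma tval_num [simp]: "tval e (num_tm n) = n"
  by (induction n) auto

lemma sat_inst [simp]: "sat e (inst \<phi> t) \<longleftrightarrow> sat (case_nat (tval e t) e) \<phi>"
proof -
  have "(\<lambda>i. tval e (case_nat t Var i)) = case_nat (tval e t) e"
    by (auto simp: fun_eq_iff split: nat.split)
  then show ?thesis by (simp add: inst_def sat_subst)
qed

lemma sat_inst2 [simp]:
  "sat e (inst2 \<phi> s t) \<longleftrightarrow> sat (case_nat (tval e s) (case_nat (tval e t) e)) \<phi>"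
proof -
  have "(\<lambda>i. tval e (case_nat s (case_nat t Var) i)) = case_nat (tval e s) (case_nat (tval e t) e)"
    by (auto simp: fun_eq_iff split: nat.split)
  then show ?thesis by (simp add: inst2_def sat_subst)
qed

lemma sat_lift_fm [simp]: "sat (case_nat x e) (lift_fm \<phi>) \<longleftrightarrow> sat e \<phi>"
  by (simp add: lift_fm_def sat_subst)

lemma soundness: "T \<turnstile> \<phi> \<Longrightarrow> \<forall>\<psi>\<in>T. true_in_N \<psi> \<Longrightarrow> sat e \<phi>"
  by (induction arbitrary: e rule: prv.induct) (auto simp: true_in_N_def)

lemma PA_true: "\<phi> \<in> PA \<Longrightarrow> true_in_N \<phi>"
proof (induction rule: PA.induct)
  case 7 then show ?case by (simp add: true_in_N_def less_iff_Suc_add numeral_2_eq_2) metis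
next
  case (8 \<phi>)
  have *: "(\<lambda>i. tval (case_nat x e) (case_nat (Succ (Var 0)) (\<lambda>i. Var (Suc i)) i)) = case_nat (Suc x) e" for x e
    by (auto simp: fun_eq_iff split: nat.split)
  show ?case unfolding true_in_N_def
    apply (simp add: sat_subst * )
    apply (intro allI impI) 
    subgoal for e x by (induction x) auto
    done
qed (auto simp: true_in_N_def)

lemma sat_mod: "sat e (mod_fm a m r) \<longleftrightarrow> tval e m > 0 \<and> tval e r = tval e a mod tval e m"
  by (auto simp: mod_fm_def) (metis mult.commute div_mult_mod_eq)

lemma sat_beta: "sat e (beta_fm a b i v) \<longleftrightarrow> tval e v = tval e a mod Suc (Suc (tval e i) * tval e b)"
  by (simp add: beta_fm_def sat_mod)

lemma beta_lemma: "\<exists>a b. \<forall>i\<le>k. a mod Suc (Suc i * b) = (f i :: nat)"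
proof -
  define s where "s = Suc k + (\<Sum>i\<le>k. f i)"
  define b where "b = (fact s :: nat)"
  let ?m = "\<lambda>i. Suc (Suc i * b)"
  have cop: "coprime (?m i) (?m j)" if "i \<le> k" "j \<le> k" "i < j" for i j
  proof (rule ccontr)
    assume "\<not> coprime (?m i) (?m j)"
    then have "gcd (?m i) (?m j) \<noteq> 1" by (simp only: coprime_iff_gcd_eq_1) simp
    then obtain p where "prime p" "p dvd gcd (?m i) (?m j)" using prime_factor_nat by blast
    then have p: "prime p" "p dvd ?m i" "p dvd ?m j" by (auto dest: dvd_trans)
    have "p dvd Suc j * ?m i - Suc i * ?m j" using p by (meson dvd_diff_nat dvd_mult)
    also have "Suc j * ?m i - Suc i * ?m j = j - i" by (simp add: algebra_simps)
    finally have "p \<le> j - i" using that by (auto dest: dvd_imp_le)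
    then have "p \<le> s" using that by (simp add: s_def)
    then have "p dvd b" using p(1) prime_gt_0_nat[of p] unfolding b_def by (intro dvd_fact) auto
    then have "p dvd ?m i - Suc i * b" using p(2) by (meson dvd_diff_nat dvd_mult)
    then show False using p(1) by simp
  qed
  have "\<exists>x. \<forall>i\<in>{..k}. [x = f i] (mod ?m i)"
  proof (rule chinese_remainder_nat)
    show "\<forall>i\<in>{..k}. \<forall>j\<in>{..k}. i \<noteq> j \<longrightarrow> coprime (?m i) (?m j)"
      using cop by (metis atMost_iff coprime_commute linorder_neqE_nat)
  qed auto
  then obtain x where x: "\<And>i. i \<le> k \<Longrightarrow> [x = f i] (mod ?m i)" by auto
  have "f i < ?m i" if "i \<le> k" for i
  proof -
    have "f i \<le> (\<Sum>i\<le>k. f i)" using that by (intro member_le_sum) auto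
    also have "\<dots> \<le> s" by (simp add: s_def)
    also have "\<dots> \<le> b" unfolding b_def by (rule fact_ge_self)
    finally show ?thesis by simp
  qed
  then show ?thesis using x by (metis cong_def mod_less)
qed

lemma sat_pow2: "sat e (pow2_fm k u) \<longleftrightarrow> tval e u = 2 ^ tval e k"
proof -
  let ?k = "tval e k"
  have "sat e (pow2_fm k u) \<longleftrightarrow> (\<exists>a b. Suc 0 = a mod Suc (Suc 0 * b) \<and>
     (\<forall>i<?k. a mod Suc (Suc i * b) + a mod Suc (Suc i * b) = a mod Suc (Suc (Suc i) * b)) \<and>
     tval e u = a mod Suc (Suc ?k * b))" (is "_ \<longleftrightarrow> ?R")
    by (simp add: pow2_fm_def sat_beta numeral_2_eq_2 numeral_3_eq_3 del: mult_Suc add_Suc)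
  also have "\<dots> \<longleftrightarrow> tval e u = 2 ^ ?k"
  proof
    assume ?R
    then obtain a b where ab: "Suc 0 = a mod Suc (Suc 0 * b)"
     "\<And>i. i<?k \<Longrightarrow> a mod Suc (Suc i * b) + a mod Suc (Suc i * b) = a mod Suc (Suc (Suc i) * b)"
     "tval e u = a mod Suc (Suc ?k * b)" by blast
    have "i \<le> ?k \<Longrightarrow> a mod Suc (Suc i * b) = 2 ^ i" for i
    proof (induction i)
      case 0 show ?case using ab(1)[symmetric] by simp
    next
      case (Suc i) then show ?case using ab(2)[of i] by simp
    qed
    then show "tval e u = 2 ^ ?k" using ab(3) by simp
  next
    assume u: "tval e u = 2 ^ ?k"
    obtain a b where ab: "\<And>i. i\<le>?k \<Longrightarrow> a mod Suc (Suc i * b) = 2 ^ i"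
      using beta_lemma[of ?k "\<lambda>i. 2^i"] by blast
    show ?R
      apply (rule exI[of _ a], rule exI[of _ b])
      using ab[of 0] u by (auto simp: ab simp del: mult_Suc)
  qed
  finally show ?thesis .
qed

lemma bij_code: "bij code"
proof (rule bijI)
  show "inj code"
  proof (rule injI)
    fix x y show "code x = code y \<Longrightarrow> x = y"
    proof (induction x arbitrary: y)
      case Nil then show ?case by (cases y) (auto split: if_splits)
    next
      case (Cons b x) then show ?case
        by (cases y) (auto split: if_splits, presburger+)
    qed
  qed
  show "surj code"
  proof -
    have "\<exists>x. code x = n" for n
    proof (induction n rule: less_induct)
      case (less n)
      show ?case
      proof (cases "n = 0")
        case True then show ?thesis by (intro exI[of _ "[]"]) simp
      next
        case False
        then obtain x where x: "code x = (n - 1) div 2" using less[of "(n-1) div 2"] by fastforce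
        show ?thesis using x False by (intro exI[of _ "even n # x"]) (auto elim!: evenE oddE)
      qed
    qed
    then show ?thesis by (metis surjI)
  qed
qed

lemma code_length: "2 ^ length x \<le> Suc (code x) \<and> Suc (code x) < 2 ^ Suc (length x)"
  by (induction x) auto

lemma sat_len: "tval e p = code x \<Longrightarrow> sat e (len_fm p k) \<longleftrightarrow> tval e k = length x"
proof -
  assume "tval e p = code x"
  then have "sat e (len_fm p k) \<longleftrightarrow> 2 ^ tval e k \<le> Suc (code x) \<and> Suc (code x) < 2 ^ Suc (tval e k)"
    by (auto simp: len_fm_def sat_pow2)
  also have "\<dots> \<longleftrightarrow> tval e k = length x"
  proof
    assume *: "2 ^ tval e k \<le> Suc (code x) \<and> Suc (code x) < 2 ^ Suc (tval e k)"
    have "(2::nat) ^ tval e k < 2 ^ Suc (length x)" "(2::nat) ^ length x < 2 ^ Suc (tval e k)"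
      using * code_length[of x] by linarith+
    then have "tval e k < Suc (length x)" "length x < Suc (tval e k)"
      by (simp_all only: power_strict_increasing_iff one_less_numeral_iff Num.num.simps semiring_norm)
    then show "tval e k = length x" by simp
  next
    assume "tval e k = length x"
    then show "2 ^ tval e k \<le> Suc (code x) \<and> Suc (code x) < 2 ^ Suc (tval e k)"
      using code_length[of x] by simp
  qed
  finally show ?thesis .
qed

lemma sat_complexity:
  assumes \<delta>: "represents \<delta> D" and x: "tval e t = code x"
  shows "sat e (complexity_fm \<delta> t k) \<longleftrightarrow> plain_complexity D x = enat (tval e k)"
proof -
  have d: "sat (case_nat (code p) (case_nat (code x) e)) \<delta> \<longleftrightarrow> D p = Some x" for p x e
    using \<delta> by (simp add: represents_def)
  have q: "(\<exists>n. P n) \<longleftrightarrow> (\<exists>y. P (code y))" "(\<forall>n j. Q n j) \<longleftrightarrow> (\<forall>y j. Q (code y) j)"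
    for P and Q :: "nat \<Rightarrow> nat \<Rightarrow> bool"
    using bij_code by (metis bij_pointE)+
  have l: "sat (case_nat (code p) e') (len_fm (Var 0) k') \<longleftrightarrow> tval (case_nat (code p) e') k' = length p" for p e' k'
    by (rule sat_len) simp
  have l1: "sat (case_nat j (case_nat (code p) e')) (len_fm (Var 1) (Var 0)) \<longleftrightarrow> j = length p" for p e' j
    by (subst sat_len[of _ _ p]) auto
  have "sat e (complexity_fm \<delta> t k) \<longleftrightarrow>
     (\<exists>p. D p = Some x \<and> tval e k = length p) \<and> (\<forall>p. D p = Some x \<longrightarrow> \<not> length p < tval e k)"
    (is "_ \<longleftrightarrow> ?R")
  proof -
    have "sat e (complexity_fm \<delta> t k) \<longleftrightarrow>
      (\<exists>n. sat (case_nat n e) (inst2 \<delta> (Var 0) (lift t)) \<and> sat (case_nat n e) (len_fm (Var 0) (lift k))) \<and>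
      (\<forall>n j. sat (case_nat j (case_nat n e)) (inst2 \<delta> (Var 1) (lift (lift t))) \<longrightarrow>
         sat (case_nat j (case_nat n e)) (len_fm (Var 1) (Var 0)) \<longrightarrow> \<not> j < tval e k)"
      by (auto simp: complexity_fm_def)
    also have "\<dots> \<longleftrightarrow> ?R" unfolding q by (simp add: x d l l1[simplified])
    finally show ?thesis .
  qed
  also have "\<dots> \<longleftrightarrow> plain_complexity D x = enat (tval e k)"
  proof
    assume *: "(\<exists>p. D p = Some x \<and> tval e k = length p) \<and> (\<forall>p. D p = Some x \<longrightarrow> \<not> length p < tval e k)"
    then show "plain_complexity D x = enat (tval e k)"
      unfolding plain_complexity_def by (intro antisym INF_greatest) (auto intro!: INF_lower2)
  next
    assume *: "plain_complexity D x = enat (tval e k)"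
    have ne: "{p. D p = Some x} \<noteq> {}" 
    proof
      assume "{p. D p = Some x} = {}"
      then show False using * by (simp add: plain_complexity_def top_enat_def)
    qed
    then have "plain_complexity D x \<in> (\<lambda>p. enat (length p)) ` {p. D p = Some x}"
      unfolding plain_complexity_def by (metis empty_is_image wellorder_InfI ex_in_conv)
    moreover have "plain_complexity D x \<le> enat (length p)" if "D p = Some x" for p
      unfolding plain_complexity_def using that by (intro INF_lower2[of p]) auto
    ultimately show "(\<exists>p. D p = Some x \<and> tval e k = length p) \<and> (\<forall>p. D p = Some x \<longrightarrow> \<not> length p < tval e k)"
      using * by force
  qed
  finally show ?thesis .
qed

lemma sat_complexity_ge:
  assumes "represents \<delta> D"
  shows "sat e (complexity_ge \<delta> x t) \<longleftrightarrow> (\<forall>k. plain_complexity D x = enat k \<longrightarrow> t \<le> real k)"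
proof -
  have "sat (case_nat k e) (complexity_fm \<delta> (num_tm (code x)) (Var 0)) \<longleftrightarrow> plain_complexity D x = enat k" for k
    by (subst sat_complexity[OF assms, of _ _ x]) auto
  then show ?thesis
    by (simp add: complexity_ge_def not_less)
qed

end

theory Submission
  imports Defs "HOL-Library.Countable_Set" "HOL-Library.Nat_Bijection"
begin

text \<open>
  Let \<open>\<phi>\<close> be a true \<open>\<Pi>\<^sub>1\<close> sentence that \<open>PA\<close> does not prove, and \<open>M\<close> a model of \<open>PA\<close> in which
  \<open>\<phi>\<close> fails. Call a finite tuple of strings bad if \<open>PA\<close> together with the axioms for its members
  proves \<open>\<phi>\<close>. Bad tuples can be enumerated, and each of them meets the sets \<open>X\<^sub>n\<close> of strings of
  length \<open>n\<close> whose axiom fails in \<open>M\<close>. These sets are small, as \<open>PA\<close> can count short programs, but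
  they are not computable. An online primal-dual algorithm replaces them by enumerable sets
  \<open>Y\<^sub>n\<close> that still meet every bad tuple: a tuple not met so far puts a small weight on each of its
  members, and a member enters \<open>Y\<^sub>n\<close> as soon as its weight reaches \<open>n\<^sup>6 / 2\<^sup>n\<close>. Each tuple has
  only one member of every length, so the size of \<open>Y\<^sub>n\<close> is controlled by the total weight, which
  in turn is charged to the sets \<open>X\<^sub>n\<close>. Hence the members of \<open>Y\<^sub>n\<close> have complexity at most
  \<open>n - 4 log n + O(1)\<close>. If \<open>\<phi>\<close> were provable, some tuple of the \<open>r\<^sub>n\<close> with all \<open>n\<close> large would be
  bad, because the axioms for small \<open>n\<close> are void when \<open>c\<close> is large, and so some \<open>r\<^sub>n\<close> would have
  too small complexity.
\<close>

section \<open>Substitution\<close>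

text \<open>No counting takes place inside \<open>M\<close>. The sets X_n contain standard strings
  having a standard short program in \<open>M\<close>. A nonstandard \<open>M\<close> may invent
  outputs, but functionality is provable, so each program still has at most one output.
  \<open>M\<close> serves only to bound the total weight; the enumeration never consults it.

  The exponents fit together as follows. A cover of size about 2^n / n^8 against capacities n^6 /
  2^n gives a total weight of at most the sum of 4 / n^2. Dividing by the capacity leaves at most 4
  * 2^n / n^6 entering elements on level n. Storing n next to the position costs a factor of order
  n^2, so the codes stay below 16 * 2^n / n^4.

  The order of the constants matters. Badness is expressed by (p + 1) n^8 <= x + 1, which does not
  mention c, and the least length of a tuple is one of its parameters. So the enumeration and its
  optimality constant are fixed before c and the starting length are chosen.

  Completeness is needed to obtain \<open>M\<close>, and it also replaces formal derivations in PA
  by arguments in arbitrary models.\<close>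

abbreviation up :: "(nat \<Rightarrow> tm) \<Rightarrow> nat \<Rightarrow> tm" where
  "up \<sigma> \<equiv> case_nat (Var 0) (\<lambda>i. lift (\<sigma> i))"

lemma subst_tm_subst_tm: "subst_tm \<sigma> (subst_tm \<tau> t) = subst_tm (\<lambda>i. subst_tm \<sigma> (\<tau> i)) t"
  by (induction t) auto

lemma subst_tm_Var [simp]: "subst_tm Var t = t"
  by (induction t) auto

lemma subst_tm_cong: "(\<And>i. i \<in> fv_tm t \<Longrightarrow> \<sigma> i = \<tau> i) \<Longrightarrow> subst_tm \<sigma> t = subst_tm \<tau> t"
  by (induction t) auto

lemma subst_cong: "(\<And>i. i \<in> fv \<phi> \<Longrightarrow> \<sigma> i = \<tau> i) \<Longrightarrow> subst \<sigma> \<phi> = subst \<tau> \<phi>"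
proof (induction \<phi> arbitrary: \<sigma> \<tau>)
  case (All \<phi>)
  have "subst (up \<sigma>) \<phi> = subst (up \<tau>) \<phi>"
    by (rule All.IH) (auto split: nat.split intro!: arg_cong[where f=lift] All.prems)
  then show ?case by simp
next
  case (Imp \<phi> \<psi>)
  then show ?case by (metis UnI1 UnI2 fv.simps(4) subst.simps(4))
qed (auto intro!: subst_tm_cong)

lemma up_comp: "subst_tm (up \<sigma>) (up \<tau> i) = up (\<lambda>i. subst_tm \<sigma> (\<tau> i)) i"
  by (auto simp: subst_tm_subst_tm split: nat.split)

lemma subst_subst: "subst \<sigma> (subst \<tau> \<phi>) = subst (\<lambda>i. subst_tm \<sigma> (\<tau> i)) \<phi>"
  by (induction \<phi> arbitrary: \<sigma> \<tau>) (auto simp: subst_tm_subst_tm up_comp)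

lemma up_Var: "case_nat (Var 0) (\<lambda>i. Var (Suc i)) = Var"
  by (rule ext) (simp split: nat.split)

lemma subst_Var [simp]: "subst Var \<phi> = \<phi>"
proof (induction \<phi>)
  case (All \<phi>)
  then show ?case by (simp add: up_Var)
qed auto

text \<open>Lets a simultaneous substitution be assembled one quantifier at a time, both when
  generalized theorems are instantiated and in the quantifier case of the truth lemma.\<close>

lemma inst_subst_up: "inst (subst (up \<sigma>) \<phi>) t = subst (case_nat t \<sigma>) \<phi>"
  unfolding inst_def subst_subst
  by (rule arg_cong[where f="\<lambda>s. subst s \<phi>"])
     (auto simp: fun_eq_iff subst_tm_subst_tm split: nat.split)

lemma finite_fv_tm [simp]: "finite (fv_tm t)"
  by (induction t) auto

lemma finite_fv [simp]: "finite (fv \<phi>)"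
proof (induction \<phi>)
  case (All \<phi>)
  have "fv (All \<phi>) = (\<lambda>i. i - 1) ` (fv \<phi> - {0})"
    by (auto simp: image_iff) (metis Suc_pred not_gr0 diff_Suc_1 insertE DiffI singletonD nat.distinct(1) Suc_eq_plus1)
  then show ?case using All by simp
qed auto

lemma fv_subst_tm: "fv_tm (subst_tm \<sigma> t) = (\<Union>i\<in>fv_tm t. fv_tm (\<sigma> i))"
  by (induction t) auto

lemma fv_subst: "fv (subst \<sigma> \<phi>) = (\<Union>i\<in>fv \<phi>. fv_tm (\<sigma> i))"
proof (induction \<phi> arbitrary: \<sigma>)
  case (All \<phi>)
  have "Suc j \<in> fv_tm (up \<sigma> i) \<longleftrightarrow> (\<exists>k. i = Suc k \<and> j \<in> fv_tm (\<sigma> k))" for i j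
    by (auto simp: fv_subst_tm split: nat.split)
  then show ?case by (auto simp: All)
qed (auto simp: fv_subst_tm)

lemma fv_num_tm [simp]: "fv_tm (num_tm n) = {}"
  by (induction n) auto

section \<open>Structures and models\<close>

text \<open>The universe is the whole type. Since HOL cannot quantify over types, "all models" will
  mean all structures of type \<open>nat str\<close>, so the completeness proof has to produce a
  model carried by exactly \<open>nat\<close>.\<close>

record 'a str =
  zer :: 'a
  suc :: "'a \<Rightarrow> 'a"
  add :: "'a \<Rightarrow> 'a \<Rightarrow> 'a"
  mul :: "'a \<Rightarrow> 'a \<Rightarrow> 'a"
  les :: "'a \<Rightarrow> 'a \<Rightarrow> bool"

primrec mtval :: "'a str \<Rightarrow> (nat \<Rightarrow> 'a) \<Rightarrow> tm \<Rightarrow> 'a" where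
  "mtval M e (Var i) = e i"
| "mtval M e Zero = zer M"
| "mtval M e (Succ t) = suc M (mtval M e t)"
| "mtval M e (Add s t) = add M (mtval M e s) (mtval M e t)"
| "mtval M e (Mul s t) = mul M (mtval M e s) (mtval M e t)"

primrec msat :: "'a str \<Rightarrow> (nat \<Rightarrow> 'a) \<Rightarrow> fm \<Rightarrow> bool" where
  "msat M e Fls \<longleftrightarrow> False"
| "msat M e (Eq s t) \<longleftrightarrow> mtval M e s = mtval M e t"
| "msat M e (Lt s t) \<longleftrightarrow> les M (mtval M e s) (mtval M e t)"
| "msat M e (Imp \<phi> \<psi>) \<longleftrightarrow> (msat M e \<phi> \<longrightarrow> msat M e \<psi>)"
| "msat M e (All \<phi>) \<longleftrightarrow> (\<forall>x. msat M (case_nat x e) \<phi>)"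

definition models :: "'a str \<Rightarrow> fm set \<Rightarrow> bool" where
  "models M T \<longleftrightarrow> (\<forall>\<phi>\<in>T. \<forall>e. msat M e \<phi>)"

lemma mtval_subst: "mtval M e (subst_tm \<sigma> t) = mtval M (\<lambda>i. mtval M e (\<sigma> i)) t"
  by (induction t) auto

lemma mtval_lift [simp]: "mtval M (case_nat x e) (lift t) = mtval M e t"
  by (simp add: mtval_subst)

lemma msat_subst: "msat M e (subst \<sigma> \<phi>) \<longleftrightarrow> msat M (\<lambda>i. mtval M e (\<sigma> i)) \<phi>"
proof (induction \<phi> arbitrary: e \<sigma>)
  case (All \<phi>)
  have "(\<lambda>i. mtval M (case_nat x e) (up \<sigma> i)) = case_nat x (\<lambda>i. mtval M e (\<sigma> i))" for x
    by (auto simp: fun_eq_iff mtval_subst split: nat.split)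
  then show ?case by (simp add: All)
qed (auto simp: mtval_subst)

lemma msat_inst [simp]: "msat M e (inst \<phi> t) \<longleftrightarrow> msat M (case_nat (mtval M e t) e) \<phi>"
proof -
  have "(\<lambda>i. mtval M e (case_nat t Var i)) = case_nat (mtval M e t) e"
    by (auto simp: fun_eq_iff split: nat.split)
  then show ?thesis by (simp add: inst_def msat_subst)
qed

lemma msat_inst2 [simp]:
  "msat M e (inst2 \<phi> s t) \<longleftrightarrow> msat M (case_nat (mtval M e s) (case_nat (mtval M e t) e)) \<phi>"
proof -
  have "(\<lambda>i. mtval M e (case_nat s (case_nat t Var) i)) = case_nat (mtval M e s) (case_nat (mtval M e t) e)"
    by (auto simp: fun_eq_iff split: nat.split)
  then show ?thesis by (simp add: inst2_def msat_subst)
qed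

lemma msat_lift_fm [simp]: "msat M (case_nat x e) (lift_fm \<phi>) \<longleftrightarrow> msat M e \<phi>"
  by (simp add: lift_fm_def msat_subst)

lemma mtval_cong: "(\<And>i. i \<in> fv_tm t \<Longrightarrow> e i = e' i) \<Longrightarrow> mtval M e t = mtval M e' t"
  by (induction t) auto

lemma msat_cong: "(\<And>i. i \<in> fv \<phi> \<Longrightarrow> e i = e' i) \<Longrightarrow> msat M e \<phi> \<longleftrightarrow> msat M e' \<phi>"
proof (induction \<phi> arbitrary: e e')
  case (All \<phi>)
  have "msat M (case_nat x e) \<phi> \<longleftrightarrow> msat M (case_nat x e') \<phi>" for x
    by (rule All.IH) (auto split: nat.split intro: All.prems)
  then show ?case by simp
next
  case (Imp \<phi> \<psi>)
  then show ?case by (metis UnI1 UnI2 fv.simps(4) msat.simps(4))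
next
  case (Eq s t)
  then show ?case using mtval_cong[of s e e' M] mtval_cong[of t e e' M] by simp
next
  case (Lt s t)
  then show ?case using mtval_cong[of s e e' M] mtval_cong[of t e e' M] by simp
qed auto

lemma msoundness: "T \<turnstile> \<phi> \<Longrightarrow> models M T \<Longrightarrow> msat M e \<phi>"
  by (induction arbitrary: e rule: prv.induct) (auto simp: models_def)

section \<open>Completeness\<close>

lemma prv_mono: "T \<turnstile> \<phi> \<Longrightarrow> T \<subseteq> U \<Longrightarrow> U \<turnstile> \<phi>"
  by (induction rule: prv.induct) (auto intro: prv.intros)

lemma prv_compact: "T \<turnstile> \<phi> \<Longrightarrow> \<exists>F. finite F \<and> F \<subseteq> T \<and> F \<turnstile> \<phi>"
proof (induction rule: prv.induct)
  case (Ax \<phi>)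
  then show ?case by (intro exI[of _ "{\<phi>}"]) (auto intro: prv.Ax)
next
  case (MP \<phi> \<psi>)
  then obtain F G where "finite F" "F \<subseteq> T" "F \<turnstile> Imp \<phi> \<psi>" "finite G" "G \<subseteq> T" "G \<turnstile> \<phi>"
    by blast
  then show ?case
    by (intro exI[of _ "F \<union> G"]) (auto intro: prv.MP[of _ \<phi>] prv_mono)
next
  case (Gen \<phi>)
  then show ?case by (auto intro: prv.Gen)
qed (rule exI[of _ "{}"], auto intro: prv.intros)+

text \<open>The calculus instantiates one variable at a time. After \<open>n\<close>
  generalizations, \<open>AllE\<close> fills the slots in turn, the innermost quantifier last;
  variables beyond the first \<open>n\<close> have moved down by \<open>n\<close>.\<close>

lemma prv_subst_Alls:
  "T \<turnstile> (All ^^ n) \<phi> \<Longrightarrow> T \<turnstile> subst (\<lambda>i. if i < n then \<sigma> i else Var (i - n)) \<phi>"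
proof (induction n arbitrary: \<phi> \<sigma>)
  case (Suc n)
  define \<rho> where "\<rho> = (\<lambda>i. if i < n then \<sigma> (Suc i) else Var (i - n))"
  have "T \<turnstile> (All ^^ n) (All \<phi>)" using Suc.prems by (simp add: funpow_swap1)
  from Suc.IH[OF this, of "\<lambda>i. \<sigma> (Suc i)"] have "T \<turnstile> All (subst (up \<rho>) \<phi>)"
    by (simp add: \<rho>_def)
  then have "T \<turnstile> inst (subst (up \<rho>) \<phi>) (\<sigma> 0)" by (rule prv.MP[OF prv.AllE])
  moreover have "case_nat (\<sigma> 0) \<rho> = (\<lambda>i. if i < Suc n then \<sigma> i else Var (i - Suc n))"
    by (auto simp: fun_eq_iff \<rho>_def split: nat.split)
  ultimately show ?case by (simp add: inst_subst_up)
qed simp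

lemma prv_subst:
  assumes "T \<turnstile> \<phi>" shows "T \<turnstile> subst \<sigma> \<phi>"
proof -
  \<comment> \<open>With all free variables below \<open>n\<close>, the branch
    \<open>Var (i - n)\<close> is never reached.\<close>
  obtain n where n: "fv \<phi> \<subseteq> {..<n}" using finite_nat_iff_bounded finite_fv by blast
  have "T \<turnstile> (All ^^ n) \<phi>" by (induction n) (auto intro: assms prv.Gen)
  from prv_subst_Alls[OF this, of \<sigma>]
  have "T \<turnstile> subst (\<lambda>i. if i < n then \<sigma> i else Var (i - n)) \<phi>" .
  moreover have "subst (\<lambda>i. if i < n then \<sigma> i else Var (i - n)) \<phi> = subst \<sigma> \<phi>"
    using n by (intro subst_cong) auto
  ultimately show ?thesis by simp
qed

lemma prv_Imp_refl: "T \<turnstile> Imp a a"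
  using prv.MP[OF prv.MP[OF prv.ImpS[of T a "Imp a a" a] prv.ImpK] prv.ImpK] .

text \<open>Hypotheses are antecedents and not extra axioms: generalization is unrestricted in
  \<open>prv\<close>, so the deduction theorem would fail for axioms with free variables.\<close>

definition der :: "fm set \<Rightarrow> fm list \<Rightarrow> fm \<Rightarrow> bool" where
  "der T hs \<phi> \<longleftrightarrow> T \<turnstile> foldr Imp hs \<phi>"

lemma der_prv: "T \<turnstile> \<phi> \<Longrightarrow> der T hs \<phi>"
  unfolding der_def by (induction hs) (auto intro: prv.MP prv.ImpK)

lemma der_mp: "der T hs (Imp \<phi> \<psi>) \<Longrightarrow> der T hs \<phi> \<Longrightarrow> der T hs \<psi>"
proof -
  have "T \<turnstile> Imp (foldr Imp hs (Imp \<phi> \<psi>)) (Imp (foldr Imp hs \<phi>) (foldr Imp hs \<psi>))"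
  proof (induction hs)
    case Nil
    show ?case by (simp add: prv_Imp_refl)
  next
    case (Cons h hs)
    let ?a = "foldr Imp hs (Imp \<phi> \<psi>)" and ?b = "foldr Imp hs \<phi>" and ?c = "foldr Imp hs \<psi>"
    have 1: "T \<turnstile> Imp h (Imp ?a (Imp ?b ?c))" by (rule prv.MP[OF prv.ImpK Cons.IH])
    have 2: "T \<turnstile> Imp (Imp h ?a) (Imp h (Imp ?b ?c))" by (rule prv.MP[OF prv.ImpS 1])
    have 3: "T \<turnstile> Imp (Imp h ?a) (Imp (Imp h (Imp ?b ?c)) (Imp (Imp h ?b) (Imp h ?c)))"
      by (rule prv.MP[OF prv.ImpK prv.ImpS])
    show ?case using prv.MP[OF prv.MP[OF prv.ImpS 3] 2] by simp
  qed
  then show "der T hs (Imp \<phi> \<psi>) \<Longrightarrow> der T hs \<phi> \<Longrightarrow> der T hs \<psi>"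
    unfolding der_def by (blast intro: prv.MP)
qed

text \<open>The deduction theorem for hypothesis lists. By definition the head is the outermost
  antecedent; exchanging it with the others one by one makes it the innermost.\<close>

lemma der_Cons: "der T (h # hs) \<phi> \<longleftrightarrow> der T hs (Imp h \<phi>)"
proof
  have swap: "T \<turnstile> Imp (Imp h (foldr Imp hs \<phi>)) (foldr Imp hs (Imp h \<phi>))"
    and swap': "T \<turnstile> Imp (foldr Imp hs (Imp h \<phi>)) (Imp h (foldr Imp hs \<phi>))"
  proof (induction hs)
    case Nil
    { case 1 show ?case by (simp add: prv_Imp_refl) next case 2 show ?case by (simp add: prv_Imp_refl) }
  next
    case (Cons g hs)
    \<comment> \<open>\<open>C\<close> is transitivity, \<open>X\<close> exchange of two
      antecedents, \<open>M\<close> monotonicity under an antecedent.\<close>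
    have C: "T \<turnstile> Imp a c" if "T \<turnstile> Imp a b" "T \<turnstile> Imp b c" for a b c
      using prv.MP[OF prv.MP[OF prv.ImpS prv.MP[OF prv.ImpK that(2)]] that(1)] .
    have X: "T \<turnstile> Imp (Imp a (Imp b c)) (Imp b (Imp a c))" for a b c
    proof -
      have "T \<turnstile> Imp (Imp (Imp a b) (Imp a c)) (Imp b (Imp a c))"
      proof -
        have 1: "T \<turnstile> Imp (Imp (Imp a b) (Imp a c)) (Imp b (Imp (Imp a b) (Imp a c)))"
          by (rule prv.ImpK)
        have 2: "T \<turnstile> Imp (Imp b (Imp (Imp a b) (Imp a c))) (Imp (Imp b (Imp a b)) (Imp b (Imp a c)))"
          by (rule prv.ImpS)
        have 3: "T \<turnstile> Imp (Imp (Imp b (Imp a b)) (Imp b (Imp a c))) (Imp b (Imp a c))"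
          using prv.MP[OF prv.MP[OF prv.ImpS prv_Imp_refl] prv.MP[OF prv.ImpK prv.ImpK]] .
        show ?thesis by (rule C[OF C[OF 1 2] 3])
      qed
      then show ?thesis by (rule C[OF prv.ImpS])
    qed
    have M: "T \<turnstile> Imp (Imp g a) (Imp g b)" if "T \<turnstile> Imp a b" for a b
      by (rule prv.MP[OF prv.ImpS prv.MP[OF prv.ImpK that]])
    { case 1 show ?case using C[OF X M[OF Cons(1)]] by simp
    next case 2 show ?case using C[OF M[OF Cons(2)] X] by simp }
  qed
  show "der T (h # hs) \<phi> \<Longrightarrow> der T hs (Imp h \<phi>)"
    using prv.MP[OF swap] by (simp add: der_def)
  show "der T hs (Imp h \<phi>) \<Longrightarrow> der T (h # hs) \<phi>"
    using prv.MP[OF swap'] by (simp add: der_def)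
qed

lemma der_hyp: "h \<in> set hs \<Longrightarrow> der T hs h"
proof (induction hs)
  case (Cons g hs)
  show ?case
  proof (cases "h = g")
    case True then show ?thesis by (simp add: der_Cons der_prv prv_Imp_refl)
  next
    case False
    then have "der T hs h" using Cons by auto
    then show ?thesis unfolding der_Cons by (rule der_mp[OF der_prv[OF prv.ImpK]])
  qed
qed simp

lemma der_cut: "der T gs \<phi> \<Longrightarrow> (\<And>g. g \<in> set gs \<Longrightarrow> der T hs g) \<Longrightarrow> der T hs \<phi>"
proof (induction gs arbitrary: \<phi>)
  case Nil then show ?case by (auto simp: der_def[of T "[]"] intro: der_prv)
next
  case (Cons g gs)
  have "der T hs (Imp g \<phi>)" using Cons by (auto simp: der_Cons)
  then show ?case using Cons.prems by (auto intro: der_mp)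
qed

lemma der_weaken: "der T gs \<phi> \<Longrightarrow> set gs \<subseteq> set hs \<Longrightarrow> der T hs \<phi>"
  by (erule der_cut) (auto intro: der_hyp)

lemma der_contr: "der T (Neg \<phi> # hs) Fls \<Longrightarrow> der T hs \<phi>"
  unfolding der_Cons by (rule der_mp[OF der_prv[OF prv.DNeg]])

lemma der_lift: "der T hs \<phi> \<Longrightarrow> der T (map (subst \<sigma>) hs) (subst \<sigma> \<phi>)"
proof -
  have "subst \<sigma> (foldr Imp hs \<phi>) = foldr Imp (map (subst \<sigma>) hs) (subst \<sigma> \<phi>)"
    by (induction hs) auto
  then show "der T hs \<phi> \<Longrightarrow> der T (map (subst \<sigma>) hs) (subst \<sigma> \<phi>)"
    unfolding der_def using prv_subst[of T "foldr Imp hs \<phi>" \<sigma>] by simp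
qed

lemma der_All:
  assumes "der T (map lift_fm hs) \<phi>" shows "der T hs (All \<phi>)"
  using assms
proof (induction hs arbitrary: \<phi>)
  case Nil then show ?case by (auto simp: der_def intro: prv.Gen)
next
  case (Cons h hs)
  then have "der T hs (All (Imp (lift_fm h) \<phi>))" by (simp add: der_Cons)
  then have 1: "der T hs (Imp (All (lift_fm h)) (All \<phi>))" by (rule der_mp[OF der_prv[OF prv.AllImp]])
  have "der T (h # hs) (All (lift_fm h))" 
    by (rule der_mp[OF der_prv[OF prv.AllI]]) (simp add: der_hyp)
  moreover have "der T (h # hs) (Imp (All (lift_fm h)) (All \<phi>))"
    by (rule der_weaken[OF 1]) auto
  ultimately show ?case by (rule der_mp[rotated])
qed

text \<open>Free variables play the role of Henkin constants: a fresh one can be renamed to 0 while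
  all others are shifted, and then be generalized.\<close>

lemma der_All_fresh:
  assumes d: "der T hs (inst \<phi> (Var x))" and x: "x \<notin> fv (All \<phi>)" "\<And>h. h \<in> set hs \<Longrightarrow> x \<notin> fv h"
  shows "der T hs (All \<phi>)"
proof (rule der_All)
  let ?\<sigma> = "\<lambda>i. if i = x then Var 0 else Var (Suc i)"
  have "map (subst ?\<sigma>) hs = map lift_fm hs"
    using x(2) by (auto simp: lift_fm_def intro!: subst_cong)
  moreover have "subst ?\<sigma> (inst \<phi> (Var x)) = subst Var \<phi>"
    unfolding inst_def subst_subst by (rule subst_cong) (use x(1) in \<open>auto split: nat.split\<close>)
  ultimately show "der T (map lift_fm hs) \<phi>" using der_lift[OF d, of ?\<sigma>] by (metis subst_Var)
qed

instance tm :: countable by countable_datatype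
instance fm :: countable by countable_datatype

text \<open>Completion and Henkin witnesses are built in one pass: a rejected formula leaves its
  negation, and a rejected universal formula also a negated instance at a fresh variable. Every
  stage is a finite list, so a fresh variable exists.\<close>

primrec henkin :: "fm set \<Rightarrow> fm \<Rightarrow> nat \<Rightarrow> fm list" where
  "henkin T \<phi> 0 = [Neg \<phi>]"
| "henkin T \<phi> (Suc n) = (let G = henkin T \<phi> n; \<psi> = from_nat n in
     if \<not> der T (\<psi> # G) Fls then \<psi> # G
     else case \<psi> of All \<chi> \<Rightarrow>
        Neg (inst \<chi> (Var (SOME x. x \<notin> fv \<psi> \<and> (\<forall>g\<in>set G. x \<notin> fv g)))) # Neg \<psi> # G
      | _ \<Rightarrow> Neg \<psi> # G)"

text \<open>If the current list refutes \<psi>, adding \<open>Neg \<psi>\<close> is harmless. For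
  \<psi> = \<open>All \<chi>\<close>, refuting the added negated instance would prove the instance
  at a fresh variable, hence \<open>All \<chi>\<close>, against \<open>Neg \<psi>\<close>.\<close>

lemma henkin_consistent:
  assumes "\<not> T \<turnstile> \<phi>" shows "\<not> der T (henkin T \<phi> n) Fls"
proof (induction n)
  case 0
  show ?case
  proof
    assume "der T (henkin T \<phi> 0) Fls"
    then have "der T [] \<phi>" by (auto intro: der_contr)
    then show False using assms by (simp add: der_def)
  qed
next
  case (Suc n)
  define G where "G = henkin T \<phi> n"
  define \<psi> :: fm where "\<psi> = from_nat n"
  show ?case
  proof (cases "der T (\<psi> # G) Fls")
    case False then show ?thesis by (simp add: G_def \<psi>_def Let_def)
  next
    case True
    then have neg: "der T G (Neg \<psi>)" by (simp add: der_Cons)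
    have con: "\<not> der T (Neg \<psi> # G) Fls"
      using Suc neg der_mp unfolding G_def[symmetric] der_Cons by blast
    show ?thesis
    proof (cases "\<exists>\<chi>. \<psi> = All \<chi>")
      case False
      then have "henkin T \<phi> (Suc n) = Neg \<psi> # G"
        using True by (simp add: G_def[symmetric] \<psi>_def[symmetric] Let_def split: fm.split)
      then show ?thesis using con by simp
    next
      case True
      then obtain \<chi> where \<chi>: "\<psi> = All \<chi>" by blast
      define x where "x = (SOME x. x \<notin> fv \<psi> \<and> (\<forall>g\<in>set G. x \<notin> fv g))"
      have "finite (fv \<psi> \<union> (\<Union>g\<in>set G. fv g))" by auto
      then have "\<exists>x. x \<notin> fv \<psi> \<union> (\<Union>g\<in>set G. fv g)" 
        by (rule ex_new_if_finite[OF infinite_UNIV_nat])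
      then have "\<exists>x. x \<notin> fv \<psi> \<and> (\<forall>g\<in>set G. x \<notin> fv g)" by auto
      then have x: "x \<notin> fv \<psi> \<and> (\<forall>g\<in>set G. x \<notin> fv g)" unfolding x_def by (rule someI_ex)
      have h: "henkin T \<phi> (Suc n) = Neg (inst \<chi> (Var x)) # Neg \<psi> # G"
        using \<open>der T (\<psi> # G) Fls\<close> by (simp add: G_def[symmetric] \<psi>_def[symmetric] Let_def \<chi> x_def)
      show ?thesis
      proof
        assume "der T (henkin T \<phi> (Suc n)) Fls"
        then have "der T (Neg \<psi> # G) (inst \<chi> (Var x))" unfolding h by (rule der_contr)
        then have "der T (Neg \<psi> # G) (All \<chi>)"
          by (rule der_All_fresh) (use x \<chi> in auto)
        moreover have "der T (Neg \<psi> # G) (Neg (All \<chi>))" using \<chi> by (intro der_hyp) simp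
        ultimately show False using con der_mp by blast
      qed
    qed
  qed
qed

lemma henkin_mono: "m \<le> n \<Longrightarrow> set (henkin T \<phi> m) \<subseteq> set (henkin T \<phi> n)"
proof (induction rule: dec_induct)
  case (step n)
  then show ?case by (auto simp: Let_def split: fm.split)
qed simp

section \<open>The maximal consistent set and its term model\<close>

definition henkin_set :: "fm set \<Rightarrow> fm \<Rightarrow> fm set" where
  "henkin_set T \<phi> = (\<Union>n. set (henkin T \<phi> n))"

context
  fixes T :: "fm set" and \<phi>\<^sub>0 :: fm and H :: "fm set"
  assumes np: "\<not> T \<turnstile> \<phi>\<^sub>0"
  defines "H \<equiv> henkin_set T \<phi>\<^sub>0"
begin

lemma H_total: "\<psi> \<in> H \<or> Neg \<psi> \<in> H"
proof -
  have "\<psi> \<in> set (henkin T \<phi>\<^sub>0 (Suc (to_nat \<psi>))) \<or> Neg \<psi> \<in> set (henkin T \<phi>\<^sub>0 (Suc (to_nat \<psi>)))"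
    by (auto simp: Let_def split: fm.split)
  then show ?thesis unfolding H_def henkin_set_def by blast
qed

lemma H_consistent: "set hs \<subseteq> H \<Longrightarrow> \<not> der T hs Fls"
proof
  assume hs: "set hs \<subseteq> H" and d: "der T hs Fls"
  have "\<exists>n. set hs \<subseteq> set (henkin T \<phi>\<^sub>0 n)" using hs
  proof (induction hs)
    case (Cons h hs)
    then obtain n m where "set hs \<subseteq> set (henkin T \<phi>\<^sub>0 n)" "h \<in> set (henkin T \<phi>\<^sub>0 m)"
      by (auto simp: H_def henkin_set_def)
    then show ?case
      using henkin_mono[of n "max n m" T \<phi>\<^sub>0] henkin_mono[of m "max n m" T \<phi>\<^sub>0]
      by (intro exI[of _ "max n m"]) auto
  qed simp
  then show False using der_weaken[OF d] henkin_consistent[OF np] by blast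
qed

lemma H_closed: "der T hs \<psi> \<Longrightarrow> set hs \<subseteq> H \<Longrightarrow> \<psi> \<in> H"
proof (rule ccontr)
  assume d: "der T hs \<psi>" and hs: "set hs \<subseteq> H" and "\<psi> \<notin> H"
  then have "Neg \<psi> \<in> H" using H_total by blast
  then have "\<not> der T (Neg \<psi> # hs) Fls" using hs by (intro H_consistent) auto
  moreover have "der T (Neg \<psi> # hs) \<psi>" by (rule der_weaken[OF d]) auto
  moreover have "der T (Neg \<psi> # hs) (Neg \<psi>)" by (rule der_hyp) simp
  ultimately show False using der_mp by blast
qed

lemma H_prv: "T \<turnstile> \<psi> \<Longrightarrow> \<psi> \<in> H"
  by (rule H_closed[of "[]"]) (auto simp: der_def)

lemma H_mp: "Imp \<psi> \<chi> \<in> H \<Longrightarrow> \<psi> \<in> H \<Longrightarrow> \<chi> \<in> H"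
  by (rule H_closed[of "[Imp \<psi> \<chi>, \<psi>]"], rule der_mp[of _ _ \<psi>]) (auto intro: der_hyp)

lemma H_Neg: "Neg \<psi> \<in> H \<longleftrightarrow> \<psi> \<notin> H"
proof -
  have "Fls \<notin> H" using H_consistent[of "[Fls]"] der_hyp[of Fls "[Fls]" T] by auto
  then show ?thesis using H_total H_mp by blast
qed

lemma H_Imp: "Imp \<psi> \<chi> \<in> H \<longleftrightarrow> (\<psi> \<in> H \<longrightarrow> \<chi> \<in> H)"
proof
  assume a: "\<psi> \<in> H \<longrightarrow> \<chi> \<in> H"
  show "Imp \<psi> \<chi> \<in> H"
  proof (cases "\<chi> \<in> H")
    case True then show ?thesis using H_mp H_prv prv.ImpK by blast
  next
    case False
    then have n: "Neg \<psi> \<in> H" using a H_Neg by blast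
    have "der T [Neg \<chi>, \<psi>, Neg \<psi>] Fls"
      by (rule der_mp[of _ _ \<psi>]) (auto intro: der_hyp)
    then have "der T [Neg \<psi>] (Imp \<psi> \<chi>)" using der_contr[of T \<chi> "[\<psi>, Neg \<psi>]"] by (simp add: der_Cons)
    then show ?thesis using n by (auto intro: H_closed)
  qed
qed (auto intro: H_mp)

text \<open>From right to left: the stage that treats \<open>All \<chi>\<close> either keeps it or
  leaves a negated instance, which contradicts the assumption.\<close>

lemma H_All: "All \<chi> \<in> H \<longleftrightarrow> (\<forall>t. inst \<chi> t \<in> H)"
proof
  assume "All \<chi> \<in> H" then show "\<forall>t. inst \<chi> t \<in> H" by (blast intro: H_mp[OF H_prv[OF prv.AllE]])
next
  assume a: "\<forall>t. inst \<chi> t \<in> H"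
  define n where "n = to_nat (All \<chi>)"
  define G where "G = henkin T \<phi>\<^sub>0 n"
  have "from_nat n = All \<chi>" by (simp add: n_def)
  then have "All \<chi> \<in> set (henkin T \<phi>\<^sub>0 (Suc n)) \<or> (\<exists>x. Neg (inst \<chi> (Var x)) \<in> set (henkin T \<phi>\<^sub>0 (Suc n)))"
    by (auto simp: Let_def)
  then have "All \<chi> \<in> H \<or> (\<exists>x. Neg (inst \<chi> (Var x)) \<in> H)" unfolding H_def henkin_set_def by blast
  then show "All \<chi> \<in> H" using a H_Neg by blast
qed

lemma H_Eq_subst: "Eq s t \<in> H \<Longrightarrow> inst \<psi> s \<in> H \<Longrightarrow> inst \<psi> t \<in> H"
  by (rule H_mp[OF H_mp[OF H_prv[OF prv.EqSubst]]])

lemma inst_lift [simp]: "subst_tm (case_nat t Var) (lift s) = s"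
  by (simp add: subst_tm_subst_tm)

lemma H_refl: "Eq t t \<in> H" by (rule H_prv[OF prv.EqRefl])

lemma H_sym: "Eq s t \<in> H \<Longrightarrow> Eq t s \<in> H"
  using H_Eq_subst[of s t "Eq (Var 0) (lift s)"] H_refl by (simp add: inst_def)

lemma H_trans: "Eq s t \<in> H \<Longrightarrow> Eq t u \<in> H \<Longrightarrow> Eq s u \<in> H"
  using H_Eq_subst[of t u "Eq (lift s) (Var 0)"] by (simp add: inst_def)

lemma H_Succ: "Eq s t \<in> H \<Longrightarrow> Eq (Succ s) (Succ t) \<in> H"
  using H_Eq_subst[of s t "Eq (Succ (lift s)) (Succ (Var 0))"] H_refl by (simp add: inst_def)

lemma H_Add: "Eq s t \<in> H \<Longrightarrow> Eq s' t' \<in> H \<Longrightarrow> Eq (Add s s') (Add t t') \<in> H"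
  using H_Eq_subst[of s t "Eq (Add (lift s) (lift s')) (Add (Var 0) (lift s'))"]
    H_Eq_subst[of s' t' "Eq (Add (lift s) (lift s')) (Add (lift t) (Var 0))"] H_refl
  by (simp add: inst_def)

lemma H_Mul: "Eq s t \<in> H \<Longrightarrow> Eq s' t' \<in> H \<Longrightarrow> Eq (Mul s s') (Mul t t') \<in> H"
  using H_Eq_subst[of s t "Eq (Mul (lift s) (lift s')) (Mul (Var 0) (lift s'))"]
    H_Eq_subst[of s' t' "Eq (Mul (lift s) (lift s')) (Mul (lift t) (Var 0))"] H_refl
  by (simp add: inst_def)

lemma H_Lt: "Eq s t \<in> H \<Longrightarrow> Eq s' t' \<in> H \<Longrightarrow> Lt s s' \<in> H \<Longrightarrow> Lt t t' \<in> H"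
  using H_Eq_subst[of s t "Lt (Var 0) (lift s')"] H_Eq_subst[of s' t' "Lt (lift t) (Var 0)"]
  by (simp add: inst_def)

definition term_class :: "tm \<Rightarrow> tm set" where
  "term_class t = {s. Eq s t \<in> H}"

lemma term_class_eq: "term_class s = term_class t \<longleftrightarrow> Eq s t \<in> H"
proof
  assume "term_class s = term_class t"
  then show "Eq s t \<in> H" using H_refl[of s] unfolding term_class_def by blast
next
  assume st: "Eq s t \<in> H"
  have "Eq u s \<in> H \<longleftrightarrow> Eq u t \<in> H" for u using H_trans[OF _ st] H_trans[OF _ H_sym[OF st]] by blast
  then show "term_class s = term_class t" unfolding term_class_def by simp
qed

text \<open>An arbitrary surjection whose kernel is equality in \<open>H\<close> replaces the
  quotient map, so that the universe can be relabelled to fill the type \<open>'a\<close>.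
  Assignments \<open>cl (\<sigma> i)\<close> correspond to substitutions \<sigma>.\<close>

lemma truth_lemma:
  fixes cl :: "tm \<Rightarrow> 'a"
  assumes cl: "surj cl" "\<And>s t. cl s = cl t \<longleftrightarrow> Eq s t \<in> H"
  shows "\<exists>M :: 'a str. \<forall>\<sigma> \<phi>. msat M (\<lambda>i. cl (\<sigma> i)) \<phi> \<longleftrightarrow> subst \<sigma> \<phi> \<in> H"
proof -
  define rep where "rep = inv cl"
  have rep: "cl (rep x) = x" for x by (simp add: rep_def cl(1) surj_f_inv_f)
  have rep': "Eq (rep (cl t)) t \<in> H" "Eq t (rep (cl t)) \<in> H" for t by (simp_all add: cl(2)[symmetric] rep)
  define M where "M = \<lparr>zer = cl Zero, suc = (\<lambda>x. cl (Succ (rep x))),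
     add = (\<lambda>x y. cl (Add (rep x) (rep y))), mul = (\<lambda>x y. cl (Mul (rep x) (rep y))),
     les = (\<lambda>x y. Lt (rep x) (rep y) \<in> H)\<rparr>"
  have tv: "mtval M (\<lambda>i. cl (\<sigma> i)) t = cl (subst_tm \<sigma> t)" for \<sigma> t
    by (induction t) (auto simp: M_def cl(2) rep' intro!: H_Succ H_Add H_Mul)
  have "msat M (\<lambda>i. cl (\<sigma> i)) \<phi> \<longleftrightarrow> subst \<sigma> \<phi> \<in> H" for \<sigma> \<phi>
  proof (induction \<phi> arbitrary: \<sigma>)
    case Fls then show ?case using H_Neg[of Fls] H_Imp[of Fls Fls] by simp
  next
    case (Eq s t) then show ?case by (simp add: tv cl(2))
  next
    case (Lt s t)
    have "Lt (rep (cl a)) (rep (cl b)) \<in> H \<longleftrightarrow> Lt a b \<in> H" for a b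
      using H_Lt rep' by blast
    then show ?case by (simp add: tv) (simp add: M_def)
  next
    case (Imp \<phi> \<psi>) then show ?case by (simp add: H_Imp)
  next
    case (All \<phi>)
    have "msat M (\<lambda>i. cl (\<sigma> i)) (fm.All \<phi>) \<longleftrightarrow> (\<forall>t. msat M (\<lambda>i. cl (case_nat t \<sigma> i)) \<phi>)"
    proof -
      have "case_nat (cl t) (\<lambda>i. cl (\<sigma> i)) = (\<lambda>i. cl (case_nat t \<sigma> i))" for t
        by (auto simp: fun_eq_iff split: nat.split)
      moreover have "(\<forall>x. P x) \<longleftrightarrow> (\<forall>t. P (cl t))" for P by (metis rep)
      ultimately show ?thesis by simp
    qed
    also have "\<dots> \<longleftrightarrow> (\<forall>t. inst (subst (up \<sigma>) \<phi>) t \<in> H)" by (simp add: All inst_subst_up)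
    finally show ?case by (simp add: H_All)
  qed
  then show ?thesis by blast
qed

end

theorem PA_complete:
  assumes "\<And>(M :: nat str) e. models M PA \<Longrightarrow> msat M e \<phi>"
  shows "PA \<turnstile> \<phi>"
proof (rule ccontr)
  assume np: "\<not> PA \<turnstile> \<phi>"
  define H where "H = henkin_set PA \<phi>"
  note prv = H_prv[OF np, folded H_def]
  define tc where "tc = term_class PA \<phi>"
  have tc: "tc s = tc t \<longleftrightarrow> Eq s t \<in> H" for s t
    unfolding tc_def H_def by (rule term_class_eq[OF np])
  have S: "Eq s t \<in> H" if "Eq (Succ s) (Succ t) \<in> H" for s t
  proof -
    have "PA \<turnstile> subst (case_nat s (\<lambda>_. t)) (Imp (Eq (Succ (Var 0)) (Succ (Var 1))) (Eq (Var 0) (Var 1)))"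
      by (intro prv_subst prv.Ax PA.intros)
    from prv[OF this] show ?thesis using H_mp[OF np, folded H_def] that by simp
  qed
  have Z: "Eq (Succ s) Zero \<notin> H" for s
  proof -
    have "PA \<turnstile> subst (\<lambda>_. s) (Neg (Eq (Succ (Var 0)) Zero))"
      by (intro prv_subst prv.Ax PA.intros)
    from prv[OF this] show ?thesis using H_Neg[OF np, folded H_def] by simp
  qed
  \<comment> \<open>Distinct numerals lie in distinct classes. So there are infinitely many classes,
    and as they are countable they can be numbered by all of \<open>nat\<close>.\<close>
  have num: "Eq (num_tm m) (num_tm n) \<in> H \<Longrightarrow> m = n" for m n
  proof (induction m arbitrary: n)
    case 0 then show ?case using Z H_sym[OF np, folded H_def] by (cases n) auto
  next
    case (Suc m) then show ?case using Z S by (cases n) auto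
  qed
  have "inj (\<lambda>n. tc (num_tm n))" using num tc by (auto intro: injI)
  then have inf: "infinite (range tc)"
    by (metis finite_subset image_subset_iff infinite_UNIV_nat finite_imageD rangeI)
  have cnt: "countable (range tc)" by simp
  define cl where "cl t = to_nat_on (range tc) (tc t)" for t
  have bij: "bij_betw (to_nat_on (range tc)) (range tc) UNIV"
    by (rule to_nat_on_infinite[OF cnt inf])
  have "surj cl" using bij by (auto simp: cl_def bij_betw_def image_image[symmetric])
  moreover have "cl s = cl t \<longleftrightarrow> Eq s t \<in> H" for s t
    using inj_on_eq_iff[OF bij_betw_imp_inj_on[OF bij], of "tc s" "tc t"] tc[of s t] by (auto simp: cl_def)
  ultimately obtain M :: "nat str" where M: "\<And>\<sigma> \<phi>. msat M (\<lambda>i. cl (\<sigma> i)) \<phi> \<longleftrightarrow> subst \<sigma> \<phi> \<in> H"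
    using truth_lemma[OF np, folded H_def] by blast
  \<comment> \<open>Every assignment comes from a substitution of representatives, and theorems are
    closed under substitution; this covers axioms with free variables.\<close>
  have "models M PA" unfolding models_def
  proof (intro ballI allI)
    fix \<psi> e assume "\<psi> \<in> PA"
    then have "subst (\<lambda>i. inv cl (e i)) \<psi> \<in> H" by (intro prv prv_subst prv.Ax)
    then show "msat M e \<psi>" using M[of "\<lambda>i. inv cl (e i)"] \<open>surj cl\<close> by (simp add: surj_f_inv_f)
  qed
  from assms[OF this] have "\<phi> \<in> H" using M[of Var \<phi>] by simp
  moreover have "Neg \<phi> \<in> H" unfolding H_def henkin_set_def
    by (metis UN_I UNIV_I henkin.simps(1) list.set_intros(1))
  ultimately show False using H_Neg[OF np, folded H_def] by blast
qed

section \<open>Arithmetic in models of PA\<close>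

locale pa_model =
  fixes M :: "'a str"
  assumes models_PA: "models M PA"
begin

abbreviation "Z \<equiv> zer M"
abbreviation "S \<equiv> suc M"
abbreviation plus_M (infixl "\<oplus>" 65) where "x \<oplus> y \<equiv> add M x y"
abbreviation times_M (infixl "\<otimes>" 70) where "x \<otimes> y \<equiv> mul M x y"
abbreviation less_M (infix "\<prec>" 50) where "x \<prec> y \<equiv> les M x y"

lemma prv_msat: "PA \<turnstile> \<phi> \<Longrightarrow> msat M e \<phi>"
  by (rule msoundness[OF _ models_PA])

lemma Suc_neq_Z [simp]: "S x \<noteq> Z" "Z \<noteq> S x"
  using prv_msat[OF prv.Ax[OF PA.intros(1)], of "\<lambda>_. x"] by auto

lemma Suc_inj [simp]: "S x = S y \<longleftrightarrow> x = y"
  using prv_msat[OF prv.Ax[OF PA.intros(2)], of "case_nat x (\<lambda>_. y)"] by auto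

lemma add_Z [simp]: "x \<oplus> Z = x"
  using prv_msat[OF prv.Ax[OF PA.intros(3)], of "\<lambda>_. x"] by auto

lemma add_S [simp]: "x \<oplus> S y = S (x \<oplus> y)"
  using prv_msat[OF prv.Ax[OF PA.intros(4)], of "case_nat x (\<lambda>_. y)"] by auto

lemma mul_Z [simp]: "x \<otimes> Z = Z"
  using prv_msat[OF prv.Ax[OF PA.intros(5)], of "\<lambda>_. x"] by auto

lemma mul_S [simp]: "x \<otimes> S y = x \<otimes> y \<oplus> x"
  using prv_msat[OF prv.Ax[OF PA.intros(6)], of "case_nat x (\<lambda>_. y)"] by auto

lemma less_iff: "x \<prec> y \<longleftrightarrow> (\<exists>z. x \<oplus> S z = y)"
  using prv_msat[OF prv.Ax[OF PA.intros(7)], of "case_nat x (\<lambda>_. y)"]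
  by (auto simp: numeral_2_eq_2)

text \<open>Induction is available for definable properties only, so every use below names its
  formula: \<open>Var 0\<close> is the induction variable, and the parameters sit in
  \<open>e\<close>.\<close>

lemma induction:
  assumes "msat M (case_nat Z e) \<phi>"
    and "\<And>x. msat M (case_nat x e) \<phi> \<Longrightarrow> msat M (case_nat (S x) e) \<phi>"
  shows "msat M (case_nat x e) \<phi>"
proof -
  have *: "(\<lambda>i. mtval M (case_nat x e) (case_nat (Succ (Var 0)) (\<lambda>i. Var (Suc i)) i)) = case_nat (S x) e" for x
    by (auto simp: fun_eq_iff split: nat.split)
  show ?thesis
    using prv_msat[OF prv.Ax[OF PA.intros(8)], of e \<phi>] assms by (simp add: msat_subst * )
qed

section \<open>Semiring and order laws, by induction inside \<open>M\<close>\<close>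

lemma Z_add [simp]: "Z \<oplus> x = x"
  using induction[of undefined "Eq (Add Zero (Var 0)) (Var 0)" x] by simp

lemma S_add [simp]: "S y \<oplus> x = S (y \<oplus> x)"
  using induction[of "\<lambda>_. y" "Eq (Add (Succ (Var 1)) (Var 0)) (Succ (Add (Var 1) (Var 0)))" x]
  by simp

lemma add_comm: "x \<oplus> y = y \<oplus> x"
  using induction[of "\<lambda>_. y" "Eq (Add (Var 0) (Var 1)) (Add (Var 1) (Var 0))" x] by simp

lemma add_assoc: "(y \<oplus> z) \<oplus> x = y \<oplus> (z \<oplus> x)"
  using induction[of "case_nat y (\<lambda>_. z)"
    "Eq (Add (Add (Var 1) (Var 2)) (Var 0)) (Add (Var 1) (Add (Var 2) (Var 0)))" x]
  by (simp add: numeral_2_eq_2)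

lemma add_left_comm: "y \<oplus> (z \<oplus> x) = z \<oplus> (y \<oplus> x)"
  by (metis add_assoc add_comm)

lemma add_cancel [simp]: "x \<oplus> y = x \<oplus> z \<longleftrightarrow> y = z"
  using induction[of "case_nat y (\<lambda>_. z)"
    "Imp (Eq (Add (Var 0) (Var 1)) (Add (Var 0) (Var 2))) (Eq (Var 1) (Var 2))" x]
  by (auto simp: numeral_2_eq_2)

lemma Z_or_S: "x = Z \<or> (\<exists>y. x = S y)"
  using induction[of undefined "Imp (Neg (Eq (Var 0) Zero)) (Ex (Eq (Var 1) (Succ (Var 0))))" x]
  by auto

lemma trichotomy: "x \<prec> y \<or> x = y \<or> y \<prec> x"
proof -
  have "Z \<prec> y \<or> Z = y" using Z_or_S[of y] by (auto simp: less_iff)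
  moreover have "S x \<prec> y \<or> S x = y \<or> y \<prec> S x" if "x \<prec> y \<or> x = y \<or> y \<prec> x" for x
    using that
  proof (elim disjE)
    assume "x \<prec> y"
    then obtain z where z: "x \<oplus> S z = y" by (auto simp: less_iff)
    then show ?thesis using Z_or_S[of z] by (auto simp: less_iff)
  next
    assume "x = y" then show ?thesis by (auto simp: less_iff intro: exI[of _ Z])
  next
    assume "y \<prec> x" then show ?thesis by (auto simp: less_iff) (metis add_S)
  qed
  ultimately show ?thesis
    using induction[of "\<lambda>_. y" "Imp (Neg (Lt (Var 0) (Var 1)))
      (Imp (Neg (Eq (Var 0) (Var 1))) (Lt (Var 1) (Var 0)))" x] by auto
qed

lemma add_mul: "(y \<oplus> z) \<otimes> x = y \<otimes> x \<oplus> z \<otimes> x"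
  using induction[of "case_nat y (\<lambda>_. z)"
    "Eq (Mul (Add (Var 1) (Var 2)) (Var 0)) (Add (Mul (Var 1) (Var 0)) (Mul (Var 2) (Var 0)))" x]
  by (simp add: numeral_2_eq_2 add_assoc add_left_comm)

lemma S_mul: "S y \<otimes> x = y \<otimes> x \<oplus> x"
  using induction[of "\<lambda>_. y"
    "Eq (Mul (Succ (Var 1)) (Var 0)) (Add (Mul (Var 1) (Var 0)) (Var 0))" x]
  by (simp add: add_assoc add_comm add_left_comm)

lemma add_S_neq: "x \<noteq> S (x \<oplus> y)"
  using add_cancel[of x Z "S y"] by auto

text \<open>With q' = q + S z, cancelling q m leaves r = S z m + r', which is at least m. Unique
  remainders make the beta function single-valued in \<open>M\<close>.\<close>

lemma division_less:
  assumes "q \<otimes> m \<oplus> r = q' \<otimes> m \<oplus> r'" "r \<prec> m" "q \<prec> q'" shows False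
proof -
  obtain z w where z: "q' = q \<oplus> S z" and w: "m = r \<oplus> S w" using assms by (auto simp: less_iff)
  have "q' \<otimes> m \<oplus> r' = q \<otimes> m \<oplus> (S z \<otimes> m \<oplus> r')" by (simp only: z add_mul add_assoc)
  then have "r = S z \<otimes> m \<oplus> r'" using assms(1) by simp
  also have "S z \<otimes> m = z \<otimes> m \<oplus> (r \<oplus> S w)" by (simp only: S_mul w)
  also have "\<dots> \<oplus> r' = S (r \<oplus> (z \<otimes> m \<oplus> (w \<oplus> r')))" by (simp add: add_assoc add_left_comm)
  finally show False using add_S_neq by blast
qed

lemma division_unique:
  assumes "q \<otimes> m \<oplus> r = q' \<otimes> m \<oplus> r'" "r \<prec> m" "r' \<prec> m" shows "r = r'"
  using trichotomy[of q q'] division_less[of q m r q' r'] division_less[of q' m r' q r] assms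
  by auto

subsection \<open>The standard initial segment\<close>

primrec std :: "nat \<Rightarrow> 'a" where
  "std 0 = Z"
| "std (Suc n) = S (std n)"

lemma mtval_num [simp]: "mtval M e (num_tm n) = std n"
  by (induction n) auto

lemma std_add: "std (m + n) = std m \<oplus> std n"
  by (induction m) auto

lemma std_mul: "std (m * n) = std m \<otimes> std n"
  by (induction n) (auto simp: std_add add_comm)

lemma less_Z [simp]: "\<not> x \<prec> Z"
  by (auto simp: less_iff)

lemma less_S: "x \<prec> S y \<longleftrightarrow> x = y \<or> x \<prec> y"
  unfolding less_iff by (metis Z_or_S add_S add_Z Suc_inj)

text \<open>\<open>M\<close> is an end extension of the standard numbers. This is what carries
  bounded statements over between \<open>M\<close> and the standard model.\<close>

lemma less_std: "x \<prec> std n \<longleftrightarrow> (\<exists>m<n. x = std m)"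
  by (induction n) (auto simp: less_S less_Suc_eq)

lemma std_inj [simp]: "std m = std n \<longleftrightarrow> m = n"
proof (induction m arbitrary: n)
  case 0 then show ?case by (cases n) auto
next
  case (Suc m) then show ?case by (cases n) auto
qed

lemma std_less: "std m \<prec> std n \<longleftrightarrow> m < n"
  by (auto simp: less_std)

lemma mtval_std: "mtval M (\<lambda>i. std (e i)) t = std (tval e t)"
  by (induction t) (auto simp: std_add std_mul)

lemma case_nat_std: "case_nat (std x) (\<lambda>i. std (e i)) = (\<lambda>i. std (case_nat x e i))"
  by (auto simp: fun_eq_iff split: nat.split)

lemma delta0_absolute: "delta0 \<phi> \<Longrightarrow> msat M (\<lambda>i. std (e i)) \<phi> \<longleftrightarrow> sat e \<phi>"
proof (induction arbitrary: e rule: delta0.induct)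
  case (5 \<phi> t)
  have "msat M (\<lambda>i. std (e i)) (All (Imp (Lt (Var 0) (lift t)) \<phi>)) \<longleftrightarrow>
      (\<forall>x < tval e t. msat M (case_nat (std x) (\<lambda>i. std (e i))) \<phi>)"
    by (auto simp: mtval_std less_std)
  then show ?case by (simp add: case_nat_std 5)
qed (auto simp: mtval_std std_less)

text \<open>The codes \<open>a\<close> and \<open>b\<close> witnessing the formula may be
  nonstandard. An outer induction up to the standard \<open>K\<close>, with uniqueness of
  remainders, still forces their entries to be the true powers of two.\<close>

lemma pow2_std:
  assumes "msat M e (pow2_fm k u)" "mtval M e k = std K" shows "mtval M e u = std (2 ^ K)"
proof -
  define bm where "bm a b i v \<longleftrightarrow> v \<prec> S (S i \<otimes> b) \<and> (\<exists>q. a = q \<otimes> S (S i \<otimes> b) \<oplus> v)" for a b i v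
  have beta: "msat M e (beta_fm a b i v) \<longleftrightarrow> bm (mtval M e a) (mtval M e b) (mtval M e i) (mtval M e v)"
    for e a b i v by (simp add: beta_fm_def mod_fm_def bm_def)
  have unique: "v = v'" if "bm a b i v" "bm a b i v'" for a b i v v'
    using that division_unique unfolding bm_def by blast
  obtain a b where 0: "bm a b Z (S Z)" and
    step: "\<And>i v. i \<prec> std K \<Longrightarrow> bm a b i v \<Longrightarrow> bm a b (S i) (v \<oplus> v)" and
    K: "bm a b (std K) (mtval M e u)"
    using assms by (auto simp: pow2_fm_def beta numeral_2_eq_2 numeral_3_eq_3 simp del: mul_S)
  have "i \<le> K \<Longrightarrow> bm a b (std i) (std (2 ^ i))" for i
  proof (induction i)
    case 0 show ?case using \<open>bm a b Z (S Z)\<close> by simp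
  next
    case (Suc i)
    then show ?case using step[of "std i" "std (2 ^ i)"] by (simp add: std_less std_add mult_2)
  qed
  from this[of K] show ?thesis using unique[OF K] by simp
qed

text \<open>The bound p + 1 < 2^(K+1) puts the program below a standard number, so the program
  itself is standard.\<close>

lemma len_std:
  assumes "msat M e (len_fm p k)" "mtval M e k = std K"
  shows "\<exists>n. mtval M e p = std n \<and> Suc n < 2 ^ Suc K"
proof -
  obtain u where u: "msat M (case_nat u e) (pow2_fm (lift k) (Var 0))" "S (mtval M e p) \<prec> u \<oplus> u"
    using assms(1) by (auto simp: len_fm_def)
  have "u = std (2 ^ K)" using pow2_std[OF u(1), of K] assms(2) by simp
  then have "S (mtval M e p) \<prec> std (2 ^ Suc K)" using u(2) by (simp add: std_add mult_2)
  then obtain m where "m < 2 ^ Suc K" "S (mtval M e p) = std m" by (auto simp only: less_std)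
  then show ?thesis by (cases m) auto
qed

lemma msat_two: "fv \<delta> \<subseteq> {0, 1} \<Longrightarrow>
    msat M (case_nat a (case_nat b e)) \<delta> \<longleftrightarrow> msat M (case_nat a (case_nat b e')) \<delta>"
  by (rule msat_cong) auto

text \<open>A complexity violating the axiom lies below a standard number, hence is standard, and so
  is the program realizing it. Therefore excluding the finitely many standard short programs
  suffices, even in a nonstandard \<open>M\<close>.\<close>

lemma complexity_ge_std:
  assumes \<delta>: "fv \<delta> \<subseteq> {0, 1}"
    and no: "\<And>p. Suc p < 2 ^ nat \<lceil>t\<rceil> \<Longrightarrow> \<not> msat M (case_nat (std p) (case_nat (std (code x)) e')) \<delta>"
  shows "msat M e (complexity_ge \<delta> x t)"
proof (rule ccontr)
  assume "\<not> msat M e (complexity_ge \<delta> x t)"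
  then obtain k where k: "k \<prec> std (nat \<lceil>t\<rceil>)"
    and c: "msat M (case_nat k e) (complexity_fm \<delta> (num_tm (code x)) (Var 0))"
    unfolding complexity_ge_def by auto
  obtain K where K: "K < nat \<lceil>t\<rceil>" "k = std K" using k by (auto simp: less_std)
  obtain p where p: "msat M (case_nat p (case_nat k e)) (len_fm (Var 0) (Var 1))"
    "msat M (case_nat p (case_nat (std (code x)) (case_nat p (case_nat k e)))) \<delta>"
    using c by (auto simp: complexity_fm_def mtval_subst)
  obtain n where n: "p = std n" "Suc n < 2 ^ Suc K" using len_std[OF p(1), of K] K by auto
  have "(2::nat) ^ Suc K \<le> 2 ^ nat \<lceil>t\<rceil>" using K by (intro power_increasing) auto
  then have "Suc n < 2 ^ nat \<lceil>t\<rceil>" using n(2) by (rule less_le_trans[rotated])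
  from no[OF this] show False using p(2) msat_two[OF \<delta>] n(1) by blast
qed

text \<open>Here provable functionality enters: it lets short programs be counted in a model whose
  view of \<open>D\<close> may be false.\<close>

lemma represents_functional:
  assumes "represents \<delta> D" "msat M (case_nat p (case_nat x e)) \<delta>" "msat M (case_nat p (case_nat y e)) \<delta>"
  shows "x = y"
proof -
  let ?e = "case_nat y (case_nat x (case_nat p e))"
  have fv: "fv \<delta> \<subseteq> {0, 1}" using assms(1) by (simp add: represents_def)
  have "PA \<turnstile> All (All (All (Imp (inst2 \<delta> (Var 2) (Var 1))
                        (Imp (inst2 \<delta> (Var 2) (Var 0)) (Eq (Var 1) (Var 0))))))"
    using assms(1) unfolding represents_def by blast
  from prv_msat[OF this, of e]
  have "msat M (case_nat p (case_nat x ?e)) \<delta> \<longrightarrow> msat M (case_nat p (case_nat y ?e)) \<delta> \<longrightarrow> x = y"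
    by (simp add: numeral_2_eq_2)
  then show ?thesis using assms(2,3) msat_two[OF fv, of p _ ?e e] by blast
qed

end

definition standard :: "nat str" where
  "standard = \<lparr>zer = 0, suc = Suc, add = (+), mul = (*), les = (<)\<rparr>"

lemma mtval_standard: "mtval standard e t = tval e t"
  by (induction t) (auto simp: standard_def)

lemma msat_standard: "msat standard e \<phi> \<longleftrightarrow> sat e \<phi>"
  by (induction \<phi> arbitrary: e) (auto simp: mtval_standard, auto simp: standard_def)

lemma pa_model_standard: "pa_model standard"
  using PA_true by unfold_locales (auto simp: models_def msat_standard true_in_N_def)

lemma PA_sound: "PA \<turnstile> \<phi> \<Longrightarrow> sat e \<phi>"
  using soundness PA_true by blast

text \<open>Provability claims will be checked in all models in this way instead of being derived in
  the calculus.\<close>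

lemma PA_complete': "(\<And>(M :: nat str) e. pa_model M \<Longrightarrow> msat M e \<phi>) \<Longrightarrow> PA \<turnstile> \<phi>"
  by (rule PA_complete) (simp add: pa_model_def)

section \<open>Definability in the standard model\<close>

lemma delta0_subst: "delta0 \<phi> \<Longrightarrow> delta0 (subst \<sigma> \<phi>)"
proof (induction arbitrary: \<sigma> rule: delta0.induct)
  case (5 \<phi> t)
  have "subst_tm (up \<sigma>) (lift t) = lift (subst_tm \<sigma> t)" by (simp add: subst_tm_subst_tm)
  then show ?case using delta0.intros(5)[OF 5(2)[of "up \<sigma>"], of "subst_tm \<sigma> t"] by simp
qed (auto intro: delta0.intros)

text \<open>A shallow embedding: definability is tracked for functions and predicates on
  environments, so that closure rules apply without exhibiting formulas. In the rules,
  \<open>e 0\<close> is the variable being bound and \<open>\<lambda>i. e (Suc i)\<close> the outer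
  environment.\<close>

definition trm :: "((nat \<Rightarrow> nat) \<Rightarrow> nat) \<Rightarrow> bool" where
  "trm F \<longleftrightarrow> (\<exists>t. \<forall>e. tval e t = F e)"

definition del :: "((nat \<Rightarrow> nat) \<Rightarrow> bool) \<Rightarrow> bool" where
  "del P \<longleftrightarrow> (\<exists>\<phi>. delta0 \<phi> \<and> (\<forall>e. sat e \<phi> \<longleftrightarrow> P e))"

definition sig :: "((nat \<Rightarrow> nat) \<Rightarrow> bool) \<Rightarrow> bool" where
  "sig R \<longleftrightarrow> (\<exists>\<phi>. delta0 \<phi> \<and> (\<forall>e. R e \<longleftrightarrow> (\<exists>w. sat (case_nat w e) \<phi>)))"

lemma trm_intros:
  "trm (\<lambda>e. e i)" "trm (\<lambda>e. n)"
  "trm F \<Longrightarrow> trm (\<lambda>e. Suc (F e))"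
  "trm F \<Longrightarrow> trm G \<Longrightarrow> trm (\<lambda>e. F e + G e)"
  "trm F \<Longrightarrow> trm G \<Longrightarrow> trm (\<lambda>e. F e * G e)"
  unfolding trm_def by (metis tval.simps tval_num)+

lemma trm_case:
  "trm F \<Longrightarrow> (\<And>k. trm (G k)) \<Longrightarrow> trm (\<lambda>e. case i of 0 \<Rightarrow> F e | Suc k \<Rightarrow> G k e)"
  by (cases i) auto

lemma del_Fls: "del (\<lambda>e. False)"
  unfolding del_def by (intro exI[of _ Fls]) (auto intro: delta0.intros)

lemma del_imp: "del P \<Longrightarrow> del Q \<Longrightarrow> del (\<lambda>e. P e \<longrightarrow> Q e)"
  unfolding del_def by (metis delta0.intros(4) sat.simps(4))

lemma del_not: "del P \<Longrightarrow> del (\<lambda>e. \<not> P e)"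
  using del_imp[OF _ del_Fls] by simp

lemma del_or: "del P \<Longrightarrow> del Q \<Longrightarrow> del (\<lambda>e. P e \<or> Q e)"
  using del_imp[OF del_not[of P], of Q] by (simp add: disj_imp)

lemma del_and: "del P \<Longrightarrow> del Q \<Longrightarrow> del (\<lambda>e. P e \<and> Q e)"
  using del_not[OF del_imp[OF _ del_not[of Q]], of P] by simp

lemma del_eq: "trm F \<Longrightarrow> trm G \<Longrightarrow> del (\<lambda>e. F e = G e)"
  unfolding del_def trm_def by (metis delta0.intros(2) sat.simps(2))

lemma del_less: "trm F \<Longrightarrow> trm G \<Longrightarrow> del (\<lambda>e. F e < G e)"
  unfolding del_def trm_def by (metis delta0.intros(3) sat.simps(3))

lemma del_le: "trm F \<Longrightarrow> trm G \<Longrightarrow> del (\<lambda>e. F e \<le> G e)"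
  using del_not[OF del_less[of G F]] by (simp add: not_less)

lemma del_all:
  assumes "trm T" "del (\<lambda>e. P (e 0) (\<lambda>i. e (Suc i)))"
  shows "del (\<lambda>e. \<forall>x<T e. P x e)"
proof -
  obtain t where t: "\<And>e. tval e t = T e" using assms(1) by (auto simp: trm_def)
  obtain \<phi> where \<phi>: "delta0 \<phi>" "\<And>e. sat e \<phi> \<longleftrightarrow> P (e 0) (\<lambda>i. e (Suc i))"
    using assms(2) by (auto simp: del_def)
  show ?thesis unfolding del_def
    by (intro exI[of _ "All (Imp (Lt (Var 0) (lift t)) \<phi>)"]) (auto intro: delta0.intros simp: \<phi> t)
qed

lemma del_ex: "trm T \<Longrightarrow> del (\<lambda>e. P (e 0) (\<lambda>i. e (Suc i))) \<Longrightarrow> del (\<lambda>e. \<exists>x<T e. P x e)"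
  using del_not[OF del_all[OF _ del_not, of T P]] by simp

lemmas del_intros = del_and del_or del_imp del_not del_eq del_less del_le del_all del_ex

lemma del_subst:
  assumes "del P" "\<And>i. trm (F i)" shows "del (\<lambda>e. P (\<lambda>i. F i e))"
proof -
  obtain \<sigma> where \<sigma>: "\<And>i e. tval e (\<sigma> i) = F i e"
    using assms(2) unfolding trm_def by metis
  obtain \<phi> where \<phi>: "delta0 \<phi>" "\<And>e. sat e \<phi> \<longleftrightarrow> P e" using assms(1) by (auto simp: del_def)
  show ?thesis unfolding del_def
    by (intro exI[of _ "subst \<sigma> \<phi>"]) (simp add: sat_subst \<sigma> \<phi> delta0_subst)
qed

lemma sigI:
  assumes "del (\<lambda>e. P (e 0) (\<lambda>i. e (Suc i)))" "\<And>e. R e \<longleftrightarrow> (\<exists>w. P w e)"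
  shows "sig R"
  using assms unfolding sig_def del_def by fastforce

text \<open>The form of definability that survives rearranging variables: terms may replace both the
  witness and each entry of the environment.\<close>

definition del2 :: "(nat \<Rightarrow> (nat \<Rightarrow> nat) \<Rightarrow> bool) \<Rightarrow> bool" where
  "del2 P \<longleftrightarrow> (\<forall>W E. trm W \<longrightarrow> (\<forall>i. trm (E i)) \<longrightarrow> del (\<lambda>e. P (W e) (\<lambda>i. E i e)))"

lemma del2D: "del2 P \<Longrightarrow> trm W \<Longrightarrow> (\<And>i. trm (E i)) \<Longrightarrow> del (\<lambda>e. P (W e) (\<lambda>i. E i e))"
  by (simp add: del2_def)

lemma sigE:
  assumes "sig R" shows "\<exists>P. del2 P \<and> (\<forall>e. R e \<longleftrightarrow> (\<exists>w. P w e))"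
proof -
  obtain \<phi> where \<phi>: "delta0 \<phi>" "\<And>e. R e \<longleftrightarrow> (\<exists>w. sat (case_nat w e) \<phi>)"
    using assms by (auto simp: sig_def)
  have "del2 (\<lambda>w e. sat (case_nat w e) \<phi>)" unfolding del2_def
  proof (intro allI impI)
    fix W and E :: "nat \<Rightarrow> (nat \<Rightarrow> nat) \<Rightarrow> nat" assume "trm W" "\<forall>i. trm (E i)"
    then have "trm (case_nat W E i)" for i by (simp split: nat.split)
    moreover have "del (\<lambda>e. sat e \<phi>)" unfolding del_def using \<phi>(1) by blast
    ultimately have "del (\<lambda>e. sat (\<lambda>i. case_nat W E i e) \<phi>)"
      using del_subst[of "\<lambda>e. sat e \<phi>" "case_nat W E"] by simp
    also have "(\<lambda>e. sat (\<lambda>i. case_nat W E i e) \<phi>) = (\<lambda>e. sat (case_nat (W e) (\<lambda>i. E i e)) \<phi>)"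
      by (intro ext arg_cong[where f="\<lambda>e. sat e \<phi>"]) (simp split: nat.split)
    finally show "del (\<lambda>e. sat (case_nat (W e) (\<lambda>i. E i e)) \<phi>)" .
  qed
  then show ?thesis using \<phi>(2) by blast
qed

lemma sig_del: "del R \<Longrightarrow> sig R"
  by (rule sigI[of "\<lambda>w. R"], erule del_subst) (simp_all add: trm_intros)

lemma sig_ren: assumes "sig R" shows "sig (\<lambda>e. R (\<lambda>i. e (\<rho> i)))"
proof -
  obtain P where P: "del2 P" "\<And>e. R e \<longleftrightarrow> (\<exists>w. P w e)" using sigE[OF assms] by blast
  show ?thesis by (rule sigI[of "\<lambda>w e. P w (\<lambda>i. e (\<rho> i))"]) (auto intro!: del2D[OF P(1)] trm_intros simp: P(2))
qed

lemma sig_ex: assumes "sig (\<lambda>e. R (e 0) (\<lambda>i. e (Suc i)))" shows "sig (\<lambda>e. \<exists>x. R x e)"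
proof -
  obtain P where P: "del2 P" "\<And>e. R (e 0) (\<lambda>i. e (Suc i)) \<longleftrightarrow> (\<exists>w. P w e)" using sigE[OF assms] by blast
  have R: "R x e \<longleftrightarrow> (\<exists>w. P w (case_nat x e))" for x e using P(2)[of "case_nat x e"] by simp
  show ?thesis
  \<comment> \<open>A single unbounded \<open>w\<close> bounds both \<open>x\<close> and the old
    witness \<open>a\<close>, so two unbounded quantifiers merge without a pairing function.\<close>
  proof (rule sigI[of "\<lambda>w e. \<exists>x<Suc w. \<exists>a<Suc w. P a (case_nat x e)"])
    show "del (\<lambda>e. \<exists>x<Suc (e 0). \<exists>a<Suc (e 0). P a (case_nat x (\<lambda>i. e (Suc i))))"
      by (intro del_ex trm_intros) (auto intro!: del2D[OF P(1)] trm_intros trm_case)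
    show "(\<exists>x. R x e) \<longleftrightarrow> (\<exists>w. \<exists>x<Suc w. \<exists>a<Suc w. P a (case_nat x e))" for e
      unfolding R by (meson less_Suc_eq_le max.cobounded1 max.cobounded2)
  qed
qed

lemma sig_and: assumes "sig R" "sig R'" shows "sig (\<lambda>e. R e \<and> R' e)"
proof -
  obtain P where P: "del2 P" "\<And>e. R e \<longleftrightarrow> (\<exists>w. P w e)" using sigE[OF assms(1)] by blast
  obtain Q where Q: "del2 Q" "\<And>e. R' e \<longleftrightarrow> (\<exists>w. Q w e)" using sigE[OF assms(2)] by blast
  have "sig (\<lambda>e. \<exists>x y. P x e \<and> Q y e)"
    by (intro sig_ex sig_del del_and del2D[OF P(1)] del2D[OF Q(1)] trm_intros)
  then show ?thesis by (simp add: P(2) Q(2))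
qed

lemma sig_or: assumes "sig R" "sig R'" shows "sig (\<lambda>e. R e \<or> R' e)"
proof -
  obtain P where P: "del2 P" "\<And>e. R e \<longleftrightarrow> (\<exists>w. P w e)" using sigE[OF assms(1)] by blast
  obtain Q where Q: "del2 Q" "\<And>e. R' e \<longleftrightarrow> (\<exists>w. Q w e)" using sigE[OF assms(2)] by blast
  have "sig (\<lambda>e. \<exists>x. P x e \<or> Q x e)"
    by (intro sig_ex sig_del del_or del2D[OF P(1)] del2D[OF Q(1)] trm_intros)
  then show ?thesis by (simp add: P(2) Q(2) ex_disj_distrib)
qed

text \<open>The collection principle: it moves an unbounded existential quantifier out of a bounded
  universal one.\<close>

lemma bounded_collection:
  "(\<forall>x<(t::nat). \<exists>w. P x w) \<longleftrightarrow> (\<exists>b. \<forall>x<t. \<exists>w<(b::nat). P x w)"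
proof
  assume "\<forall>x<t. \<exists>w. P x w"
  then obtain f where f: "\<And>x. x < t \<Longrightarrow> P x (f x)" by metis
  have "f x < Suc (\<Sum>x<t. f x)" if "x < t" for x
    using member_le_sum[of x "{..<t}" f] that by (simp add: less_Suc_eq_le)
  then show "\<exists>b. \<forall>x<t. \<exists>w<b. P x w" using f by blast
qed blast

lemma sig_all_trm:
  assumes "trm T" "sig (\<lambda>e. R (e 0) (\<lambda>i. e (Suc i)))" shows "sig (\<lambda>e. \<forall>x<T e. R x e)"
proof -
  obtain P where P: "del2 P" "\<And>e. R (e 0) (\<lambda>i. e (Suc i)) \<longleftrightarrow> (\<exists>w. P w e)" using sigE[OF assms(2)] by blast
  have R: "R x e \<longleftrightarrow> (\<exists>w. P w (case_nat x e))" for x e using P(2)[of "case_nat x e"] by simp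
  obtain t where t: "\<And>e. tval e t = T e" using assms(1) by (auto simp: trm_def)
  have T: "trm (\<lambda>e. T (\<lambda>i. e (Suc i)))"
    unfolding trm_def by (rule exI[of _ "lift t"]) (simp add: tval_subst t)
  show ?thesis
  proof (rule sigI[of "\<lambda>w e. \<forall>x<T e. \<exists>a<w. P a (case_nat x e)"])
    show "del (\<lambda>e. \<forall>x<T (\<lambda>i. e (Suc i)). \<exists>a<e 0. P a (case_nat x (\<lambda>i. e (Suc i))))"
      by (intro del_ex del_all T trm_intros) (auto intro!: del2D[OF P(1)] trm_intros trm_case)
    show "(\<forall>x<T e. R x e) \<longleftrightarrow> (\<exists>w. \<forall>x<T e. \<exists>a<w. P a (case_nat x e))" for e
      unfolding R by (rule bounded_collection)
  qed
qed

subsection \<open>Computable functions and decidable relations\<close>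

text \<open>Total functions with a \<Sigma>1 graph, and relations that are \<Sigma>1 together with
  their complement, stand for the computable ones. The passage to \<open>recf\<close> machines is
  made only once, in \<open>representable\<close>.\<close>

definition cfun :: "((nat \<Rightarrow> nat) \<Rightarrow> nat) \<Rightarrow> bool" where
  "cfun F \<longleftrightarrow> sig (\<lambda>e. e 0 = F (\<lambda>i. e (Suc i)))"

definition dec :: "((nat \<Rightarrow> nat) \<Rightarrow> bool) \<Rightarrow> bool" where
  "dec P \<longleftrightarrow> sig P \<and> sig (\<lambda>e. \<not> P e)"

lemma sig_comp:
  assumes "cfun F" "sig (\<lambda>e. R (e 0) (\<lambda>i. e (Suc i)))" shows "sig (\<lambda>e. R (F e) e)"
proof -
  have "sig (\<lambda>e. \<exists>y. y = F e \<and> R y e)"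
    using assms unfolding cfun_def by (intro sig_ex sig_and)
  then show ?thesis by simp
qed

lemma cfun_ren: "cfun F \<Longrightarrow> cfun (\<lambda>e. F (\<lambda>i. e (\<rho> i)))"
  unfolding cfun_def by (drule sig_ren[of _ "case_nat 0 (\<lambda>i. Suc (\<rho> i))"]) simp

lemma sig_comp2:
  assumes "cfun F" "cfun G" "sig (\<lambda>e. R (e 0) (e 1) (\<lambda>i. e (Suc (Suc i))))"
  shows "sig (\<lambda>e. R (F e) (G e) e)"
proof (rule sig_comp[OF assms(1)], rule sig_comp)
  show "cfun (\<lambda>e. G (\<lambda>i. e (Suc i)))" using assms(2) by (rule cfun_ren)
  show "sig (\<lambda>e. R (e (Suc 0)) (e 0) (\<lambda>i. e (Suc (Suc i))))"
    using sig_ren[OF assms(3), of "\<lambda>i. if i = 0 then Suc 0 else if i = Suc 0 then 0 else i"] by simp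
qed

lemma sig_comp3:
  assumes "cfun F" "cfun G" "cfun H" "sig (\<lambda>e. R (e 0) (e 1) (e 2))"
  shows "sig (\<lambda>e. R (F e) (G e) (H e))"
proof (rule sig_comp2[OF assms(1,2)], rule sig_comp)
  show "cfun (\<lambda>e. H (\<lambda>i. e (Suc (Suc i))))" using assms(3) by (rule cfun_ren)
  show "sig (\<lambda>e. R (e (Suc 0)) (e (Suc 1)) (e 0))"
    using sig_ren[OF assms(4), of "\<lambda>i. if i = 0 then Suc 0 else if i = Suc 0 then 2 else 0"]
    by (simp add: numeral_2_eq_2)
qed

lemma cfun_comp2:
  assumes "cfun F" "cfun G" "cfun (\<lambda>e. f (e 0) (e 1) (\<lambda>i. e (Suc (Suc i))))"
  shows "cfun (\<lambda>e. f (F e) (G e) e)"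
  unfolding cfun_def
proof (rule sig_comp2[of _ _ "\<lambda>x y e. e 0 = f x y (\<lambda>i. e (Suc i))"])
  show "cfun (\<lambda>e. F (\<lambda>i. e (Suc i)))" "cfun (\<lambda>e. G (\<lambda>i. e (Suc i)))"
    by (rule cfun_ren, rule assms)+
  show "sig (\<lambda>e. e (Suc (Suc 0)) = f (e 0) (e 1) (\<lambda>i. e (Suc (Suc (Suc i)))))"
    using sig_ren[OF assms(3)[unfolded cfun_def],
      of "\<lambda>i. if i = 0 then Suc (Suc 0) else if i = Suc 0 then 0 else if i = Suc (Suc 0) then 1 else i"]
    by simp
qed

lemma cfun_comp1:
  assumes "cfun F" "cfun (\<lambda>e. f (e 0))"
  shows "cfun (\<lambda>e. f (F e))"
proof (rule cfun_comp2[of F F "\<lambda>x y e. f x"])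
  show "cfun (\<lambda>e. f (e 0))" by fact
qed (rule assms)+

lemma sig_eq: "cfun F \<Longrightarrow> cfun G \<Longrightarrow> sig (\<lambda>e. F e = G e)"
  by (erule sig_comp2[of _ _ "\<lambda>x y e. x = y"]) (auto intro!: sig_del del_eq trm_intros)

lemma sig_neq: "cfun F \<Longrightarrow> cfun G \<Longrightarrow> sig (\<lambda>e. F e \<noteq> G e)"
  by (erule sig_comp2[of _ _ "\<lambda>x y e. x \<noteq> y"]) (auto intro!: sig_del del_not del_eq trm_intros)

lemma sig_less: "cfun F \<Longrightarrow> cfun G \<Longrightarrow> sig (\<lambda>e. F e < G e)"
  by (erule sig_comp2[of _ _ "\<lambda>x y e. x < y"]) (auto intro!: sig_del del_less trm_intros)

lemma sig_le: "cfun F \<Longrightarrow> cfun G \<Longrightarrow> sig (\<lambda>e. F e \<le> G e)"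
  by (erule sig_comp2[of _ _ "\<lambda>x y e. x \<le> y"]) (auto intro!: sig_del del_le trm_intros)

lemma sig_all:
  assumes "cfun T" "sig (\<lambda>e. R (e 0) (\<lambda>i. e (Suc i)))" shows "sig (\<lambda>e. \<forall>x<T e. R x e)"
\<comment> \<open>The value of \<open>T\<close> is named by a variable first, which turns the bound
  into a term.\<close>
proof (rule sig_comp[OF assms(1)], rule sig_all_trm)
  show "trm (\<lambda>e. e 0)" by (rule trm_intros)
  show "sig (\<lambda>e. R (e 0) (\<lambda>i. e (Suc (Suc i))))"
    using sig_ren[OF assms(2), of "\<lambda>i. if i = 0 then 0 else Suc i"] by simp
qed

lemma sig_bex:
  assumes "cfun T" "sig (\<lambda>e. R (e 0) (\<lambda>i. e (Suc i)))" shows "sig (\<lambda>e. \<exists>x<T e. R x e)"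
proof (rule sig_ex, rule sig_and[OF sig_less assms(2)])
  show "cfun (\<lambda>e. e 0)" unfolding cfun_def by (intro sig_del del_eq trm_intros)
  show "cfun (\<lambda>e. T (\<lambda>i. e (Suc i)))" by (rule cfun_ren[OF assms(1)])
qed

lemma sig_dec: "dec P \<Longrightarrow> sig P" and sig_dec_not: "dec P \<Longrightarrow> sig (\<lambda>e. \<not> P e)"
  by (simp_all add: dec_def)

lemma dec_eq: "cfun F \<Longrightarrow> cfun G \<Longrightarrow> dec (\<lambda>e. F e = G e)"
  by (simp add: dec_def sig_eq sig_neq)

lemma dec_less: "cfun F \<Longrightarrow> cfun G \<Longrightarrow> dec (\<lambda>e. F e < G e)"
  by (simp add: dec_def sig_less sig_le not_less)

lemma dec_le: "cfun F \<Longrightarrow> cfun G \<Longrightarrow> dec (\<lambda>e. F e \<le> G e)"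
  by (simp add: dec_def sig_less sig_le not_le)

lemma dec_not: "dec P \<Longrightarrow> dec (\<lambda>e. \<not> P e)"
  by (simp add: dec_def)

lemma dec_and: "dec P \<Longrightarrow> dec Q \<Longrightarrow> dec (\<lambda>e. P e \<and> Q e)"
  using sig_or[of "\<lambda>e. \<not> P e" "\<lambda>e. \<not> Q e"] by (auto simp: dec_def sig_and de_Morgan_conj simp del: imp_conv_disj not_imp)

lemma dec_or: "dec P \<Longrightarrow> dec Q \<Longrightarrow> dec (\<lambda>e. P e \<or> Q e)"
  by (simp add: dec_def sig_and sig_or)

lemma dec_imp: "dec P \<Longrightarrow> dec Q \<Longrightarrow> dec (\<lambda>e. P e \<longrightarrow> Q e)"
  using dec_or[OF dec_not[of P], of Q] by (simp add: disj_imp)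

lemma dec_all: "cfun T \<Longrightarrow> dec (\<lambda>e. P (e 0) (\<lambda>i. e (Suc i))) \<Longrightarrow> dec (\<lambda>e. \<forall>x<T e. P x e)"
  by (simp add: dec_def sig_all sig_bex)

lemma dec_ex: "cfun T \<Longrightarrow> dec (\<lambda>e. P (e 0) (\<lambda>i. e (Suc i))) \<Longrightarrow> dec (\<lambda>e. \<exists>x<T e. P x e)"
  using dec_not[OF dec_all[OF _ dec_not, of T P]] by simp

lemma cfunI: "sig (\<lambda>e. Q (e 0) (\<lambda>i. e (Suc i))) \<Longrightarrow> (\<And>y e. Q y e \<longleftrightarrow> y = F e) \<Longrightarrow> cfun F"
  by (simp add: cfun_def)

lemma cfun_trm: "trm F \<Longrightarrow> cfun F"
  unfolding cfun_def
proof (intro sig_del del_eq trm_intros)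
  assume "trm F"
  then obtain t where t: "\<And>e. tval e t = F e" by (auto simp: trm_def)
  show "trm (\<lambda>e. F (\<lambda>i. e (Suc i)))"
    unfolding trm_def by (rule exI[of _ "lift t"]) (simp add: tval_subst t)
qed

lemma cfun_base: "cfun (\<lambda>e. e i)" "cfun (\<lambda>e. n)"
  by (intro cfun_trm trm_intros)+

lemma cfun_Suc: "cfun F \<Longrightarrow> cfun (\<lambda>e. Suc (F e))"
  by (erule cfun_comp1) (intro cfun_trm trm_intros)

lemma cfun_add: "cfun F \<Longrightarrow> cfun G \<Longrightarrow> cfun (\<lambda>e. F e + G e)"
  by (erule cfun_comp2[of _ _ "\<lambda>x y e. x + y"], assumption) (intro cfun_trm trm_intros)

lemma cfun_mult: "cfun F \<Longrightarrow> cfun G \<Longrightarrow> cfun (\<lambda>e. F e * G e)"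
  by (erule cfun_comp2[of _ _ "\<lambda>x y e. x * y"], assumption) (intro cfun_trm trm_intros)

lemma cfun_if:
  assumes "dec P" "cfun F" "cfun G" shows "cfun (\<lambda>e. if P e then F e else G e)"
proof (rule cfunI[of "\<lambda>y e. (P e \<and> y = F e) \<or> (\<not> P e \<and> y = G e)"])
  show "sig (\<lambda>e. (P (\<lambda>i. e (Suc i)) \<and> e 0 = F (\<lambda>i. e (Suc i))) \<or>
      (\<not> P (\<lambda>i. e (Suc i)) \<and> e 0 = G (\<lambda>i. e (Suc i))))"
    by (intro sig_or sig_and sig_eq cfun_base cfun_ren[OF assms(2)] cfun_ren[OF assms(3)]
        sig_ren[OF sig_dec[OF assms(1)]] sig_ren[OF sig_dec_not[OF assms(1)]])
qed auto

lemma cfun_diff: "cfun F \<Longrightarrow> cfun G \<Longrightarrow> cfun (\<lambda>e. F e - G e)"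
proof (erule cfun_comp2[of _ _ "\<lambda>x y e. x - y"])
  show "cfun (\<lambda>e. e 0 - e 1)"
    by (rule cfunI[of "\<lambda>z e. z + e 1 = e 0 \<or> (e 0 < e 1 \<and> z = 0)"])
       (auto intro!: sig_or sig_and sig_eq sig_less cfun_base cfun_add)
qed

lemma cfun_div: "cfun F \<Longrightarrow> cfun G \<Longrightarrow> cfun (\<lambda>e. F e div G e)"
proof (erule cfun_comp2[of _ _ "\<lambda>x y e. x div y"])
  show "cfun (\<lambda>e. e 0 div e 1)"
  proof (rule cfunI[of "\<lambda>z e. (e 1 = 0 \<and> z = 0) \<or> (z * e 1 \<le> e 0 \<and> e 0 < Suc z * e 1)"])
    show "(e 1 = 0 \<and> z = 0) \<or> (z * e 1 \<le> e 0 \<and> e 0 < Suc z * e 1) \<longleftrightarrow> z = e 0 div e 1"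
      for z :: nat and e
    proof (cases "e 1 = 0")
      case False
      have "z = e 0 div e 1" if "z * e 1 \<le> e 0 \<and> e 0 < Suc z * e 1"
        by (rule sym, rule div_nat_eqI) (use that in \<open>auto simp: mult.commute\<close>)
      then show ?thesis using False by (auto simp: dividend_less_div_times)
    qed auto
  qed (auto intro!: sig_or sig_and sig_eq sig_less sig_le cfun_base cfun_mult cfun_Suc simp del: mult_Suc)
qed

lemma cfun_mod: "cfun F \<Longrightarrow> cfun G \<Longrightarrow> cfun (\<lambda>e. F e mod G e)"
  using cfun_diff[of F "\<lambda>e. F e div G e * G e"] by (simp add: cfun_mult cfun_div minus_div_mult_eq_mod)

definition beta :: "nat \<Rightarrow> nat \<Rightarrow> nat \<Rightarrow> nat" where
  "beta a b n = a mod Suc (Suc n * b)"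

lemma cfun_beta: "cfun A \<Longrightarrow> cfun B \<Longrightarrow> cfun N \<Longrightarrow> cfun (\<lambda>e. beta (A e) (B e) (N e))"
  unfolding beta_def by (intro cfun_mod cfun_Suc cfun_mult)

text \<open>Goedel's elimination of primitive recursion: the sequence of values is coded by a beta
  pair and checked locally, and \<open>beta_lemma\<close> supplies such a pair.\<close>

lemma cfun_rec:
  assumes g: "cfun g" and k: "cfun (\<lambda>e. k (e 0) (e 1) (\<lambda>i. e (Suc (Suc i))))" and m: "cfun m"
  shows "cfun (\<lambda>e. rec_nat (g e) (\<lambda>i y. k i y e) (m e))"
proof -
  show ?thesis
  proof (rule cfunI[of "\<lambda>y e. \<exists>a b. beta a b 0 = g e \<and>
      (\<forall>i<m e. beta a b (Suc i) = k i (beta a b i) e) \<and> y = beta a b (m e)"])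
    have k': "cfun (\<lambda>e. k (e 0) (beta (e 2) (e 1) (e 0)) (\<lambda>i. e (Suc (Suc (Suc (Suc i))))))"
    proof (rule cfun_comp2[where F="\<lambda>e. e 0" and G="\<lambda>e. beta (e 2) (e 1) (e 0)"
          and f="\<lambda>x y e. k x y (\<lambda>i. e (Suc (Suc (Suc (Suc i)))))"])
      show "cfun (\<lambda>e. k (e 0) (e 1) (\<lambda>i. e (Suc (Suc (Suc (Suc (Suc (Suc i))))))))"
        using cfun_ren[OF k, of "\<lambda>i. if i = 0 then 0 else if i = 1 then 1 else Suc (Suc (Suc (Suc i)))"]
        by simp
    qed (intro cfun_beta cfun_base)+
    show "sig (\<lambda>e. \<exists>a b. beta a b 0 = g (\<lambda>i. e (Suc i)) \<and>
      (\<forall>i<m (\<lambda>i. e (Suc i)). beta a b (Suc i) = k i (beta a b i) (\<lambda>i. e (Suc i))) \<and>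
       e 0 = beta a b (m (\<lambda>i. e (Suc i))))"
      by (intro sig_ex sig_and sig_eq sig_all cfun_beta cfun_base cfun_Suc cfun_ren[OF g] cfun_ren[OF m])
         (use k' in \<open>simp add: numeral_2_eq_2\<close>)
    show "(\<exists>a b. beta a b 0 = g e \<and> (\<forall>i<m e. beta a b (Suc i) = k i (beta a b i) e) \<and> y = beta a b (m e))
      \<longleftrightarrow> y = rec_nat (g e) (\<lambda>i y. k i y e) (m e)" (is "?L \<longleftrightarrow> ?R") for y e
    proof
      assume ?L
      then obtain a b where ab: "beta a b 0 = g e" "\<And>i. i < m e \<Longrightarrow> beta a b (Suc i) = k i (beta a b i) e"
        "y = beta a b (m e)" by blast
      have "i \<le> m e \<Longrightarrow> beta a b i = rec_nat (g e) (\<lambda>i y. k i y e) i" for i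
        by (induction i) (auto simp: ab)
      then show ?R using ab(3) by simp
    next
      assume y: ?R
      obtain a b where "\<And>i. i \<le> m e \<Longrightarrow> beta a b i = rec_nat (g e) (\<lambda>i y. k i y e) i"
        using beta_lemma[of "m e" "rec_nat (g e) (\<lambda>i y. k i y e)"] unfolding beta_def by blast
      then show ?L using y by (intro exI[of _ a] exI[of _ b]) simp
    qed
  qed
qed

lemma cfun_power: assumes "cfun F" "cfun G" shows "cfun (\<lambda>e. F e ^ G e)"
proof -
  have "rec_nat 1 (\<lambda>i y. y * a) n = a ^ n" for a n :: nat by (induction n) auto
  moreover have "cfun (\<lambda>e. rec_nat 1 (\<lambda>i y. y * F e) (G e))"
    by (intro cfun_rec cfun_base cfun_mult cfun_ren[OF assms(1)] assms(2))
  ultimately show ?thesis by simp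
qed

lemma rec_nat_sum: "rec_nat 0 (\<lambda>i y. y + f i) n = (\<Sum>x<n. f x :: nat)"
  by (induction n) auto

lemma cfun_sum:
  assumes "cfun T" "cfun (\<lambda>e. F (e 0) (\<lambda>i. e (Suc i)))" shows "cfun (\<lambda>e. \<Sum>x<T e. F x e)"
proof -
  have "cfun (\<lambda>e. rec_nat 0 (\<lambda>i y. y + F i e) (T e))"
    using cfun_ren[OF assms(2), of "\<lambda>i. if i = 0 then 0 else Suc i"]
    by (intro cfun_rec cfun_base cfun_add assms(1)) simp_all
  then show ?thesis by (simp add: rec_nat_sum)
qed

lemma cfun_prod_encode: "cfun F \<Longrightarrow> cfun G \<Longrightarrow> cfun (\<lambda>e. prod_encode (F e, G e))"
  unfolding prod_encode_def triangle_def
  by (simp del: mult_Suc mult_Suc_right) (intro cfun_add cfun_div cfun_mult cfun_Suc cfun_base)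

lemma cfun_fst: "cfun F \<Longrightarrow> cfun (\<lambda>e. fst (prod_decode (F e)))"
proof (erule cfun_comp1)
  show "cfun (\<lambda>e. fst (prod_decode (e 0)))"
  proof (rule cfunI[of "\<lambda>y e. \<exists>b. prod_encode (y, b) = e 0"])
    show "(\<exists>b. prod_encode (y, b) = e 0) \<longleftrightarrow> y = fst (prod_decode (e 0))" for y e
      by (metis prod.collapse fst_conv prod_decode_inverse prod_encode_inverse)
  qed (intro sig_ex sig_eq cfun_prod_encode cfun_base)
qed

lemma cfun_snd: "cfun F \<Longrightarrow> cfun (\<lambda>e. snd (prod_decode (F e)))"
proof (erule cfun_comp1)
  show "cfun (\<lambda>e. snd (prod_decode (e 0)))"
  proof (rule cfunI[of "\<lambda>y e. \<exists>b. prod_encode (b, y) = e 0"])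
    show "(\<exists>b. prod_encode (b, y) = e 0) \<longleftrightarrow> y = snd (prod_decode (e 0))" for y e
      by (metis prod.collapse snd_conv prod_decode_inverse prod_encode_inverse)
  qed (intro sig_ex sig_eq cfun_prod_encode cfun_base)
qed

lemmas cfun_intros = cfun_base cfun_Suc cfun_add cfun_mult cfun_diff cfun_div cfun_mod cfun_power
  cfun_sum cfun_prod_encode cfun_fst cfun_snd cfun_if
lemmas dec_intros = dec_and dec_or dec_not dec_imp dec_eq dec_less dec_le dec_all dec_ex
lemmas sig_intros = sig_and sig_or sig_eq sig_neq sig_less sig_le sig_all sig_bex sig_ex

text \<open>A decidable matrix is what allows an enumeration in stages whose history is
  computable.\<close>

lemma sig_normal:
  assumes "sig R"
  shows "\<exists>P. dec (\<lambda>e. P (e 0) (\<lambda>i. e (Suc i))) \<and> (\<forall>e. R e \<longleftrightarrow> (\<exists>w. P w e))"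
proof -
  obtain P where P: "del2 P" "\<And>e. R e \<longleftrightarrow> (\<exists>w. P w e)" using sigE[OF assms] by blast
  have "dec (\<lambda>e. P (e 0) (\<lambda>i. e (Suc i)))"
    unfolding dec_def by (intro conjI sig_del del_not del2D[OF P(1)] trm_intros)
  then show ?thesis using P(2) by blast
qed

subsection \<open>Inductive closures\<close>

text \<open>A common format for substitution in terms, substitution in formulas and provability. A
  rule with one premise can use the same element for both.\<close>

inductive closure :: "(nat \<Rightarrow> bool) \<Rightarrow> (nat \<Rightarrow> nat \<Rightarrow> nat \<Rightarrow> bool) \<Rightarrow> nat \<Rightarrow> bool" for B S where
  base: "B x \<Longrightarrow> closure B S x"
| step: "closure B S y \<Longrightarrow> closure B S z \<Longrightarrow> S x y z \<Longrightarrow> closure B S x"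

definition derivation :: "(nat \<Rightarrow> bool) \<Rightarrow> (nat \<Rightarrow> nat \<Rightarrow> nat \<Rightarrow> bool) \<Rightarrow> nat list \<Rightarrow> bool" where
  "derivation B S xs \<longleftrightarrow>
     (\<forall>i<length xs. B (xs ! i) \<or> (\<exists>j<i. \<exists>k<i. S (xs ! i) (xs ! j) (xs ! k)))"

lemma derivation_append: "derivation B S xs \<Longrightarrow> derivation B S ys \<Longrightarrow> derivation B S (xs @ ys)"
  unfolding derivation_def
proof (intro allI impI)
  fix i assume xs: "\<forall>i<length xs. B (xs ! i) \<or> (\<exists>j<i. \<exists>k<i. S (xs ! i) (xs ! j) (xs ! k))"
    and ys: "\<forall>i<length ys. B (ys ! i) \<or> (\<exists>j<i. \<exists>k<i. S (ys ! i) (ys ! j) (ys ! k))"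
    and i: "i < length (xs @ ys)"
  let ?zs = "xs @ ys"
  show "B (?zs ! i) \<or> (\<exists>j<i. \<exists>k<i. S (?zs ! i) (?zs ! j) (?zs ! k))"
  proof (cases "i < length xs")
    case True
    have "?zs ! j = xs ! j" if "j \<le> i" for j using that True by (simp add: nth_append)
    then show ?thesis using xs True by (metis less_imp_le order_refl)
  next
    case False
    then obtain l where l: "i = length xs + l" "l < length ys" using i by (auto simp: not_less le_iff_add)
    then have "B (ys ! l) \<or> (\<exists>j<l. \<exists>k<l. S (ys ! l) (ys ! j) (ys ! k))" using ys by blast
    then show ?thesis
    proof
      assume "\<exists>j<l. \<exists>k<l. S (ys ! l) (ys ! j) (ys ! k)"
      then obtain j k where "j < l" "k < l" "S (ys ! l) (ys ! j) (ys ! k)" by blast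
      then show ?thesis using l
        by (intro disjI2 exI[of _ "length xs + j"] conjI exI[of _ "length xs + k"]) auto
    qed (simp add: l)
  qed
qed

lemma closure_iff: "closure B S x \<longleftrightarrow> (\<exists>xs. derivation B S (xs @ [x]))"
proof
  show "closure B S x \<Longrightarrow> \<exists>xs. derivation B S (xs @ [x])"
  proof (induction rule: closure.induct)
    case (base x)
    then show ?case by (intro exI[of _ "[]"]) (simp add: derivation_def)
  next
    case (step y z x)
    then obtain ys zs where d: "derivation B S ((ys @ [y]) @ (zs @ [z]))" by (blast intro: derivation_append)
    let ?xs = "(ys @ [y]) @ (zs @ [z])"
    have "derivation B S (?xs @ [x])" unfolding derivation_def
    proof (intro allI impI)
      fix i assume i: "i < length (?xs @ [x])"
      show "B ((?xs @ [x]) ! i) \<or> (\<exists>j<i. \<exists>k<i. S ((?xs @ [x]) ! i) ((?xs @ [x]) ! j) ((?xs @ [x]) ! k))"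
      proof (cases "i < length ?xs")
        case True
        have "(?xs @ [x]) ! j = ?xs ! j" if "j \<le> i" for j using that True by (simp only: nth_append) simp
        then show ?thesis using d True unfolding derivation_def by (metis less_imp_le order_refl)
      next
        case False
        then have "i = length ?xs" using i by simp
        then show ?thesis using step(3)
          by (intro disjI2 exI[of _ "length ys"] conjI exI[of _ "Suc (length ys + length zs)"])
             (auto simp: nth_append)
      qed
    qed
    then show ?case by blast
  qed
next
  assume "\<exists>xs. derivation B S (xs @ [x])"
  then obtain xs where d: "derivation B S (xs @ [x])" by blast
  have "i < length (xs @ [x]) \<Longrightarrow> closure B S ((xs @ [x]) ! i)" for i
  proof (induction i rule: less_induct)
    case (less i)
    then have "B ((xs @ [x]) ! i) \<or> (\<exists>j<i. \<exists>k<i. S ((xs @ [x]) ! i) ((xs @ [x]) ! j) ((xs @ [x]) ! k))"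
      using d unfolding derivation_def by blast
    then show ?case using less by (meson closure.intros less_trans)
  qed
  from this[of "length xs"] show "closure B S x" by simp
qed

text \<open>Membership is the existence of a finite derivation, and a beta pair codes the derivation
  by two numbers and its last index.\<close>

lemma sig_closure:
  assumes B: "sig (\<lambda>e. B (e 0))" and S: "sig (\<lambda>e. S (e 0) (e 1) (e 2))"
  shows "sig (\<lambda>e. closure B S (e 0))"
proof -
  have "closure B S x \<longleftrightarrow> (\<exists>a b n. beta a b n = x \<and>
      (\<forall>i<Suc n. B (beta a b i) \<or> (\<exists>j<i. \<exists>k<i. S (beta a b i) (beta a b j) (beta a b k))))" (is "_ \<longleftrightarrow> ?R") for x
  proof
    assume "closure B S x"
    then obtain xs where d: "derivation B S (xs @ [x])" by (auto simp: closure_iff)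
    obtain a b where ab: "\<And>i. i \<le> length xs \<Longrightarrow> beta a b i = (xs @ [x]) ! i"
      using beta_lemma[of "length xs" "\<lambda>i. (xs @ [x]) ! i"] unfolding beta_def by blast
    show ?R
    proof (rule exI[of _ a], rule exI[of _ b], rule exI[of _ "length xs"], intro conjI allI impI)
      show "beta a b (length xs) = x" by (simp add: ab)
      fix i assume i: "i < Suc (length xs)"
      then have "B ((xs @ [x]) ! i) \<or> (\<exists>j<i. \<exists>k<i. S ((xs @ [x]) ! i) ((xs @ [x]) ! j) ((xs @ [x]) ! k))"
        using d unfolding derivation_def by simp
      moreover have "beta a b j = (xs @ [x]) ! j" if "j \<le> i" for j using ab that i by simp
      ultimately show "B (beta a b i) \<or> (\<exists>j<i. \<exists>k<i. S (beta a b i) (beta a b j) (beta a b k))"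
        by (metis less_imp_le order_refl)
    qed
  next
    assume ?R
    then obtain a b n where ab: "beta a b n = x" and
      d: "\<And>i. i < Suc n \<Longrightarrow> B (beta a b i) \<or> (\<exists>j<i. \<exists>k<i. S (beta a b i) (beta a b j) (beta a b k))" by blast
    have "i < Suc n \<Longrightarrow> closure B S (beta a b i)" for i
    proof (induction i rule: less_induct)
      case (less i)
      then show ?case using d[OF less.prems] by (meson closure.intros less_trans)
    qed
    from this[of n] show "closure B S x" using ab by simp
  qed
  moreover have "sig (\<lambda>e. \<exists>a b n. beta a b n = e 0 \<and>
      (\<forall>i<Suc n. B (beta a b i) \<or> (\<exists>j<i. \<exists>k<i. S (beta a b i) (beta a b j) (beta a b k))))"
    by (intro sig_intros cfun_intros cfun_beta sig_comp3[where R=S, OF _ _ _ S]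
        sig_comp[where R="\<lambda>x e. B x", OF _ B])
  ultimately show ?thesis by simp
qed

section \<open>Recursive functions\<close>

definition rec_fun :: "nat \<Rightarrow> (nat list \<Rightarrow> nat) \<Rightarrow> bool" where
  "rec_fun k F \<longleftrightarrow> (\<exists>g. \<forall>xs. length xs = k \<longrightarrow> (\<forall>y. computes g xs y \<longleftrightarrow> y = F xs))"

inductive_cases computes_ZeroF: "computes ZeroF xs y"
inductive_cases computes_SuccF: "computes SuccF xs y"
inductive_cases computes_Proj: "computes (Proj i) xs y"
inductive_cases computes_CompE: "computes (Comp f gs) xs y"
inductive_cases computes_PrimRec_0E: "computes (PrimRec f g) (0 # xs) y"
inductive_cases computes_PrimRec_SucE: "computes (PrimRec f g) (Suc n # xs) y"
inductive_cases computes_MuE: "computes (Mu f) xs y"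

lemma computes_Comp:
  "computes (Comp f gs) xs z \<longleftrightarrow> (\<exists>ys. list_all2 (\<lambda>g y. computes g xs y) gs ys \<and> computes f ys z)"
  by (auto elim: computes_CompE intro: computes.intros)

lemma rec_fun_0: "rec_fun k (\<lambda>xs. 0)"
  unfolding rec_fun_def by (intro exI[of _ ZeroF]) (auto elim: computes_ZeroF intro: computes.intros)

lemma rec_fun_proj: "i < k \<Longrightarrow> rec_fun k (\<lambda>xs. xs ! i)"
  unfolding rec_fun_def by (intro exI[of _ "Proj i"]) (auto elim: computes_Proj intro: computes.intros)

lemma rec_fun_Suc0: "rec_fun (Suc 0) (\<lambda>xs. Suc (xs ! 0))"
  unfolding rec_fun_def
  by (intro exI[of _ SuccF]) (auto simp: length_Suc_conv elim: computes_SuccF intro: computes.intros)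

lemma rec_fun_cong: "rec_fun k F \<Longrightarrow> (\<And>xs. length xs = k \<Longrightarrow> F xs = G xs) \<Longrightarrow> rec_fun k G"
  unfolding rec_fun_def by metis

lemma rec_fun_comp:
  assumes F: "rec_fun (length Gs) F" and Gs: "\<And>G. G \<in> set Gs \<Longrightarrow> rec_fun k G"
  shows "rec_fun k (\<lambda>xs. F (map (\<lambda>G. G xs) Gs))"
proof -
  obtain f where f: "\<And>xs y. length xs = length Gs \<Longrightarrow> computes f xs y \<longleftrightarrow> y = F xs"
    using F unfolding rec_fun_def by blast
  have "\<exists>gs. \<forall>xs ys. length xs = k \<longrightarrow> (list_all2 (\<lambda>g y. computes g xs y) gs ys \<longleftrightarrow> ys = map (\<lambda>G. G xs) Gs)"
    using Gs
  proof (induction Gs)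
    case Nil then show ?case by (intro exI[of _ "[]"]) simp
  next
    case (Cons G Gs)
    then obtain gs where gs: "\<And>xs ys. length xs = k \<Longrightarrow>
      list_all2 (\<lambda>g y. computes g xs y) gs ys \<longleftrightarrow> ys = map (\<lambda>G. G xs) Gs" by auto
    obtain g where g: "\<And>xs y. length xs = k \<Longrightarrow> computes g xs y \<longleftrightarrow> y = G xs"
      using Cons.prems[of G] unfolding rec_fun_def by auto
    show ?case by (intro exI[of _ "g # gs"]) (auto simp: list_all2_Cons1 gs g)
  qed
  then obtain gs where gs: "\<And>xs ys. length xs = k \<Longrightarrow>
      list_all2 (\<lambda>g y. computes g xs y) gs ys \<longleftrightarrow> ys = map (\<lambda>G. G xs) Gs" by blast
  show ?thesis unfolding rec_fun_def
    by (intro exI[of _ "Comp f gs"]) (simp add: computes_Comp gs f)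
qed

lemma rec_fun_comp1: "rec_fun (Suc 0) (\<lambda>xs. f (xs ! 0)) \<Longrightarrow> rec_fun k F \<Longrightarrow> rec_fun k (\<lambda>xs. f (F xs))"
  using rec_fun_comp[of "[F]" "\<lambda>xs. f (xs ! 0)" k] by simp

lemma rec_fun_comp2:
  "rec_fun (Suc (Suc 0)) (\<lambda>xs. f (xs ! 0) (xs ! 1)) \<Longrightarrow> rec_fun k F \<Longrightarrow> rec_fun k G \<Longrightarrow>
    rec_fun k (\<lambda>xs. f (F xs) (G xs))"
  using rec_fun_comp[of "[F, G]" "\<lambda>xs. f (xs ! 0) (xs ! 1)" k] by auto

lemma rec_fun_prim:
  assumes "rec_fun k G" "rec_fun (Suc (Suc k)) H"
  shows "rec_fun (Suc k) (\<lambda>xs. rec_nat (G (tl xs)) (\<lambda>i y. H (i # y # tl xs)) (hd xs))"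
proof -
  obtain g where g: "\<And>xs y. length xs = k \<Longrightarrow> computes g xs y \<longleftrightarrow> y = G xs"
    using assms(1) unfolding rec_fun_def by blast
  obtain h where h: "\<And>xs y. length xs = Suc (Suc k) \<Longrightarrow> computes h xs y \<longleftrightarrow> y = H xs"
    using assms(2) unfolding rec_fun_def by blast
  have "computes (PrimRec g h) (n # xs) y \<longleftrightarrow> y = rec_nat (G xs) (\<lambda>i y. H (i # y # xs)) n"
    if "length xs = k" for n xs y
    using that
  proof (induction n arbitrary: y)
    case 0 then show ?case by (auto elim: computes_PrimRec_0E intro: computes.intros simp: g)
  next
    case (Suc n)
    show ?case
    proof
      assume "computes (PrimRec g h) (Suc n # xs) y"
      then show "y = rec_nat (G xs) (\<lambda>i y. H (i # y # xs)) (Suc n)"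
        by (rule computes_PrimRec_SucE) (use Suc h in auto)
    next
      assume "y = rec_nat (G xs) (\<lambda>i y. H (i # y # xs)) (Suc n)"
      then show "computes (PrimRec g h) (Suc n # xs) y"
        using Suc h by (intro computes.intros(6)) auto
    qed
  qed
  then show ?thesis unfolding rec_fun_def
    by (intro exI[of _ "PrimRec g h"]) (auto simp: length_Suc_conv)
qed

lemma rec_fun_Suc: "rec_fun k F \<Longrightarrow> rec_fun k (\<lambda>xs. Suc (F xs))"
  by (rule rec_fun_comp1[OF rec_fun_Suc0])

lemma rec_fun_add: "rec_fun k F \<Longrightarrow> rec_fun k G \<Longrightarrow> rec_fun k (\<lambda>xs. F xs + G xs)"
proof (rule rec_fun_comp2[where f="\<lambda>x y. x + y"])
  have [simp]: "rec_nat a (\<lambda>i y. Suc y) n = n + a" for a n :: nat by (induction n) auto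
  show "rec_fun (Suc (Suc 0)) (\<lambda>xs. xs ! 0 + xs ! 1)"
    by (rule rec_fun_cong[OF rec_fun_prim[OF rec_fun_proj[of 0] rec_fun_Suc[OF rec_fun_proj[of 1]]]])
       (auto simp: length_Suc_conv)
qed

lemma rec_fun_mult: "rec_fun k F \<Longrightarrow> rec_fun k G \<Longrightarrow> rec_fun k (\<lambda>xs. F xs * G xs)"
proof (rule rec_fun_comp2[where f="\<lambda>x y. x * y"])
  have [simp]: "rec_nat 0 (\<lambda>i y. y + a) n = n * a" for a n :: nat by (induction n) auto
  show "rec_fun (Suc (Suc 0)) (\<lambda>xs. xs ! 0 * xs ! 1)"
    by (rule rec_fun_cong[OF rec_fun_prim[OF rec_fun_0 rec_fun_add[OF rec_fun_proj[of 1] rec_fun_proj[of 2]]]])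
       (auto simp: length_Suc_conv)
qed

lemma rec_fun_diff: "rec_fun k F \<Longrightarrow> rec_fun k G \<Longrightarrow> rec_fun k (\<lambda>xs. F xs - G xs)"
proof -
  have [simp]: "rec_nat 0 (\<lambda>i y. i) n = n - 1" for n :: nat by (cases n) auto
  have "rec_fun (Suc 0) (\<lambda>xs. xs ! 0 - 1)"
    by (rule rec_fun_cong[OF rec_fun_prim[OF rec_fun_0 rec_fun_proj[of 0]]]) (auto simp: length_Suc_conv)
  then have pred: "rec_fun 3 (\<lambda>xs. xs ! 1 - 1)"
    by (rule rec_fun_comp1) (simp add: rec_fun_proj)
  have [simp]: "rec_nat a (\<lambda>i y. y - Suc 0) n = a - n" for a n :: nat by (induction n) auto
  have "rec_fun (Suc (Suc 0)) (\<lambda>xs. xs ! 1 - xs ! 0)"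
    by (rule rec_fun_cong[OF rec_fun_prim[OF rec_fun_proj[of 0]]])
       (use pred in \<open>auto simp: length_Suc_conv numeral_3_eq_3\<close>)
  then show "rec_fun k F \<Longrightarrow> rec_fun k G \<Longrightarrow> ?thesis"
    using rec_fun_comp2[of "\<lambda>x y. y - x"] by blast
qed

lemma rec_fun_sum:
  assumes "rec_fun (Suc k) F" "rec_fun k T" shows "rec_fun k (\<lambda>xs. \<Sum>x<T xs. F (x # xs))"
proof -
  \<comment> \<open>\<open>PrimRec\<close> passes counter, accumulator and parameters to its step
    function; \<open>?Gs\<close> selects everything except the accumulator, which \<open>F\<close>
    does not take.\<close>
  let ?Gs = "(\<lambda>xs. xs ! 0) # map (\<lambda>i xs. xs ! i) [2..<Suc (Suc k)]"
  have "rec_fun (Suc (Suc k)) (\<lambda>xs. F (map (\<lambda>G. G xs) ?Gs))"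
    by (rule rec_fun_comp) (use assms(1) in \<open>auto intro: rec_fun_proj simp del: upt_Suc\<close>)
  then have "rec_fun (Suc (Suc k)) (\<lambda>xs. xs ! 1 + F (map (\<lambda>G. G xs) ?Gs))"
    by (intro rec_fun_add rec_fun_proj) simp_all
  from rec_fun_prim[OF rec_fun_0 this]
  have "rec_fun (Suc k) (\<lambda>xs. rec_nat 0 (\<lambda>i y. (i # y # tl xs) ! 1 + F (map (\<lambda>G. G (i # y # tl xs)) ?Gs)) (hd xs))" .
  then have *: "rec_fun (Suc k) (\<lambda>xs. \<Sum>x<hd xs. F (x # tl xs))"
  proof (rule rec_fun_cong)
    fix xs :: "nat list" assume "length xs = Suc k"
    then have "map ((\<lambda>G. G (i # y # tl xs)) \<circ> (\<lambda>i xs. xs ! i)) [2..<Suc (Suc k)] = tl xs" for i y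
      by (intro nth_equalityI) (auto simp: nth_Cons' simp del: upt_Suc)
    then show "rec_nat 0 (\<lambda>i y. (i # y # tl xs) ! 1 + F (map (\<lambda>G. G (i # y # tl xs)) ?Gs)) (hd xs) =
       (\<Sum>x<hd xs. F (x # tl xs))"
      by (simp add: rec_nat_sum del: upt_Suc)
  qed
  let ?Hs = "T # map (\<lambda>i xs. xs ! i) [0..<k]"
  have "rec_fun k (\<lambda>xs. (\<lambda>xs. \<Sum>x<hd xs. F (x # tl xs)) (map (\<lambda>G. G xs) ?Hs))"
    by (rule rec_fun_comp) (use assms(2) * in \<open>auto intro: rec_fun_proj\<close>)
  then show ?thesis
  proof (rule rec_fun_cong)
    fix xs :: "nat list" assume "length xs = k"
    then have "map ((\<lambda>G. G xs) \<circ> (\<lambda>i xs. xs ! i)) [0..<k] = xs" 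
      by (intro nth_equalityI) auto
    then show "(\<Sum>x<hd (map (\<lambda>G. G xs) ?Hs). F (x # tl (map (\<lambda>G. G xs) ?Hs))) = (\<Sum>x<T xs. F (x # xs))"
      by simp
  qed
qed

definition list_env :: "nat list \<Rightarrow> nat \<Rightarrow> nat" where
  "list_env xs i = (if i < length xs then xs ! i else 0)"

lemma list_env_Cons: "list_env (x # xs) = case_nat x (list_env xs)"
  by (auto simp: fun_eq_iff list_env_def split: nat.split)

lemma rec_fun_tm: "rec_fun k (\<lambda>xs. tval (list_env xs) t)"
proof (induction t)
  case (Var i)
  show ?case
  proof (cases "i < k")
    case True then show ?thesis by (intro rec_fun_cong[OF rec_fun_proj[of i]]) (auto simp: list_env_def)
  next
    case False then show ?thesis by (intro rec_fun_cong[OF rec_fun_0]) (auto simp: list_env_def)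
  qed
qed (auto intro: rec_fun_0 rec_fun_Suc rec_fun_add rec_fun_mult)

text \<open>Truth is the value 0, which is what \<open>Mu\<close> searches for. Implication becomes
  \<open>(1 - F) * G\<close>, and a bounded universal quantifier a sum.\<close>

lemma rec_fun_delta0:
  "delta0 \<phi> \<Longrightarrow> \<exists>F. rec_fun k F \<and> (\<forall>xs. length xs = k \<longrightarrow> (F xs = 0 \<longleftrightarrow> sat (list_env xs) \<phi>))"
proof (induction arbitrary: k rule: delta0.induct)
  case 1
  show ?case by (intro exI[of _ "\<lambda>xs. Suc 0"]) (auto intro: rec_fun_Suc rec_fun_0)
next
  case (2 s t)
  let ?s = "\<lambda>xs. tval (list_env xs) s" and ?t = "\<lambda>xs. tval (list_env xs) t"
  show ?case
    by (intro exI[of _ "\<lambda>xs. (?s xs - ?t xs) + (?t xs - ?s xs)"] conjI rec_fun_add rec_fun_diff rec_fun_tm) auto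
next
  case (3 s t)
  let ?s = "\<lambda>xs. tval (list_env xs) s" and ?t = "\<lambda>xs. tval (list_env xs) t"
  show ?case
    by (intro exI[of _ "\<lambda>xs. Suc (?s xs) - ?t xs"] conjI rec_fun_Suc rec_fun_diff rec_fun_tm) auto
next
  case (4 \<phi> \<psi>)
  from 4(3)[of k] obtain F where F: "rec_fun k F"
    "\<And>xs. length xs = k \<Longrightarrow> F xs = 0 \<longleftrightarrow> sat (list_env xs) \<phi>" by blast
  from 4(4)[of k] obtain G where G: "rec_fun k G"
    "\<And>xs. length xs = k \<Longrightarrow> G xs = 0 \<longleftrightarrow> sat (list_env xs) \<psi>" by blast
  have "rec_fun k (\<lambda>xs. (Suc 0 - F xs) * G xs)"
    using F(1) G(1) by (intro rec_fun_mult rec_fun_diff rec_fun_Suc rec_fun_0)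
  moreover have "(Suc 0 - F xs) * G xs = 0 \<longleftrightarrow> (F xs = 0 \<longrightarrow> G xs = 0)" for xs by auto
  moreover have "sat (list_env xs) (Imp \<phi> \<psi>) \<longleftrightarrow> (F xs = 0 \<longrightarrow> G xs = 0)" if "length xs = k" for xs
    using F(2)[OF that] G(2)[OF that] by simp
  ultimately show ?case by (intro exI[of _ "\<lambda>xs. (Suc 0 - F xs) * G xs"]) simp
next
  case (5 \<phi> t)
  from 5(2)[of "Suc k"] obtain F where F: "rec_fun (Suc k) F"
    "\<And>xs. length xs = Suc k \<Longrightarrow> F xs = 0 \<longleftrightarrow> sat (list_env xs) \<phi>" by blast
  have "rec_fun k (\<lambda>xs. \<Sum>x<tval (list_env xs) t. F (x # xs))"
    by (rule rec_fun_sum[OF F(1) rec_fun_tm])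
  then show ?case using F(2)
    by (intro exI[of _ "\<lambda>xs. \<Sum>x<tval (list_env xs) t. F (x # xs)"]) (auto simp: list_env_Cons)
qed

section \<open>Representing computably enumerable relations\<close>

abbreviation env3 :: "'b \<Rightarrow> 'b \<Rightarrow> 'b \<Rightarrow> 'b \<Rightarrow> nat \<Rightarrow> 'b" where
  "env3 a b c z \<equiv> case_nat a (case_nat b (case_nat c (\<lambda>_. z)))"

definition at3 :: "fm \<Rightarrow> tm \<Rightarrow> tm \<Rightarrow> tm \<Rightarrow> fm" where
  "at3 \<tau> a b c = subst (env3 a b c Zero) \<tau>"

lemma msat_at3: "msat M e (at3 \<tau> a b c) \<longleftrightarrow> msat M (env3 (mtval M e a) (mtval M e b) (mtval M e c) (zer M)) \<tau>"
proof -
  have "(\<lambda>i. mtval M e (env3 a b c Zero i)) = env3 (mtval M e a) (mtval M e b) (mtval M e c) (zer M)"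
    by (auto simp: fun_eq_iff split: nat.split)
  then show ?thesis by (simp add: at3_def msat_subst)
qed

lemma sat_at3: "sat e (at3 \<tau> a b c) \<longleftrightarrow> sat (env3 (tval e a) (tval e b) (tval e c) 0) \<tau>"
  using msat_at3[of standard e \<tau> a b c] by (simp add: msat_standard mtval_standard) (simp add: standard_def)

lemma fv_at3: "fv (at3 \<tau> a b c) \<subseteq> fv_tm a \<union> fv_tm b \<union> fv_tm c"
  unfolding at3_def fv_subst by (auto split: nat.splits)

text \<open>Selects among all pairs \<open>(w, x)\<close> with \<open>x < w\<close> and \<open>\<tau>(w, q, x)\<close> the lexicographically
  least one. Since only trichotomy is needed for this, uniqueness is provable in \<open>PA\<close>.\<close>

definition least_fm :: "fm \<Rightarrow> fm" where
  "least_fm \<tau> = Con (Lt (Var 2) (Var 0)) (Con (at3 \<tau> (Var 0) (Var 1) (Var 2))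
     (Con (All (Imp (Lt (Var 0) (lift (Var 0)))
                 (All (Imp (Lt (Var 0) (lift (Var 0))) (Neg (at3 \<tau> (Var 1) (Var 3) (Var 0)))))))
          (All (Imp (Lt (Var 0) (lift (Var 2))) (Neg (at3 \<tau> (Var 1) (Var 2) (Var 0)))))))"

definition least_sem :: "'a str \<Rightarrow> fm \<Rightarrow> 'a \<Rightarrow> 'a \<Rightarrow> 'a \<Rightarrow> bool" where
  "least_sem M \<tau> w q x \<longleftrightarrow> les M x w \<and> msat M (env3 w q x (zer M)) \<tau> \<and>
     (\<forall>w'. les M w' w \<longrightarrow> (\<forall>x'. les M x' w' \<longrightarrow> \<not> msat M (env3 w' q x' (zer M)) \<tau>)) \<and>
     (\<forall>x'. les M x' x \<longrightarrow> \<not> msat M (env3 w q x' (zer M)) \<tau>)"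

lemma msat_least: "msat M e (least_fm \<tau>) \<longleftrightarrow> least_sem M \<tau> (e 0) (e 1) (e 2)"
  by (auto simp: least_fm_def least_sem_def msat_at3 numeral_2_eq_2 numeral_3_eq_3)

lemma (in pa_model) least_unique:
  assumes "least_sem M \<tau> w q x" "least_sem M \<tau> w' q x'" shows "w = w' \<and> x = x'"
  using assms trichotomy[of w w'] trichotomy[of x x'] unfolding least_sem_def by blast

lemma delta0_least: "delta0 \<tau> \<Longrightarrow> delta0 (least_fm \<tau>)"
  unfolding least_fm_def at3_def by (intro delta0.intros delta0_subst)

lemma fv_least: "fv (least_fm \<tau>) \<subseteq> {0, 1, 2}"
  using fv_at3[of \<tau> "Var 0" "Var 1" "Var 2"] fv_at3[of \<tau> "Var 1" "Var 3" "Var 0"]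
    fv_at3[of \<tau> "Var 1" "Var 2" "Var 0"]
  by (auto simp: least_fm_def numeral_2_eq_2 numeral_3_eq_3)

text \<open>Optimality applies only to interpreters given by a provably functional formula, whereas
  \<Sigma>1 relations are multivalued. Selecting the least pair uniformizes \<open>R\<close>: the
  output satisfies \<open>R\<close>, but need not be a prescribed \<open>y\<close>.\<close>

theorem representable:
  assumes "sig (\<lambda>e. R (e 0) (e 1))"
  obtains D \<delta> where "partial_computable D" "represents \<delta> D"
    "\<And>p x. D p = Some x \<Longrightarrow> R (code p) (code x)" "\<And>p y. R (code p) y \<Longrightarrow> D p \<noteq> None"
proof -
  obtain P where P: "del2 P" "\<And>e. R (e 0) (e 1) \<longleftrightarrow> (\<exists>v. P v e)" using sigE[OF assms] by blast
  \<comment> \<open>The witness is bounded by the first variable \<open>w\<close>; as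
    \<open>x < w\<close> is required later, a search for \<open>w\<close> finds a witness and an
    output together.\<close>
  have "del (\<lambda>e. \<exists>v<e 0. P v (\<lambda>i. case i of 0 \<Rightarrow> e 1 | Suc i \<Rightarrow> (case i of 0 \<Rightarrow> e 2 | Suc i \<Rightarrow> 0)))"
    by (intro del_ex trm_intros del2D[OF P(1)] trm_case)
  from this[unfolded del_def] obtain \<tau> where \<tau>: "delta0 \<tau>"
    "\<And>e. sat e \<tau> \<longleftrightarrow> (\<exists>v<e 0. P v (case_nat (e 1) (case_nat (e 2) (\<lambda>_. 0))))"
    by (elim exE conjE) (rule that, assumption, erule spec)
  define T where "T w q x \<longleftrightarrow> sat (env3 w q x 0) \<tau>" for w q x
  have T: "T w q x \<longleftrightarrow> (\<exists>v<w. P v (case_nat q (case_nat x (\<lambda>_. 0))))" for w q x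
    by (simp add: T_def \<tau> numeral_2_eq_2)
  have R: "R q x \<longleftrightarrow> (\<exists>v. P v (case_nat q (case_nat x (\<lambda>_. 0))))" for q x
    using P(2)[of "case_nat q (case_nat x (\<lambda>_. 0))"] by simp
  define G where "G = least_sem standard \<tau>"
  have G: "G w q x \<longleftrightarrow> x < w \<and> T w q x \<and> (\<forall>w'<w. \<forall>x'<w'. \<not> T w' q x') \<and> (\<forall>x'<x. \<not> T w q x')" for w q x
    by (auto simp: G_def least_sem_def msat_standard T_def) (auto simp: standard_def)
  have unique: "G w q x \<Longrightarrow> G w' q x' \<Longrightarrow> w = w' \<and> x = x'" for w w' q x x'
    unfolding G_def by (rule pa_model.least_unique[OF pa_model_standard])
  have GR: "R q x" if "G w q x" for w q x
  proof -
    have "T w q x" using that by (simp add: G)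
    then show ?thesis unfolding T R by blast
  qed
  have RG: "\<exists>w x. G w q x" if Rqy: "R q y" for q y
  proof -
    obtain v where v: "P v (case_nat q (case_nat y (\<lambda>_. 0)))" using Rqy unfolding R by blast
    have ex: "\<exists>w. \<exists>x<w. T w q x"
      by (intro exI[of _ "Suc (max v y)"] exI[of _ y]) (auto simp: T intro!: exI[of _ v] v)
    define w where "w = (LEAST w. \<exists>x<w. T w q x)"
    have w: "\<exists>x. x < w \<and> T w q x" unfolding w_def using LeastI_ex[OF ex] by blast
    define x where "x = (LEAST x. x < w \<and> T w q x)"
    have x: "x < w \<and> T w q x" unfolding x_def by (rule LeastI_ex[OF w])
    have "\<not> T w' q x'" if "w' < w" "x' < w'" for w' x'
      using not_less_Least[of w' "\<lambda>w. \<exists>x<w. T w q x"] that unfolding w_def by blast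
    moreover have "\<not> T w q x'" if "x' < x" for x'
      using not_less_Least[of x' "\<lambda>x. x < w \<and> T w q x"] that x unfolding x_def[symmetric] by auto
    ultimately have "G w q x" using x by (simp add: G)
    then show ?thesis by blast
  qed
  define D where "D p = (if \<exists>w z. G w (code p) (code z) then Some (THE z. \<exists>w. G w (code p) (code z)) else None)" for p
  have D: "D p = Some z \<longleftrightarrow> (\<exists>w. G w (code p) (code z))" for p z
  proof -
    have u: "z = z'" if "G w (code p) (code z)" "G w' (code p) (code z')" for w w' z z'
      using unique[OF that] bij_code by (metis bij_is_inj injD)
    show ?thesis
    proof
      assume "\<exists>w. G w (code p) (code z)"
      then show "D p = Some z" unfolding D_def using u by (auto intro!: the_equality)
    next
      assume a: "D p = Some z"
      then have ex: "\<exists>w z. G w (code p) (code z)" by (auto simp: D_def split: if_splits)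
      then obtain w z' where z': "G w (code p) (code z')" by blast
      then have "(THE z. \<exists>w. G w (code p) (code z)) = z'" using u by (intro the_equality) auto
      then have "z = z'" using a ex by (simp add: D_def)
      then show "\<exists>w. G w (code p) (code z)" using z' by blast
    qed
  qed
  have "partial_computable D"
  proof -
    have c: "delta0 (Neg (All (Imp (Lt (Var 0) (lift (Var 0))) (Neg (at3 \<tau> (Var 1) (Var 2) (Var 0))))))"
      "delta0 (Con (Lt (Var 0) (Var 1)) (at3 \<tau> (Var 1) (Var 2) (Var 0)))"
      unfolding at3_def by (intro delta0.intros delta0_subst \<tau>(1))+
    obtain F1 where F1: "rec_fun 2 F1" "\<And>w q. F1 [w, q] = 0 \<longleftrightarrow> (\<exists>x<w. T w q x)"
    proof -
      from rec_fun_delta0[OF c(1), of 2] obtain F where F: "rec_fun 2 F" and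
        F0: "\<forall>xs. length xs = 2 \<longrightarrow> F xs = 0 \<longleftrightarrow> sat (list_env xs)
          (Neg (All (Imp (Lt (Var 0) (lift (Var 0))) (Neg (at3 \<tau> (Var 1) (Var 2) (Var 0))))))" by blast
      have "F [w, q] = 0 \<longleftrightarrow> (\<exists>x<w. T w q x)" for w q
        using F0[rule_format, of "[w, q]"] by (simp add: list_env_Cons sat_at3 T_def numeral_2_eq_2)
      then show ?thesis using that F by blast
    qed
    obtain F2 where F2: "rec_fun 3 F2" "\<And>w q x. F2 [x, w, q] = 0 \<longleftrightarrow> x < w \<and> T w q x"
    proof -
      from rec_fun_delta0[OF c(2), of 3] obtain F where F: "rec_fun 3 F" and
        F0: "\<forall>xs. length xs = 3 \<longrightarrow> F xs = 0 \<longleftrightarrow> sat (list_env xs)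
          (Con (Lt (Var 0) (Var 1)) (at3 \<tau> (Var 1) (Var 2) (Var 0)))" by blast
      have "F [x, w, q] = 0 \<longleftrightarrow> x < w \<and> T w q x" for w q x
        using F0[rule_format, of "[x, w, q]"] by (simp add: list_env_Cons sat_at3 T_def numeral_2_eq_2)
      then show ?thesis using that F by blast
    qed
    obtain g1 where g1: "\<And>w q y. computes g1 [w, q] y \<longleftrightarrow> y = F1 [w, q]"
      using F1(1) unfolding rec_fun_def by (metis length_Cons list.size(3) numeral_2_eq_2)
    obtain g2 where g2: "\<And>w q x y. computes g2 [x, w, q] y \<longleftrightarrow> y = F2 [x, w, q]"
      using F2(1) unfolding rec_fun_def by (metis length_Cons list.size(3) numeral_3_eq_3)
    have Mu: "computes (Mu g) xs n \<longleftrightarrow> computes g (n # xs) 0 \<and> (\<forall>m<n. \<exists>k. computes g (m # xs) (Suc k))"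
      for g xs n by (auto elim: computes_MuE intro: computes.intros)
    have m1: "computes (Mu g1) [q] w \<longleftrightarrow> (\<exists>x<w. T w q x) \<and> (\<forall>w'<w. \<not> (\<exists>x<w'. T w' q x))" for q w
      by (simp only: Mu g1 F1(2)[symmetric]) (metis not0_implies_Suc nat.distinct(1))
    have m2: "computes (Mu g2) [w, q] x \<longleftrightarrow> (x < w \<and> T w q x) \<and> (\<forall>x'<x. \<not> (x' < w \<and> T w q x'))" for q w x
      by (simp only: Mu g2 F2(2)[symmetric]) (metis not0_implies_Suc nat.distinct(1))
    \<comment> \<open>Two searches in a row: \<open>Mu g1\<close> finds the least \<open>w\<close>,
      then \<open>Mu g2\<close> the least \<open>x\<close> for it.\<close>
    have "computes (Comp (Mu g2) [Mu g1, Proj 0]) [q] x \<longleftrightarrow> (\<exists>w. G w q x)" for q x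
    proof -
      have "computes (Proj 0) [q] y \<longleftrightarrow> y = q" for y
        using computes.intros(3)[of 0 "[q]"] by (auto elim: computes_Proj)
      then have "computes (Comp (Mu g2) [Mu g1, Proj 0]) [q] x \<longleftrightarrow>
          (\<exists>w. computes (Mu g1) [q] w \<and> computes (Mu g2) [w, q] x)"
        by (auto simp: computes_Comp list_all2_Cons1)
      also have "\<dots> \<longleftrightarrow> (\<exists>w. G w q x)"
        unfolding m1 m2 G by (meson less_trans)
      finally show ?thesis .
    qed
    then have "computes (Comp (Mu g2) [Mu g1, Proj 0]) [code p] y \<longleftrightarrow> (\<exists>x. D p = Some x \<and> y = code x)" for p y
      using bij_code by (metis D bij_pointE)
    then show ?thesis unfolding partial_computable_def by blast
  qed
  moreover have "represents (Ex (least_fm \<tau>)) D"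
    unfolding represents_def
  proof (intro conjI allI)
    show "sigma1 (Ex (least_fm \<tau>))" by (intro sigma1.intros delta0_least \<tau>(1))
    show "fv (Ex (least_fm \<tau>)) \<subseteq> {0, 1}" using fv_least[of \<tau>] by auto
    show "sat (case_nat (code p) (case_nat (code x) e)) (Ex (least_fm \<tau>)) \<longleftrightarrow> D p = Some x" for p x e
    proof -
      have "sat (case_nat (code p) (case_nat (code x) e)) (Ex (least_fm \<tau>)) \<longleftrightarrow> (\<exists>w. G w (code p) (code x))"
        by (simp add: msat_standard[symmetric] msat_least G_def numeral_2_eq_2)
      then show ?thesis by (simp add: D)
    qed
    show "PA \<turnstile> All (All (All (Imp (inst2 (Ex (least_fm \<tau>)) (Var 2) (Var 1))
       (Imp (inst2 (Ex (least_fm \<tau>)) (Var 2) (Var 0)) (Eq (Var 1) (Var 0))))))"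
    proof (rule PA_complete')
      fix M :: "nat str" and e assume "pa_model M"
      then interpret pa_model M .
      show "msat M e (All (All (All (Imp (inst2 (Ex (least_fm \<tau>)) (Var 2) (Var 1))
       (Imp (inst2 (Ex (least_fm \<tau>)) (Var 2) (Var 0)) (Eq (Var 1) (Var 0)))))))"
        using least_unique by (auto simp: msat_least numeral_2_eq_2)
    qed
  qed
  moreover have "R (code p) (code x)" if "D p = Some x" for p x using that GR D by blast
  moreover have "D p \<noteq> None" if "R (code p) y" for p y
  proof -
    obtain w x where "G w (code p) x" using RG \<open>R (code p) y\<close> by blast
    moreover obtain z where "x = code z" using bij_code by (metis bij_pointE)
    ultimately show ?thesis using D by blast
  qed
  ultimately show ?thesis using that by blast
qed

section \<open>Enumerating the theorems of PA\<close>

abbreviation (input) "cVar i \<equiv> prod_encode (0, i)"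
abbreviation (input) "cZero \<equiv> prod_encode (1, 0)"
abbreviation (input) "cSucc a \<equiv> prod_encode (2, a)"
abbreviation (input) "cAdd a b \<equiv> prod_encode (3, prod_encode (a, b))"
abbreviation (input) "cMul a b \<equiv> prod_encode (4, prod_encode (a, b))"

abbreviation (input) "cFls \<equiv> prod_encode (0, 0)"
abbreviation (input) "cEq a b \<equiv> prod_encode (1, prod_encode (a, b))"
abbreviation (input) "cLt a b \<equiv> prod_encode (2, prod_encode (a, b))"
abbreviation (input) "cImp a b \<equiv> prod_encode (3, prod_encode (a, b))"
abbreviation (input) "cAll a \<equiv> prod_encode (4, a)"

primrec enc_tm :: "tm \<Rightarrow> nat" where
  "enc_tm (Var i) = cVar i"
| "enc_tm Zero = cZero"
| "enc_tm (Succ t) = cSucc (enc_tm t)"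
| "enc_tm (Add s t) = cAdd (enc_tm s) (enc_tm t)"
| "enc_tm (Mul s t) = cMul (enc_tm s) (enc_tm t)"

primrec enc_fm :: "fm \<Rightarrow> nat" where
  "enc_fm Fls = cFls"
| "enc_fm (Eq s t) = cEq (enc_tm s) (enc_tm t)"
| "enc_fm (Lt s t) = cLt (enc_tm s) (enc_tm t)"
| "enc_fm (Imp \<phi> \<psi>) = cImp (enc_fm \<phi>) (enc_fm \<psi>)"
| "enc_fm (All \<phi>) = cAll (enc_fm \<phi>)"

lemma enc_tm_inj [simp]: "enc_tm s = enc_tm t \<longleftrightarrow> s = t"
proof (induction s arbitrary: t)
  case (Var i) then show ?case by (cases t) auto
next
  case Zero then show ?case by (cases t) auto
next
  case (Succ s) then show ?case by (cases t) auto
next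
  case (Add s s') then show ?case by (cases t) auto
next
  case (Mul s s') then show ?case by (cases t) auto
qed

lemma enc_fm_inj [simp]: "enc_fm \<phi> = enc_fm \<psi> \<longleftrightarrow> \<phi> = \<psi>"
proof (induction \<phi> arbitrary: \<psi>)
  case Fls then show ?case by (cases \<psi>) auto
next
  case (Eq s t) then show ?case by (cases \<psi>) auto
next
  case (Lt s t) then show ?case by (cases \<psi>) auto
next
  case (Imp \<phi> \<phi>') then show ?case by (cases \<psi>) auto
next
  case (All \<phi>) then show ?case by (cases \<psi>) auto
qed

text \<open>All substitutions in the calculus have the form \<open>sb t k 0\<close>, and passing under a
  quantifier turns \<open>sb t k d\<close> into \<open>sb (lift t) k (Suc d)\<close>.\<close>

definition sb :: "tm \<Rightarrow> nat \<Rightarrow> nat \<Rightarrow> nat \<Rightarrow> tm" where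
  "sb t k d i = (if i < d then Var i else if i = d then t else Var (i - 1 + k))"

lemma up_sb: "up (sb t k d) = sb (lift t) k (Suc d)"
  by (auto simp: fun_eq_iff sb_def split: nat.split)

text \<open>The parameters make 0 go to \<open>Var 1\<close> and each i > 0 to
  \<open>Var (i - 1 + 2)\<close>. Thus lifting is itself a substitution of the coded form.\<close>

lemma lift_sb: "lift t = subst_tm (sb (Var 1) 2 0) t"
  by (rule subst_tm_cong) (simp add: sb_def)

lemma inst_sb: "inst \<phi> t = subst (sb t 0 0) \<phi>"
  unfolding inst_def by (rule subst_cong) (simp add: sb_def split: nat.split)

lemma lift_fm_sb: "lift_fm \<phi> = subst (sb (Var 1) 2 0) \<phi>"
  unfolding lift_fm_def by (rule subst_cong) (simp add: sb_def)

lemma Succ_sb: "subst (case_nat (Succ (Var 0)) (\<lambda>i. Var (Suc i))) \<phi> = subst (sb (Succ (Var 0)) 1 0) \<phi>"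
  by (rule subst_cong) (simp add: sb_def split: nat.split)

abbreviation (input) tup :: "nat \<Rightarrow> nat \<Rightarrow> nat \<Rightarrow> nat \<Rightarrow> nat \<Rightarrow> nat" where
  "tup t k d s s' \<equiv> prod_encode (t, prod_encode (k, prod_encode (d, prod_encode (s, s'))))"

definition ST_base :: "nat \<Rightarrow> bool" where
  "ST_base x \<longleftrightarrow> (\<exists>t k d i.
     (x = tup t k d (cVar i) (cVar i) \<and> i < d) \<or> x = tup t k d (cVar d) t \<or>
     (x = tup t k d (cVar i) (cVar (i - 1 + k)) \<and> d < i) \<or> x = tup t k d cZero cZero)"

definition ST_step :: "nat \<Rightarrow> nat \<Rightarrow> nat \<Rightarrow> bool" where
  "ST_step x y z \<longleftrightarrow> (\<exists>t k d a a' b b'. y = tup t k d a a' \<and> z = tup t k d b b' \<and>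
     (x = tup t k d (cSucc a) (cSucc a') \<or> x = tup t k d (cAdd a b) (cAdd a' b') \<or>
      x = tup t k d (cMul a b) (cMul a' b')))"

definition ST :: "nat \<Rightarrow> bool" where "ST = closure ST_base ST_step"

lemma sig_ST: "cfun F \<Longrightarrow> sig (\<lambda>e. ST (F e))"
proof (erule sig_comp)
  show "sig (\<lambda>e. ST (e 0))" unfolding ST_def
  proof (rule sig_closure)
    show "sig (\<lambda>e. ST_base (e 0))" unfolding ST_base_def by (intro sig_intros cfun_intros)
    show "sig (\<lambda>e. ST_step (e 0) (e 1) (e 2))" unfolding ST_step_def by (intro sig_intros cfun_intros)
  qed
qed

text \<open>The closure also contains tuples whose first component codes no term. All rules keep
  \<open>t\<close>, \<open>k\<close> and \<open>d\<close>, so fixing \<open>enc_tm t\<close>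
  excludes them.\<close>

lemma ST_iff: "ST (tup (enc_tm t) k d s s') \<longleftrightarrow>
    (\<exists>u. s = enc_tm u \<and> s' = enc_tm (subst_tm (sb t k d) u))"
proof
  have "ST x \<Longrightarrow> \<forall>s s'. x = tup (enc_tm t) k d s s' \<longrightarrow>
      (\<exists>u. s = enc_tm u \<and> s' = enc_tm (subst_tm (sb t k d) u))" for x
    unfolding ST_def
  proof (induction rule: closure.induct)
    case (base x)
    show ?case
    proof (intro allI impI)
      fix s s' assume x: "x = tup (enc_tm t) k d s s'"
      then consider i where "s = cVar i" "s' = cVar i" "i < d" | "s = cVar d" "s' = enc_tm t"
        | i where "s = cVar i" "s' = cVar (i - 1 + k)" "d < i" | "s = cZero" "s' = cZero"
        using base unfolding ST_base_def by auto
      then show "\<exists>u. s = enc_tm u \<and> s' = enc_tm (subst_tm (sb t k d) u)"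
      proof cases
        case (1 i) then show ?thesis by (intro exI[of _ "Var i"]) (simp add: sb_def)
      next
        case 2 then show ?thesis by (intro exI[of _ "Var d"]) (simp add: sb_def)
      next
        case (3 i) then show ?thesis by (intro exI[of _ "Var i"]) (simp add: sb_def)
      next
        case 4 then show ?thesis by (intro exI[of _ Zero]) simp
      qed
    qed
  next
    case (step y z x)
    show ?case
    proof (intro allI impI)
      fix s s' assume "x = tup (enc_tm t) k d s s'"
      then obtain a a' b b' where y: "y = tup (enc_tm t) k d a a'" and z: "z = tup (enc_tm t) k d b b'"
        and c: "(s = cSucc a \<and> s' = cSucc a') \<or> (s = cAdd a b \<and> s' = cAdd a' b') \<or>
          (s = cMul a b \<and> s' = cMul a' b')"
        using step.hyps(3) unfolding ST_step_def by auto
      from step.IH(1)[rule_format, OF y] obtain u where u: "a = enc_tm u" "a' = enc_tm (subst_tm (sb t k d) u)"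
        by blast
      from step.IH(2)[rule_format, OF z] obtain v where v: "b = enc_tm v" "b' = enc_tm (subst_tm (sb t k d) v)"
        by blast
      show "\<exists>u. s = enc_tm u \<and> s' = enc_tm (subst_tm (sb t k d) u)"
        using c u v exI[of _ "Succ u"] exI[of _ "Add u v"] exI[of _ "Mul u v"]
        by (metis enc_tm.simps(3-5) subst_tm.simps(3-5))
    qed
  qed
  then show "ST (tup (enc_tm t) k d s s') \<Longrightarrow>
    \<exists>u. s = enc_tm u \<and> s' = enc_tm (subst_tm (sb t k d) u)" by blast
next
  have "ST (tup (enc_tm t) k d (enc_tm u) (enc_tm (subst_tm (sb t k d) u)))" for u
    unfolding ST_def
  proof (induction u)
    case (Var i)
    have "ST_base (tup (enc_tm t) k d (cVar i) (enc_tm (sb t k d i)))"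
      unfolding ST_base_def
      by (rule exI[of _ "enc_tm t"], rule exI[of _ k], rule exI[of _ d], rule exI[of _ i])
         (auto simp: sb_def)
    then show ?case by (intro closure.base) simp
  next
    case Zero
    show ?case by (rule closure.base) (simp add: ST_base_def)
  next
    case (Succ u)
    show ?case by (rule closure.step[OF Succ Succ]) (simp add: ST_step_def)
  next
    case (Add u v)
    show ?case by (rule closure.step[OF Add]) (simp add: ST_step_def)
  next
    case (Mul u v)
    show ?case by (rule closure.step[OF Mul]) (simp add: ST_step_def)
  qed
  then show "\<exists>u. s = enc_tm u \<and> s' = enc_tm (subst_tm (sb t k d) u) \<Longrightarrow>
    ST (tup (enc_tm t) k d s s')" by blast
qed

definition SF_base :: "nat \<Rightarrow> bool" where
  "SF_base x \<longleftrightarrow> (\<exists>t k d a a' b b'. x = tup t k d cFls cFls \<or>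
     (ST (tup t k d a a') \<and> ST (tup t k d b b') \<and>
      (x = tup t k d (cEq a b) (cEq a' b') \<or> x = tup t k d (cLt a b) (cLt a' b'))))"

text \<open>Under a quantifier the depth grows and \<open>t\<close> has to be lifted; the lifted
  code \<open>t'\<close> is obtained from \<open>ST\<close>, by the description of
  \<open>lift\<close> as a substitution.\<close>

definition SF_step :: "nat \<Rightarrow> nat \<Rightarrow> nat \<Rightarrow> bool" where
  "SF_step x y z \<longleftrightarrow> (\<exists>t k d t' a a' b b'.
     (y = tup t k d a a' \<and> z = tup t k d b b' \<and> x = tup t k d (cImp a b) (cImp a' b')) \<or>
     (y = tup t' k (Suc d) a a' \<and> ST (tup (enc_tm (Var 1)) 2 0 t t') \<and>
       x = tup t k d (cAll a) (cAll a')))"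

definition SF :: "nat \<Rightarrow> bool" where "SF = closure SF_base SF_step"

lemma sig_SF: "cfun F \<Longrightarrow> sig (\<lambda>e. SF (F e))"
proof (erule sig_comp)
  show "sig (\<lambda>e. SF (e 0))" unfolding SF_def
  proof (rule sig_closure)
    show "sig (\<lambda>e. SF_base (e 0))" unfolding SF_base_def by (intro sig_intros cfun_intros sig_ST)
    show "sig (\<lambda>e. SF_step (e 0) (e 1) (e 2))"
      unfolding SF_step_def by (intro sig_intros cfun_intros sig_ST)
  qed
qed

lemma SF_iff: "SF (tup (enc_tm t) k d s s') \<longleftrightarrow>
    (\<exists>\<phi>. s = enc_fm \<phi> \<and> s' = enc_fm (subst (sb t k d) \<phi>))"
proof
  have "SF x \<Longrightarrow> \<forall>t d s s'. x = tup (enc_tm t) k d s s' \<longrightarrow>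
      (\<exists>\<phi>. s = enc_fm \<phi> \<and> s' = enc_fm (subst (sb t k d) \<phi>))" for x
    unfolding SF_def
  proof (induction rule: closure.induct)
    case (base x)
    show ?case
    proof (intro allI impI)
      fix t d s s' assume x: "x = tup (enc_tm t) k d s s'"
      then consider "s = cFls" "s' = cFls" | a a' b b' where
        "ST (tup (enc_tm t) k d a a')" "ST (tup (enc_tm t) k d b b')"
        "(s = cEq a b \<and> s' = cEq a' b') \<or> (s = cLt a b \<and> s' = cLt a' b')"
        using base unfolding SF_base_def by auto
      then show "\<exists>\<phi>. s = enc_fm \<phi> \<and> s' = enc_fm (subst (sb t k d) \<phi>)"
      proof cases
        case 1 then show ?thesis by (intro exI[of _ Fls]) simp
      next
        case (2 a a' b b')
        then obtain u v where "a = enc_tm u" "a' = enc_tm (subst_tm (sb t k d) u)"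
          "b = enc_tm v" "b' = enc_tm (subst_tm (sb t k d) v)" unfolding ST_iff by blast
        then show ?thesis using 2(3) by (metis enc_fm.simps(2,3) subst.simps(2,3))
      qed
    qed
  next
    case (step y z x)
    show ?case
    proof (intro allI impI)
      fix t d s s' assume "x = tup (enc_tm t) k d s s'"
      then consider a a' b b' where "y = tup (enc_tm t) k d a a'" "z = tup (enc_tm t) k d b b'"
          "s = cImp a b" "s' = cImp a' b'"
        | a a' t' where "y = tup t' k (Suc d) a a'" "ST (tup (enc_tm (Var 1)) 2 0 (enc_tm t) t')"
          "s = cAll a" "s' = cAll a'"
        using step.hyps(3) unfolding SF_step_def by auto
      then show "\<exists>\<phi>. s = enc_fm \<phi> \<and> s' = enc_fm (subst (sb t k d) \<phi>)"
      proof cases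
        case (1 a a' b b')
        then show ?thesis using step.IH(1)[rule_format, OF 1(1)] step.IH(2)[rule_format, OF 1(2)]
          by (metis enc_fm.simps(4) subst.simps(4))
      next
        case (2 a a' t')
        have "t' = enc_tm (lift t)" using 2(2) unfolding ST_iff lift_sb by auto
        then have "y = tup (enc_tm (lift t)) k (Suc d) a a'" using 2(1) by simp
        from step.IH(1)[rule_format, OF this] show ?thesis using 2(3,4)
          by (metis enc_fm.simps(5) subst.simps(5) up_sb)
      qed
    qed
  qed
  then show "SF (tup (enc_tm t) k d s s') \<Longrightarrow>
    \<exists>\<phi>. s = enc_fm \<phi> \<and> s' = enc_fm (subst (sb t k d) \<phi>)" by blast
next
  have T: "ST (tup (enc_tm t) k d (enc_tm u) (enc_tm (subst_tm (sb t k d) u)))" for t k d u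
    unfolding ST_iff by blast
  have "SF (tup (enc_tm t) k d (enc_fm \<phi>) (enc_fm (subst (sb t k d) \<phi>)))" for \<phi>
    unfolding SF_def
  proof (induction \<phi> arbitrary: t d)
    case Fls
    show ?case by (rule closure.base) (simp add: SF_base_def)
  next
    case (Eq u v)
    show ?case by (rule closure.base) (use T in \<open>auto simp: SF_base_def\<close>)
  next
    case (Lt u v)
    show ?case by (rule closure.base) (use T in \<open>auto simp: SF_base_def\<close>)
  next
    case (Imp \<phi> \<psi>)
    show ?case by (rule closure.step[OF Imp]) (simp add: SF_step_def)
  next
    case (All \<phi>)
    have "ST (tup (enc_tm (Var 1)) 2 0 (enc_tm t) (enc_tm (lift t)))"
      unfolding lift_sb by (rule T)
    then show ?case
      by (intro closure.step[OF All[of "lift t" "Suc d"] All[of "lift t" "Suc d"]])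
         (auto simp: SF_step_def up_sb)
  qed
  then show "\<exists>\<phi>. s = enc_fm \<phi> \<and> s' = enc_fm (subst (sb t k d) \<phi>) \<Longrightarrow>
    SF (tup (enc_tm t) k d s s')" by blast
qed

text \<open>Well-formedness needs no recursion of its own: exactly the codes of terms, or of
  formulas, possess a substitution instance.\<close>

definition is_tm :: "nat \<Rightarrow> bool" where "is_tm s \<longleftrightarrow> (\<exists>s'. ST (tup (enc_tm Zero) 0 0 s s'))"
definition is_fm :: "nat \<Rightarrow> bool" where "is_fm s \<longleftrightarrow> (\<exists>s'. SF (tup (enc_tm Zero) 0 0 s s'))"

lemma is_tm_iff: "is_tm s \<longleftrightarrow> (\<exists>u. s = enc_tm u)"
  unfolding is_tm_def ST_iff by blast

lemma is_fm_iff: "is_fm s \<longleftrightarrow> (\<exists>\<phi>. s = enc_fm \<phi>)"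
  unfolding is_fm_def SF_iff by blast

lemma sig_is_tm: "cfun F \<Longrightarrow> sig (\<lambda>e. is_tm (F e))"
  unfolding is_tm_def by (erule sig_comp) (intro sig_ex sig_ST cfun_intros)

lemma sig_is_fm: "cfun F \<Longrightarrow> sig (\<lambda>e. is_fm (F e))"
  unfolding is_fm_def by (erule sig_comp) (intro sig_ex sig_SF cfun_intros)

section \<open>The provability predicate of PA\<close>

definition Prov_base :: "nat \<Rightarrow> bool" where
  "Prov_base x \<longleftrightarrow>
    (\<exists>a b. is_fm a \<and> is_fm b \<and> x = cImp a (cImp b a)) \<or>
    (\<exists>a b c. is_fm a \<and> is_fm b \<and> is_fm c \<and>
       x = cImp (cImp a (cImp b c)) (cImp (cImp a b) (cImp a c))) \<or>
    (\<exists>a. is_fm a \<and> x = cImp (cImp (cImp a cFls) cFls) a) \<or>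
    (\<exists>a b t. is_tm t \<and> SF (tup t 0 0 a b) \<and> x = cImp (cAll a) b) \<or>
    (\<exists>a b. is_fm a \<and> is_fm b \<and> x = cImp (cAll (cImp a b)) (cImp (cAll a) (cAll b))) \<or>
    (\<exists>a b. SF (tup (enc_tm (Var 1)) 2 0 a b) \<and> x = cImp a (cAll b)) \<or>
    (\<exists>t. is_tm t \<and> x = cEq t t) \<or>
    (\<exists>s t a b c. is_tm s \<and> is_tm t \<and> SF (tup s 0 0 a b) \<and> SF (tup t 0 0 a c) \<and>
       x = cImp (cEq s t) (cImp b c)) \<or>
    (\<exists>a b c. SF (tup (enc_tm Zero) 0 0 a b) \<and> SF (tup (enc_tm (Succ (Var 0))) 1 0 a c) \<and>
       x = cImp b (cImp (cAll (cImp a c)) (cAll a))) \<or>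
    x = enc_fm (Neg (Eq (Succ (Var 0)) Zero)) \<or>
    x = enc_fm (Imp (Eq (Succ (Var 0)) (Succ (Var 1))) (Eq (Var 0) (Var 1))) \<or>
    x = enc_fm (Eq (Add (Var 0) Zero) (Var 0)) \<or>
    x = enc_fm (Eq (Add (Var 0) (Succ (Var 1))) (Succ (Add (Var 0) (Var 1)))) \<or>
    x = enc_fm (Eq (Mul (Var 0) Zero) Zero) \<or>
    x = enc_fm (Eq (Mul (Var 0) (Succ (Var 1))) (Add (Mul (Var 0) (Var 1)) (Var 0))) \<or>
    x = enc_fm (Iff (Lt (Var 0) (Var 1)) (Ex (Eq (Add (Var 1) (Succ (Var 0))) (Var 2))))"

definition Prov_step :: "nat \<Rightarrow> nat \<Rightarrow> nat \<Rightarrow> bool" where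
  "Prov_step x y z \<longleftrightarrow> y = cImp z x \<or> x = cAll y"

definition Prov :: "nat \<Rightarrow> bool" where "Prov = closure Prov_base Prov_step"

lemma sig_Prov: "cfun F \<Longrightarrow> sig (\<lambda>e. Prov (F e))"
proof (erule sig_comp)
  show "sig (\<lambda>e. Prov (e 0))" unfolding Prov_def
  proof (rule sig_closure)
    show "sig (\<lambda>e. Prov_base (e 0))"
      unfolding Prov_base_def by (intro sig_intros cfun_intros sig_SF sig_is_tm sig_is_fm)
    show "sig (\<lambda>e. Prov_step (e 0) (e 1) (e 2))"
      unfolding Prov_step_def by (intro sig_intros cfun_intros)
  qed
qed

lemma Prov_base_sound: "Prov_base x \<Longrightarrow> \<exists>\<phi>. x = enc_fm \<phi> \<and> PA \<turnstile> \<phi>"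
proof -
  have I: "\<exists>\<phi>. x = enc_fm \<phi> \<and> PA \<turnstile> \<phi>" if "PA \<turnstile> \<phi>" "x = enc_fm \<phi>" for \<phi> using that by blast
  have inst: "\<exists>\<phi>. a = enc_fm \<phi> \<and> b = enc_fm (inst \<phi> t)" if "SF (tup (enc_tm t) 0 0 a b)" for t a b
    using that unfolding SF_iff inst_sb by blast
  assume "Prov_base x"
  then show ?thesis unfolding Prov_base_def
  proof (elim disjE exE conjE)
    fix a b assume "is_fm a" "is_fm b" "x = cImp a (cImp b a)"
    then obtain \<phi> \<psi> where "x = enc_fm (Imp \<phi> (Imp \<psi> \<phi>))" by (auto simp: is_fm_iff)
    then show ?thesis by (rule I[OF prv.ImpK])
  next
    fix a b c assume "is_fm a" "is_fm b" "is_fm c" "x = cImp (cImp a (cImp b c)) (cImp (cImp a b) (cImp a c))"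
    then obtain \<phi> \<psi> \<chi> where "x = enc_fm (Imp (Imp \<phi> (Imp \<psi> \<chi>)) (Imp (Imp \<phi> \<psi>) (Imp \<phi> \<chi>)))"
      by (auto simp: is_fm_iff)
    then show ?thesis by (rule I[OF prv.ImpS])
  next
    fix a assume "is_fm a" "x = cImp (cImp (cImp a cFls) cFls) a"
    then obtain \<phi> where "x = enc_fm (Imp (Neg (Neg \<phi>)) \<phi>)" by (auto simp: is_fm_iff)
    then show ?thesis by (rule I[OF prv.DNeg])
  next
    fix a b t assume t: "is_tm t" and s: "SF (tup t 0 0 a b)" and x: "x = cImp (cAll a) b"
    obtain u where u: "t = enc_tm u" using t by (auto simp: is_tm_iff)
    obtain \<phi> where "a = enc_fm \<phi>" "b = enc_fm (inst \<phi> u)" using inst[of u a b] s u by blast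
    then show ?thesis using x by (intro I[OF prv.AllE[of _ \<phi> u]]) simp
  next
    fix a b assume "is_fm a" "is_fm b" "x = cImp (cAll (cImp a b)) (cImp (cAll a) (cAll b))"
    then obtain \<phi> \<psi> where "x = enc_fm (Imp (All (Imp \<phi> \<psi>)) (Imp (All \<phi>) (All \<psi>)))"
      by (auto simp: is_fm_iff)
    then show ?thesis by (rule I[OF prv.AllImp])
  next
    fix a b assume s: "SF (tup (enc_tm (Var 1)) 2 0 a b)" and x: "x = cImp a (cAll b)"
    obtain \<phi> where "a = enc_fm \<phi>" "b = enc_fm (lift_fm \<phi>)" using s unfolding SF_iff lift_fm_sb by blast
    then show ?thesis using x by (intro I[OF prv.AllI[of _ \<phi>]]) simp
  next
    fix t assume "is_tm t" "x = cEq t t"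
    then obtain u where "x = enc_fm (Eq u u)" by (auto simp: is_tm_iff)
    then show ?thesis by (rule I[OF prv.EqRefl])
  next
    fix s t a b c assume st: "is_tm s" "is_tm t" and S: "SF (tup s 0 0 a b)" "SF (tup t 0 0 a c)"
      and x: "x = cImp (cEq s t) (cImp b c)"
    obtain u v where uv: "s = enc_tm u" "t = enc_tm v" using st by (auto simp: is_tm_iff)
    obtain \<phi> \<psi> where "a = enc_fm \<phi>" "b = enc_fm (inst \<phi> u)" "a = enc_fm \<psi>" "c = enc_fm (inst \<psi> v)"
      using inst[of u a b] inst[of v a c] S uv by blast
    then show ?thesis using x uv by (intro I[OF prv.EqSubst[of _ u v \<phi>]]) simp
  next
    fix a b c assume S: "SF (tup (enc_tm Zero) 0 0 a b)" "SF (tup (enc_tm (Succ (Var 0))) 1 0 a c)"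
      and x: "x = cImp b (cImp (cAll (cImp a c)) (cAll a))"
    obtain \<phi> where \<phi>: "a = enc_fm \<phi>" "b = enc_fm (inst \<phi> Zero)" using inst[OF S(1)] by blast
    have "c = enc_fm (subst (case_nat (Succ (Var 0)) (\<lambda>i. Var (Suc i))) \<phi>)"
      using S(2) \<phi>(1) unfolding SF_iff Succ_sb by auto
    then show ?thesis using x \<phi> by (intro I[OF prv.Ax[OF PA.intros(8)[of \<phi>]]]) simp
  qed (erule I[rotated], rule prv.Ax, rule PA.intros)+
qed

lemma Prov_iff: "Prov (enc_fm \<phi>) \<longleftrightarrow> PA \<turnstile> \<phi>"
proof
  have "Prov x \<Longrightarrow> \<exists>\<phi>. x = enc_fm \<phi> \<and> PA \<turnstile> \<phi>" for x
    unfolding Prov_def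
  proof (induction rule: closure.induct)
    case (base x)
    then show ?case by (rule Prov_base_sound)
  next
    case (step y z x)
    obtain \<phi> \<psi> where \<phi>: "y = enc_fm \<phi>" "PA \<turnstile> \<phi>" and \<psi>: "z = enc_fm \<psi>" "PA \<turnstile> \<psi>" using step by blast
    from step.hyps(3) consider "y = cImp z x" | "x = cAll y" unfolding Prov_step_def by blast
    then show ?case
    proof cases
      case 1
      then obtain \<chi> where "\<phi> = Imp \<psi> \<chi>" "x = enc_fm \<chi>" using \<phi>(1) \<psi>(1) by (cases \<phi>) auto
      then show ?thesis using \<phi>(2) \<psi>(2) prv.MP by blast
    next
      case 2
      then show ?thesis using \<phi> by (intro exI[of _ "All \<phi>"]) (auto intro: prv.Gen)
    qed
  qed
  then show "Prov (enc_fm \<phi>) \<Longrightarrow> PA \<turnstile> \<phi>" by (metis enc_fm_inj)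
next
  have F: "is_fm (enc_fm \<phi>)" for \<phi> unfolding is_fm_iff by blast
  have T: "is_tm (enc_tm t)" for t unfolding is_tm_iff by blast
  have S: "SF (tup (enc_tm t) k d (enc_fm \<phi>) (enc_fm (subst (sb t k d) \<phi>)))" for t k d \<phi>
    unfolding SF_iff by blast
  show "PA \<turnstile> \<phi> \<Longrightarrow> Prov (enc_fm \<phi>)" unfolding Prov_def
  proof (induction rule: prv.induct)
    case (Ax \<phi>)
    then show ?case
    proof (cases rule: PA.cases)
      case (8 \<psi>)
      have "SF (tup (enc_tm Zero) 0 0 (enc_fm \<psi>) (enc_fm (inst \<psi> Zero)))"
        "SF (tup (enc_tm (Succ (Var 0))) 1 0 (enc_fm \<psi>)
          (enc_fm (subst (case_nat (Succ (Var 0)) (\<lambda>i. Var (Suc i))) \<psi>)))"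
        unfolding inst_sb Succ_sb by (rule S)+
      then have "\<exists>a b c. SF (tup (enc_tm Zero) 0 0 a b) \<and> SF (tup (enc_tm (Succ (Var 0))) 1 0 a c) \<and>
          enc_fm \<phi> = cImp b (cImp (cAll (cImp a c)) (cAll a))"
        unfolding 8 by (metis enc_fm.simps(4,5))
      then show ?thesis by (intro closure.base) (simp only: Prov_base_def simp_thms)
    qed (rule closure.base, simp only: Prov_base_def simp_thms)+
  next
    case (ImpK \<phi> \<psi>)
    have "\<exists>a b. is_fm a \<and> is_fm b \<and> enc_fm (Imp \<phi> (Imp \<psi> \<phi>)) = cImp a (cImp b a)"
      using F by auto
    then show ?case by (intro closure.base) (simp only: Prov_base_def simp_thms)
  next
    case (ImpS \<phi> \<psi> \<chi>)
    have "\<exists>a b c. is_fm a \<and> is_fm b \<and> is_fm c \<and>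
        enc_fm (Imp (Imp \<phi> (Imp \<psi> \<chi>)) (Imp (Imp \<phi> \<psi>) (Imp \<phi> \<chi>))) =
        cImp (cImp a (cImp b c)) (cImp (cImp a b) (cImp a c))" using F by auto
    then show ?case by (intro closure.base) (simp only: Prov_base_def simp_thms)
  next
    case (DNeg \<phi>)
    have "\<exists>a. is_fm a \<and> enc_fm (Imp (Neg (Neg \<phi>)) \<phi>) = cImp (cImp (cImp a cFls) cFls) a"
      using F by auto
    then show ?case by (intro closure.base) (simp only: Prov_base_def simp_thms)
  next
    case (AllE \<phi> t)
    have "SF (tup (enc_tm t) 0 0 (enc_fm \<phi>) (enc_fm (inst \<phi> t)))" unfolding inst_sb by (rule S)
    then have "\<exists>a b t'. is_tm t' \<and> SF (tup t' 0 0 a b) \<and> enc_fm (Imp (All \<phi>) (inst \<phi> t)) = cImp (cAll a) b"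
      using T by (metis enc_fm.simps(4,5))
    then show ?case by (intro closure.base) (simp only: Prov_base_def simp_thms)
  next
    case (AllImp \<phi> \<psi>)
    have "\<exists>a b. is_fm a \<and> is_fm b \<and> enc_fm (Imp (All (Imp \<phi> \<psi>)) (Imp (All \<phi>) (All \<psi>))) =
        cImp (cAll (cImp a b)) (cImp (cAll a) (cAll b))" using F by auto
    then show ?case by (intro closure.base) (simp only: Prov_base_def simp_thms)
  next
    case (AllI \<phi>)
    have "SF (tup (enc_tm (Var 1)) 2 0 (enc_fm \<phi>) (enc_fm (lift_fm \<phi>)))" unfolding lift_fm_sb by (rule S)
    then have "\<exists>a b. SF (tup (enc_tm (Var 1)) 2 0 a b) \<and> enc_fm (Imp \<phi> (All (lift_fm \<phi>))) = cImp a (cAll b)"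
      by (metis enc_fm.simps(4,5))
    then show ?case by (intro closure.base) (simp only: Prov_base_def simp_thms)
  next
    case (EqRefl t)
    have "\<exists>a. is_tm a \<and> enc_fm (Eq t t) = cEq a a" using T by auto
    then show ?case by (intro closure.base) (simp only: Prov_base_def simp_thms)
  next
    case (EqSubst s t \<phi>)
    have "SF (tup (enc_tm s) 0 0 (enc_fm \<phi>) (enc_fm (inst \<phi> s)))"
      "SF (tup (enc_tm t) 0 0 (enc_fm \<phi>) (enc_fm (inst \<phi> t)))" unfolding inst_sb by (rule S)+
    then have "\<exists>s' t' a b c. is_tm s' \<and> is_tm t' \<and> SF (tup s' 0 0 a b) \<and> SF (tup t' 0 0 a c) \<and>
       enc_fm (Imp (Eq s t) (Imp (inst \<phi> s) (inst \<phi> t))) = cImp (cEq s' t') (cImp b c)"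
      using T by (metis enc_fm.simps(2,4))
    then show ?case by (intro closure.base) (simp only: Prov_base_def simp_thms)
  next
    case (MP \<phi> \<psi>)
    show ?case by (rule closure.step[OF MP(3,4)]) (simp add: Prov_step_def)
  next
    case (Gen \<phi>)
    show ?case by (rule closure.step[OF Gen(2,2)]) (simp add: Prov_step_def)
  qed
qed

lemma cfun_num: "cfun F \<Longrightarrow> cfun (\<lambda>e. enc_tm (num_tm (F e)))"
proof -
  assume F: "cfun F"
  have "rec_nat cZero (\<lambda>i y. cSucc y) n = enc_tm (num_tm n)" for n by (induction n) auto
  moreover have "cfun (\<lambda>e. rec_nat cZero (\<lambda>i y. cSucc y) (F e))"
    by (intro cfun_rec cfun_intros F)
  ultimately show ?thesis by simp
qed

text \<open>Numerals enter through equational hypotheses on free variables. The code of this formula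
  is then an explicit function of the four numbers, with no substitution to compute.\<close>

definition at_nums :: "fm \<Rightarrow> nat \<Rightarrow> nat \<Rightarrow> nat \<Rightarrow> nat \<Rightarrow> fm" where
  "at_nums \<chi> a b c d = Imp (Eq (Var 0) (num_tm a)) (Imp (Eq (Var 1) (num_tm b))
     (Imp (Eq (Var 2) (num_tm c)) (Imp (Eq (Var 3) (num_tm d)) \<chi>)))"

lemma sig_at_nums:
  assumes "cfun A" "cfun B" "cfun C" "cfun E"
  shows "sig (\<lambda>e. PA \<turnstile> at_nums \<chi> (A e) (B e) (C e) (E e))"
  unfolding Prov_iff[symmetric] at_nums_def enc_fm.simps
  by (intro sig_Prov cfun_intros cfun_num assms)

lemma prv_at_nums:
  "PA \<turnstile> at_nums \<chi> a b c d \<longleftrightarrow> (\<forall>(M :: nat str) e. pa_model M \<longrightarrow>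
     msat M (case_nat (pa_model.std M a) (case_nat (pa_model.std M b)
       (case_nat (pa_model.std M c) (case_nat (pa_model.std M d) e)))) \<chi>)"
proof (intro iffI allI impI)
  fix M :: "nat str" and e
  assume p: "PA \<turnstile> at_nums \<chi> a b c d" and "pa_model M"
  then interpret pa_model M by simp
  show "msat M (case_nat (std a) (case_nat (std b) (case_nat (std c) (case_nat (std d) e)))) \<chi>"
    using prv_msat[OF p, of "case_nat (std a) (case_nat (std b) (case_nat (std c) (case_nat (std d) e)))"]
    by (simp add: at_nums_def numeral_2_eq_2 numeral_3_eq_3)
next
  assume a: "\<forall>(M :: nat str) e. pa_model M \<longrightarrow>
     msat M (case_nat (pa_model.std M a) (case_nat (pa_model.std M b)
       (case_nat (pa_model.std M c) (case_nat (pa_model.std M d) e)))) \<chi>"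
  show "PA \<turnstile> at_nums \<chi> a b c d"
  proof (rule PA_complete')
    fix M :: "nat str" and e assume M: "pa_model M"
    then interpret pa_model M .
    show "msat M e (at_nums \<chi> a b c d)"
    proof (cases "e 0 = std a \<and> e 1 = std b \<and> e 2 = std c \<and> e 3 = std d")
      case True
      then have "e = case_nat (std a) (case_nat (std b) (case_nat (std c) (case_nat (std d) (\<lambda>i. e (i + 4)))))"
        by (auto simp: fun_eq_iff numeral_2_eq_2 numeral_3_eq_3 eval_nat_numeral split: nat.split)
      then show ?thesis using a M by (simp add: at_nums_def) metis
    qed (auto simp: at_nums_def)
  qed
qed

section \<open>Optimality and an unprovable true sentence\<close>

lemma plain_complexity_attained:
  assumes "plain_complexity D x \<le> enat m" shows "\<exists>p. D p = Some x \<and> length p \<le> m"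
proof (rule ccontr)
  assume "\<nexists>p. D p = Some x \<and> length p \<le> m"
  then have "enat (Suc m) \<le> plain_complexity D x"
    unfolding plain_complexity_def by (intro INF_greatest) (auto simp: not_le)
  then have "enat (Suc m) \<le> enat m" using assms by (rule order_trans)
  then show False by simp
qed

text \<open>The form in which optimality is used: whatever \<Sigma>1 relation is searched from
  \<open>p\<close>, some solution costs only a constant more than \<open>p\<close>. Of the provable
  inequality just its truth in the standard model is taken.\<close>

lemma optimal_relation:
  assumes \<delta>: "represents \<delta> D" "provably_optimal \<delta>" and R: "sig (\<lambda>e. R (e 0) (e 1))"
  obtains c where "\<And>p y. R (code p) y \<Longrightarrow>
    \<exists>x. R (code p) (code x) \<and> plain_complexity D x \<le> enat (length p + c)"
proof -
  obtain D' \<delta>' where D': "partial_computable D'" "represents \<delta>' D'"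
    "\<And>p x. D' p = Some x \<Longrightarrow> R (code p) (code x)" "\<And>p y. R (code p) y \<Longrightarrow> D' p \<noteq> None"
    using representable[OF R] by blast
  obtain c where "PA \<turnstile> All (All (Imp (complexity_fm \<delta>' (Var 1) (Var 0))
                (Ex (Con (complexity_fm \<delta> (Var 2) (Var 0))
                         (Neg (Lt (Add (Var 1) (num_tm c)) (Var 0)))))))"
    using \<delta>(2) D'(1,2) unfolding provably_optimal_def by blast
  note c = PA_sound[OF this]
  have "\<exists>x. R (code p) (code x) \<and> plain_complexity D x \<le> enat (length p + c)" if y: "R (code p) y" for p y
  proof -
    obtain x where x: "D' p = Some x" using D'(4)[OF y] by blast
    have "plain_complexity D' x \<le> enat (length p)"
      unfolding plain_complexity_def using x by (intro INF_lower2[of p]) auto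
    then obtain k where k: "plain_complexity D' x = enat k" "k \<le> length p"
      by (cases "plain_complexity D' x") auto
    let ?e = "case_nat k (case_nat (code x) (\<lambda>_. 0))"
    have "sat ?e (complexity_fm \<delta>' (Var 1) (Var 0))"
      using k(1) by (subst sat_complexity[OF D'(2), of _ _ x]) auto
    then obtain j where j: "sat (case_nat j ?e) (complexity_fm \<delta> (Var 2) (Var 0))" "j \<le> k + c"
      using c[of "\<lambda>_. 0"] by (auto simp: not_less)
    have "plain_complexity D x = enat j"
      using j(1) by (subst (asm) sat_complexity[OF \<delta>(1), of _ _ x]) (auto simp: numeral_2_eq_2)
    then show ?thesis using D'(3)[OF x] j(2) k(2) by auto
  qed
  then show ?thesis using that by blast
qed

lemma pi1_subst: "pi1 \<phi> \<Longrightarrow> pi1 (subst \<sigma> \<phi>)"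
  by (induction arbitrary: \<sigma> rule: pi1.induct) (auto intro: pi1.intros delta0_subst)

text \<open>\<open>pi1\<close> is a syntactic class, so a negated \<Sigma>1 formula is only
  equivalent to a member of it. The equivalence is stated in all models, so that it transfers
  provability as well as truth.\<close>

lemma sigma1_negation:
  "sigma1 \<phi> \<Longrightarrow> \<exists>\<psi>. pi1 \<psi> \<and> fv \<psi> = fv \<phi> \<and> (\<forall>(M :: 'a str) e. msat M e \<psi> \<longleftrightarrow> \<not> msat M e \<phi>)"
proof (induction rule: sigma1.induct)
  case (1 \<phi>)
  then show ?case by (intro exI[of _ "Neg \<phi>"]) (auto intro: pi1.intros delta0.intros)
next
  case (2 \<phi>)
  then obtain \<psi> where "pi1 \<psi>" "fv \<psi> = fv \<phi>" "\<forall>(M :: 'a str) e. msat M e \<psi> \<longleftrightarrow> \<not> msat M e \<phi>"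
    by blast
  then show ?case by (intro exI[of _ "All \<psi>"]) (auto intro: pi1.intros)
qed

lemma standard_std: "pa_model.std standard n = n"
proof -
  interpret pa_model standard by (rule pa_model_standard)
  have "zer standard = 0" "suc standard = Suc" by (simp_all add: standard_def)
  then show ?thesis by (induction n) auto
qed

text \<open>Chaitin's argument: otherwise \<open>D(p) \<noteq> x\<close> would be enumerable, and from \<open>q\<close> one could
  compute some \<open>x\<close> that is not produced by any of the first \<open>(q + 1)\<^sup>2\<close> programs.\<close>

theorem pi1_incompleteness:
  assumes \<delta>: "represents \<delta> D" "provably_optimal \<delta>"
  obtains \<phi> where "sentence \<phi>" "pi1 \<phi>" "true_in_N \<phi>" "\<not> PA \<turnstile> \<phi>"
proof -
  have \<delta>s: "sigma1 \<delta>" "fv \<delta> \<subseteq> {0, 1}"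
    and sat_\<delta>: "\<And>p x e. sat (case_nat (code p) (case_nat (code x) e)) \<delta> \<longleftrightarrow> D p = Some x"
    using \<delta>(1) by (simp_all add: represents_def)
  obtain \<psi> where \<psi>: "pi1 \<psi>" "fv \<psi> = fv \<delta>" "\<And>(M :: nat str) e. msat M e \<psi> \<longleftrightarrow> \<not> msat M e \<delta>"
    using sigma1_negation[OF \<delta>s(1), where 'a=nat] by blast
  have sat_\<psi>: "sat (case_nat (code p) (case_nat (code x) e)) \<psi> \<longleftrightarrow> D p \<noteq> Some x" for p x e
    using \<psi>(3)[of standard] by (simp add: msat_standard sat_\<delta>)
  define \<nu> where "\<nu> p x = inst2 \<psi> (num_tm (code p)) (num_tm (code x))" for p x
  have sentence: "sentence (\<nu> p x)" for p x
    unfolding sentence_def \<nu>_def inst2_def fv_subst using \<psi>(2) \<delta>s(2) by (auto split: nat.splits)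
  have pi: "pi1 (\<nu> p x)" for p x unfolding \<nu>_def inst2_def by (intro pi1_subst \<psi>)
  have true: "true_in_N (\<nu> p x)" if "D p \<noteq> Some x" for p x
    using that by (simp add: true_in_N_def \<nu>_def sat_\<psi>)
  have "\<exists>p x. D p \<noteq> Some x \<and> \<not> PA \<turnstile> \<nu> p x"
  proof (rule ccontr)
    assume "\<not> ?thesis"
    then have all: "PA \<turnstile> \<nu> p x" if "D p \<noteq> Some x" for p x using that by blast
    \<comment> \<open>By soundness and the assumption, provability captures
      \<open>D p \<noteq> Some x\<close> exactly, which makes this relation enumerable.\<close>
    define N where "N p x \<longleftrightarrow> PA \<turnstile> at_nums \<psi> p x 0 0" for p x
    have N: "N (code p) (code x) \<longleftrightarrow> D p \<noteq> Some x" for p x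
    proof
      assume "N (code p) (code x)"
      then have "msat standard (case_nat (code p) (case_nat (code x) (case_nat 0 (case_nat 0 (\<lambda>_. 0))))) \<psi>"
        unfolding N_def prv_at_nums using pa_model_standard standard_std by metis
      then show "D p \<noteq> Some x" by (simp only: msat_standard sat_\<psi>) simp
    next
      assume "D p \<noteq> Some x"
      note p = all[OF this]
      show "N (code p) (code x)" unfolding N_def prv_at_nums
      proof (intro allI impI)
        fix M :: "nat str" and e assume "pa_model M"
        then interpret pa_model M .
        let ?e = "case_nat (std 0) (case_nat (std 0) e)"
        show "msat M (case_nat (std (code p)) (case_nat (std (code x)) ?e)) \<psi>"
          using prv_msat[OF p, of ?e] by (simp add: \<nu>_def)
      qed
    qed
    define R where "R q y \<longleftrightarrow> (\<forall>p<(q + 1) ^ 2. N p y)" for q y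
    have "sig (\<lambda>e. R (e 0) (e 1))"
      unfolding R_def N_def by (intro sig_intros cfun_intros sig_at_nums)
    then obtain c where c: "\<And>p y. R (code p) y \<Longrightarrow>
      \<exists>x. R (code p) (code x) \<and> plain_complexity D x \<le> enat (length p + c)"
      using optimal_relation[OF \<delta>, of R] by blast
    \<comment> \<open>Length c + 1 makes |p| + c + 1 equal to 2 |p|, so every program of length at
      most |p| + c has a code below \<open>(code p + 1) ^ 2\<close>.\<close>
    define p where "p = replicate (Suc c) True"
    have code_inv: "\<exists>z. code z = q" for q using bij_code by (metis bij_pointE)
    have "\<exists>y. R (code p) y"
    proof -
      let ?A = "{x. \<exists>p'. code p' < (code p + 1) ^ 2 \<and> D p' = Some x}"
      have "?A \<subseteq> (\<lambda>q. the (D (inv code q))) ` {..<(code p + 1) ^ 2}"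
      proof
        fix x assume "x \<in> ?A"
        then obtain p' where p': "code p' < (code p + 1) ^ 2" "D p' = Some x" by blast
        have "inv code (code p') = p'" using bij_code by (simp add: bij_is_inj)
        then show "x \<in> (\<lambda>q. the (D (inv code q))) ` {..<(code p + 1) ^ 2}"
          using p' by (intro image_eqI[of _ _ "code p'"]) auto
      qed
      then have "finite ?A" by (rule finite_subset) simp
      moreover have "infinite (UNIV :: bool list set)" by (rule infinite_UNIV_listI)
      ultimately obtain x where "x \<notin> ?A" using ex_new_if_finite by blast
      then have "N p' (code x)" if "p' < (code p + 1) ^ 2" for p'
        using that code_inv[of p'] N by blast
      then show ?thesis unfolding R_def by blast
    qed
    then obtain x where x: "R (code p) (code x)" "plain_complexity D x \<le> enat (length p + c)"
      using c by blast
    obtain p' where p': "D p' = Some x" "length p' \<le> length p + c"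
      using plain_complexity_attained[OF x(2)] by blast
    have "Suc (code p') < 2 ^ Suc (length p')" using code_length by blast
    also have "(2::nat) ^ Suc (length p') \<le> 2 ^ (length p + length p)"
      using p'(2) by (intro power_increasing) (auto simp: p_def)
    also have "\<dots> \<le> (code p + 1) ^ 2"
      using mult_mono[of "2 ^ length p" "Suc (code p)" "2 ^ length p" "Suc (code p)"] code_length[of p]
      by (simp add: power_add power2_eq_square)
    finally have "N (code p') (code x)" using x(1) by (simp add: R_def)
    then show False using N p'(1) by simp
  qed
  then show ?thesis using that sentence pi true by blast
qed

section \<open>Online hitting sets\<close>

text \<open>At time \<open>t\<close> a tuple \<open>(S t n)\<close>, \<open>lo t \<le> n \<le> hi t\<close>, arrives. It is accepted if none of its
  elements is saturated yet, and then each of its elements receives the weight \<open>2 ^ - hi t\<close>. An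
  element of level \<open>n\<close> is saturated when its weight reaches \<open>n ^ 6 / 2 ^ n\<close>. Weights at time \<open>t\<close>
  are scaled by \<open>2 ^ t\<close> to make them integers, and the set of accepted times before \<open>t\<close> is
  encoded by the number \<open>hist t\<close>.\<close>

locale hitting =
  fixes ok :: "nat \<Rightarrow> bool" and lo hi :: "nat \<Rightarrow> nat" and S :: "nat \<Rightarrow> nat \<Rightarrow> nat"
  assumes hi_le: "hi t \<le> t" and ok_range: "ok t \<Longrightarrow> 2 \<le> lo t \<and> lo t \<le> hi t"
begin

definition mass :: "nat \<Rightarrow> nat \<Rightarrow> nat \<Rightarrow> nat \<Rightarrow> nat" where
  "mass h t n x = (\<Sum>s<t. if (h div 2 ^ s) mod 2 = 1 \<and> lo s \<le> n \<and> n \<le> hi s \<and> S s n = x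
     then 2 ^ (t - hi s) else 0)"

definition accepts :: "nat \<Rightarrow> nat \<Rightarrow> bool" where
  "accepts h t \<longleftrightarrow> ok t \<and>
     (\<forall>n<Suc (hi t). lo t \<le> n \<longrightarrow> mass h t n (S t n) * 2 ^ n < n ^ 6 * 2 ^ t)"

definition hist :: "nat \<Rightarrow> nat" where
  "hist t = rec_nat 0 (\<lambda>t h. if accepts h t then h + 2 ^ t else h) t"

definition acc :: "nat \<Rightarrow> bool" where "acc t \<longleftrightarrow> accepts (hist t) t"

definition enter :: "nat \<Rightarrow> nat \<Rightarrow> bool" where
  "enter t n \<longleftrightarrow> acc t \<and> lo t \<le> n \<and> n \<le> hi t \<and>
     n ^ 6 * 2 ^ Suc t \<le> mass (hist (Suc t)) (Suc t) n (S t n) * 2 ^ n"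

definition rank :: "nat \<Rightarrow> nat \<Rightarrow> nat" where
  "rank t n = (\<Sum>s<t. if enter s n then 1 else 0)"

definition weight :: "nat \<Rightarrow> nat \<Rightarrow> nat \<Rightarrow> real" where
  "weight t n x = (\<Sum>s<t. if acc s \<and> lo s \<le> n \<and> n \<le> hi s \<and> S s n = x then (1/2) ^ hi s else 0)"

definition total :: "nat \<Rightarrow> real" where
  "total t = (\<Sum>s<t. if acc s then (1/2) ^ hi s else 0)"

definition cap :: "nat \<Rightarrow> real" where "cap n = real n ^ 6 / 2 ^ n"

section \<open>The stages in terms of real weights\<close>

lemma hist_set: "hist t = set_encode {s. s < t \<and> acc s}"
proof (induction t)
  case 0 then show ?case by (simp add: hist_def)
next
  case (Suc t)
  have "hist (Suc t) = (if acc t then hist t + 2 ^ t else hist t)"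
    by (simp add: hist_def acc_def)
  moreover have "{s. s < Suc t \<and> acc s} = (if acc t then insert t {s. s < t \<and> acc s} else {s. s < t \<and> acc s})"
    by (auto simp: less_Suc_eq)
  ultimately show ?case using Suc by (simp add: set_encode_insert)
qed

lemma hist_bit: "s < t \<Longrightarrow> (hist t div 2 ^ s) mod 2 = 1 \<longleftrightarrow> acc s"
proof -
  assume "s < t"
  have "(hist t div 2 ^ s) mod 2 = 1 \<longleftrightarrow> s \<in> set_decode (hist t)"
    by (simp add: set_decode_def odd_iff_mod_2_eq_one)
  also have "\<dots> \<longleftrightarrow> acc s" using \<open>s < t\<close> by (simp add: hist_set set_encode_inverse)
  finally show ?thesis .
qed

lemma mass_weight: "real (mass (hist t) t n x) = 2 ^ t * weight t n x"
proof -
  have "real (2 ^ (t - hi s)) = 2 ^ t * (1/2) ^ hi s" if "s < t" for s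
  proof -
    have "real (2 ^ (t - hi s)) = 2 ^ (t - hi s)" by simp
    also have "\<dots> = 2 ^ t / 2 ^ hi s" using hi_le[of s] that by (intro power_diff) auto
    finally show ?thesis by (simp add: power_one_over)
  qed
  then show ?thesis
    unfolding mass_def weight_def sum_distrib_left of_nat_sum
    by (intro sum.cong refl) (simp only: hist_bit lessThan_iff of_nat_0 mult_zero_right split: if_split, simp)
qed

lemma cap_iff: "n ^ 6 * 2 ^ t \<le> mass (hist t) t n x * 2 ^ n \<longleftrightarrow> cap n \<le> weight t n x"
proof -
  have "n ^ 6 * 2 ^ t \<le> mass (hist t) t n x * 2 ^ n \<longleftrightarrow>
      real (n ^ 6 * 2 ^ t) \<le> real (mass (hist t) t n x * 2 ^ n)" by (rule of_nat_le_iff[symmetric])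
  also have "\<dots> \<longleftrightarrow> real n ^ 6 * 2 ^ t \<le> (weight t n x * 2 ^ n) * 2 ^ t"
    by (simp add: mass_weight mult_ac)
  also have "\<dots> \<longleftrightarrow> cap n \<le> weight t n x" by (simp add: cap_def field_simps)
  finally show ?thesis .
qed

lemma acc_iff: "acc t \<longleftrightarrow> ok t \<and> (\<forall>n. lo t \<le> n \<and> n \<le> hi t \<longrightarrow> weight t n (S t n) < cap n)"
  unfolding acc_def accepts_def not_le[symmetric] cap_iff by (auto simp: less_Suc_eq_le)

lemma enter_iff: "enter t n \<longleftrightarrow> acc t \<and> lo t \<le> n \<and> n \<le> hi t \<and> cap n \<le> weight (Suc t) n (S t n)"
  unfolding enter_def cap_iff ..

lemma weight_Suc: "weight (Suc t) n x = weight t n x +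
    (if acc t \<and> lo t \<le> n \<and> n \<le> hi t \<and> S t n = x then (1/2) ^ hi t else 0)"
  by (simp add: weight_def)

lemma weight_mono: "s \<le> t \<Longrightarrow> weight s n x \<le> weight t n x"
  by (induction rule: dec_induct) (auto simp: weight_Suc intro: add_increasing2)

lemma cap_pos: "n > 0 \<Longrightarrow> cap n > 0" and cap_ge: "n > 0 \<Longrightarrow> (1/2) ^ n \<le> cap n"
  by (simp_all add: cap_def power_one_over field_simps)

text \<open>A tuple that reaches level n has \<open>hi t \<ge> n\<close>, so one increment is at
  most 2^-n and hence at most the capacity. An unsaturated element therefore overshoots by at most
  one capacity.\<close>

lemma weight_le: "n > 0 \<Longrightarrow> weight t n x \<le> 2 * cap n"
proof (induction t)
  case 0 then show ?case using cap_pos[of n] by (simp add: weight_def)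
next
  case (Suc t)
  show ?case
  proof (cases "acc t \<and> lo t \<le> n \<and> n \<le> hi t \<and> S t n = x")
    case True
    then have "weight t n x < cap n" by (auto simp: acc_iff)
    moreover have "(1/2::real) ^ hi t \<le> (1/2) ^ n" using True by (intro power_decreasing) auto
    moreover have "weight (Suc t) n x = weight t n x + (1/2) ^ hi t" using True by (simp add: weight_Suc)
    ultimately show ?thesis using cap_ge[OF Suc(2)] by linarith
  next
    case False then show ?thesis using Suc by (auto simp: weight_Suc)
  qed
qed

text \<open>Once saturated, an element blocks every later tuple containing it, so it enters only
  once.\<close>

lemma enter_inj: "inj_on (\<lambda>s. S s n) {s. enter s n}"
proof -
  have False if "enter s n" "enter t n" "S s n = S t n" "s < t" for s t
  proof -
    have "cap n \<le> weight (Suc s) n (S t n)" using that by (simp add: enter_iff)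
    also have "\<dots> \<le> weight t n (S t n)" using that(4) by (intro weight_mono) simp
    also have "\<dots> < cap n" using that(2) by (auto simp: enter_iff acc_iff)
    finally show False by simp
  qed
  then show ?thesis by (auto intro!: inj_onI) (metis linorder_neqE_nat)
qed

lemma rank_card: "rank t n = card {s. s < t \<and> enter s n}"
proof -
  have "rank t n = (\<Sum>s\<in>{s\<in>{..<t}. enter s n}. 1)"
    unfolding rank_def by (subst sum.inter_filter) auto
  then show ?thesis by (simp add: lessThan_def)
qed

lemma rank_cap: "real (rank t n) * cap n \<le> total t"
proof -
  define E where "E = {s. s < t \<and> enter s n}"
  have E: "finite E" "inj_on (\<lambda>s. S s n) E"
    unfolding E_def by (auto intro: inj_on_subset[OF enter_inj])
  have "real (rank t n) * cap n = (\<Sum>s\<in>E. cap n)" by (simp add: rank_card E_def)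
  also have "\<dots> \<le> (\<Sum>s\<in>E. weight t n (S s n))"
  proof (rule sum_mono)
    fix s assume "s \<in> E"
    then show "cap n \<le> weight t n (S s n)"
      using weight_mono[of "Suc s" t n "S s n"] by (auto simp: E_def enter_iff)
  qed
  also have "\<dots> = (\<Sum>x\<in>(\<lambda>s. S s n) ` E. weight t n x)" by (simp add: sum.reindex[OF E(2)])
  also have "\<dots> = (\<Sum>s<t. \<Sum>x\<in>(\<lambda>s. S s n) ` E.
      if acc s \<and> lo s \<le> n \<and> n \<le> hi s \<and> S s n = x then (1/2) ^ hi s else 0)"
    unfolding weight_def by (rule sum.swap)
  also have "\<dots> \<le> total t" unfolding total_def
  proof (rule sum_mono)
    fix s
    have "(\<Sum>x\<in>(\<lambda>s. S s n) ` E. if acc s \<and> lo s \<le> n \<and> n \<le> hi s \<and> S s n = x then (1/2) ^ hi s else 0)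
      \<le> (\<Sum>x\<in>(\<lambda>s. S s n) ` E. if S s n = x then (if acc s then (1/2) ^ hi s else 0) else (0::real))"
      by (rule sum_mono) auto
    also have "\<dots> \<le> (if acc s then (1/2) ^ hi s else 0)" using E(1) by (subst sum.delta') auto
    finally show "(\<Sum>x\<in>(\<lambda>s. S s n) ` E. if acc s \<and> lo s \<le> n \<and> n \<le> hi s \<and> S s n = x then (1/2) ^ hi s else 0)
      \<le> (if acc s then (1/2) ^ hi s else 0 :: real)" .
  qed
  finally show ?thesis .
qed

text \<open>Every accepted tuple meets the cover \<open>X\<close>, so its weight is charged to an element of \<open>X\<close>,
  and no element receives more than twice its capacity.\<close>

lemma total_le:
  assumes fin: "\<And>n. finite (X n)"
    and cover: "\<And>t. ok t \<Longrightarrow> \<exists>n. lo t \<le> n \<and> n \<le> hi t \<and> S t n \<in> X n"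
    and card: "\<And>n. 2 \<le> n \<Longrightarrow> card (X n) * n ^ 8 \<le> 2 ^ Suc n"
  shows "total t \<le> 4"
proof -
  have "total t \<le> (\<Sum>s<t. \<Sum>n\<in>{2..t}. \<Sum>x\<in>X n.
      if acc s \<and> lo s \<le> n \<and> n \<le> hi s \<and> S s n = x then (1/2) ^ hi s else 0)"
    unfolding total_def
  proof (rule sum_mono)
    fix s assume s: "s \<in> {..<t}"
    let ?f = "\<lambda>n x. if acc s \<and> lo s \<le> n \<and> n \<le> hi s \<and> S s n = x then (1/2) ^ hi s else (0::real)"
    show "(if acc s then (1/2) ^ hi s else 0) \<le> (\<Sum>n\<in>{2..t}. \<Sum>x\<in>X n. ?f n x)"
    proof (cases "acc s")
      case True
      then have "ok s" by (simp add: acc_iff)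
      then obtain n where n: "lo s \<le> n" "n \<le> hi s" "S s n \<in> X n" using cover by blast
      have "n \<in> {2..t}" using n ok_range[OF \<open>ok s\<close>] hi_le[of s] s by auto
      have "(1/2) ^ hi s = ?f n (S s n)" using True n by simp
      also have "\<dots> \<le> (\<Sum>x\<in>X n. ?f n x)" by (rule member_le_sum) (use n fin in auto)
      also have "\<dots> \<le> (\<Sum>n\<in>{2..t}. \<Sum>x\<in>X n. ?f n x)"
        by (rule member_le_sum[OF \<open>n \<in> {2..t}\<close>]) (auto intro: sum_nonneg)
      finally show ?thesis using True by simp
    qed (auto intro!: sum_nonneg)
  qed
  also have "\<dots> = (\<Sum>n\<in>{2..t}. \<Sum>x\<in>X n. weight t n x)"
    unfolding weight_def by (subst sum.swap) (intro sum.cong refl sum.swap)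
  \<comment> \<open>Here the exponents 8 of the cover and 6 of the capacity meet: their difference
    makes the sum over the levels converge.\<close>
  also have "\<dots> \<le> (\<Sum>n\<in>{2..t}. 4 / real n ^ 2)"
  proof (rule sum_mono)
    fix n assume n: "n \<in> {2..t}"
    have "(\<Sum>x\<in>X n. weight t n x) \<le> (\<Sum>x\<in>X n. 2 * cap n)"
      using n by (intro sum_mono weight_le) auto
    also have "\<dots> = 2 * cap n * real (card (X n))" by simp
    also have "\<dots> \<le> 2 * cap n * (2 ^ Suc n / real n ^ 8)"
    proof (rule mult_left_mono)
      have "real (card (X n) * n ^ 8) \<le> real (2 ^ Suc n)" using card n by (subst of_nat_le_iff) auto
      then show "real (card (X n)) \<le> 2 ^ Suc n / real n ^ 8" using n by (simp add: field_simps)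
    qed (simp add: cap_def)
    also have "\<dots> = 4 / real n ^ 2" using n by (simp add: cap_def field_simps)
    finally show "(\<Sum>x\<in>X n. weight t n x) \<le> 4 / real n ^ 2" .
  qed
  also have "\<dots> \<le> 4"
  proof -
    \<comment> \<open>The bound is strengthened for the induction: 4 / (m+1)^2 <= 4 / m - 4 / (m+1)
      telescopes.\<close>
    have "t \<ge> 1 \<Longrightarrow> (\<Sum>n\<in>{2..t}. 4 / real n ^ 2) \<le> 4 - 4 / real t"
    proof (induction t rule: dec_induct)
      case (step m)
      have "4 / real (Suc m) ^ 2 \<le> 4 / real m - 4 / real (Suc m)"
      proof -
        have "4 / real m - 4 / real (Suc m) = 4 / (real m * real (Suc m))"
          using step by (simp add: field_simps)
        moreover have "4 / real (Suc m) ^ 2 \<le> 4 / (real m * real (Suc m))"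
          using step by (intro divide_left_mono) (auto simp: power2_eq_square)
        ultimately show ?thesis by simp
      qed
      moreover have "{2..Suc m} = insert (Suc m) {2..m}" using step by auto
      ultimately show ?case using step by simp
    qed simp
    then show ?thesis
      by (cases "t \<ge> 1") (auto intro: order_trans[where y="4 - 4 / real t"])
  qed
  finally show ?thesis .
qed

text \<open>An element cannot cross its capacity without an \<open>enter\<close> event. So if no
  element of the tuple ever enters, every one of its infinitely many arrivals is accepted and adds
  the same 2^-h, which exceeds any capacity.\<close>

lemma hit:
  assumes inf: "infinite {t. ok t \<and> lo t = l \<and> hi t = h \<and> (\<forall>n. l \<le> n \<and> n \<le> h \<longrightarrow> S t n = s n)}"
  shows "\<exists>n t. l \<le> n \<and> n \<le> h \<and> enter t n \<and> S t n = s n"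
proof (rule ccontr)
  assume no: "\<not> ?thesis"
  define J where "J = {t. ok t \<and> lo t = l \<and> hi t = h \<and> (\<forall>n. l \<le> n \<and> n \<le> h \<longrightarrow> S t n = s n)}"
  have "J \<noteq> {}" using inf unfolding J_def by force
  then have lh: "2 \<le> l" "l \<le> h" using ok_range unfolding J_def by auto
  have less: "weight t n (s n) < cap n" if "l \<le> n" "n \<le> h" for t n
  proof (induction t)
    case 0 then show ?case using cap_pos[of n] that lh by (simp add: weight_def)
  next
    case (Suc t)
    show ?case
    proof (rule ccontr)
      assume sat: "\<not> weight (Suc t) n (s n) < cap n"
      with Suc have "acc t \<and> lo t \<le> n \<and> n \<le> hi t \<and> S t n = s n"
        by (auto simp: weight_Suc split: if_splits)
      then have "enter t n \<and> S t n = s n" using sat by (simp add: enter_iff not_less)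
      then show False using no that by blast
    qed
  qed
  have acc: "acc t" if "t \<in> J" for t using that less by (auto simp: acc_iff J_def)
  obtain k where k: "cap l * 2 ^ h < real k" using reals_Archimedean2 by blast
  obtain B where B: "B \<subseteq> J" "finite B" "card B = k"
    using infinite_arbitrarily_large[OF inf[folded J_def]] by blast
  obtain t where t: "B \<subseteq> {..<t}" using B(2) finite_nat_iff_bounded by blast
  have "real k * (1/2) ^ h = (\<Sum>u\<in>B. (1/2) ^ h)" using B by simp
  also have "\<dots> = (\<Sum>u\<in>B. if acc u \<and> lo u \<le> l \<and> l \<le> hi u \<and> S u l = s l then (1/2) ^ hi u else 0)"
    using B acc lh by (intro sum.cong) (auto simp: J_def)
  also have "\<dots> \<le> weight t l (s l)"
    unfolding weight_def by (rule sum_mono2) (use t in auto)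
  also have "\<dots> < cap l" using less lh by simp
  finally show False using k by (simp add: power_one_over field_simps)
qed

section \<open>Short programs for the entering elements\<close>

lemma enter_rank_unique: "enter t n \<Longrightarrow> enter t' n \<Longrightarrow> rank t n = rank t' n \<Longrightarrow> t = t'"
proof -
  have "rank t n < rank t' n" if "enter t n" "t < t'" for t t'
    unfolding rank_card using that by (intro psubset_card_mono) auto
  then show "enter t n \<Longrightarrow> enter t' n \<Longrightarrow> rank t n = rank t' n \<Longrightarrow> t = t'"
    by (metis less_irrefl linorder_neqE_nat)
qed

lemma enter_rank_le:
  assumes "total (Suc t) \<le> 4" "enter t n" shows "Suc (rank t n) * n ^ 6 \<le> 4 * 2 ^ n"
proof -
  have "Suc (rank t n) = rank (Suc t) n" using assms(2) by (simp add: rank_def)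
  then have "real (Suc (rank t n)) * cap n \<le> 4" using rank_cap[of "Suc t" n] assms(1) by simp
  then have "real (Suc (rank t n) * n ^ 6) \<le> real (4 * 2 ^ n)" by (simp add: cap_def field_simps)
  then show ?thesis by (simp only: of_nat_le_iff)
qed

text \<open>Programs: the position \<open>i\<close> of an element among those of its level \<open>n < 2 ^ (a + 1)\<close>, and \<open>n\<close>
  itself, are stored in \<open>q\<close> with \<open>2 log n\<close> additional bits.\<close>

definition produces :: "nat \<Rightarrow> nat \<Rightarrow> bool" where
  "produces q y \<longleftrightarrow> (\<exists>a n t. q = 2 ^ a * (2 * (rank t n * 2 ^ Suc a + n) + 1) \<and> n < 2 ^ Suc a \<and>
     enter t n \<and> y = S t n)"

lemma two_power_odd_unique:
  fixes b b' :: nat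
  shows "2 ^ a * (2 * b + 1) = 2 ^ a' * (2 * b' + 1) \<Longrightarrow> a = a' \<and> b = b'"
proof (induction a arbitrary: a')
  case 0
  then show ?case by (cases a') (simp_all, presburger)
next
  case (Suc a)
  show ?case
  proof (cases a')
    case 0 then show ?thesis using Suc.prems by simp presburger
  next
    case (Suc a'')
    then show ?thesis using Suc.IH[of a''] Suc.prems by simp
  qed
qed

lemma produces_unique:
  assumes "produces q y" "produces q y'" shows "y = y'"
proof -
  obtain a n t where 1: "q = 2 ^ a * (2 * (rank t n * 2 ^ Suc a + n) + 1)" "n < 2 ^ Suc a"
    "enter t n" "y = S t n" using assms(1) unfolding produces_def by blast
  obtain a' n' t' where 2: "q = 2 ^ a' * (2 * (rank t' n' * 2 ^ Suc a' + n') + 1)" "n' < 2 ^ Suc a'"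
    "enter t' n'" "y' = S t' n'" using assms(2) unfolding produces_def by blast
  have a: "a = a'" "rank t n * 2 ^ Suc a + n = rank t' n' * 2 ^ Suc a' + n'"
    using two_power_odd_unique[of a _ a'] 1(1) 2(1) by blast+
  have "n = (rank t n * 2 ^ Suc a + n) mod 2 ^ Suc a" "n' = (rank t' n' * 2 ^ Suc a + n') mod 2 ^ Suc a"
    using 1(2) 2(2) a(1) by simp_all
  then have n: "n = n'" using a by metis
  then have "rank t n = rank t' n'" using a by simp
  then have "t = t'" using 1(3) 2(3) n enter_rank_unique by blast
  then show ?thesis using 1 2 n by simp
qed

text \<open>With \<open>a\<close> the integer part of log n, both 2^a and 2^(a+1) are of order n, so
  the program for position i satisfies q + 1 <= 4 n^2 (i + 1). The bound (i + 1) n^6 <= 4 * 2^n then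
  gives the factor 16 and leaves the exponent 4.\<close>

lemma produces_enter:
  assumes "total (Suc t) \<le> 4" "enter t n"
  shows "\<exists>q. produces q (S t n) \<and> Suc q * n ^ 4 \<le> 16 * 2 ^ n"
proof -
  have n2: "2 \<le> n" using assms(2) ok_range by (auto simp: enter_iff acc_iff intro: order_trans)
  obtain a where a: "2 ^ a \<le> n" "n < 2 ^ Suc a" using ex_power_ivl1[of 2 n] n2 by auto
  define i where "i = rank t n"
  define q where "q = 2 ^ a * (2 * (i * 2 ^ Suc a + n) + 1)"
  have "produces q (S t n)" unfolding produces_def q_def i_def using a assms(2) by blast
  moreover have "Suc q * n ^ 4 \<le> 16 * 2 ^ n"
  proof -
    have "q \<le> n * (2 * (i * (2 * n) + n) + 1)"
      unfolding q_def using a(1) by (intro mult_mono add_mono) auto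
    also have "\<dots> = 4 * n ^ 2 * i + 2 * n ^ 2 + n" by (simp add: algebra_simps power2_eq_square)
    finally have "Suc q \<le> 4 * n ^ 2 * i + 2 * n ^ 2 + n + 1" by simp
    also have "\<dots> \<le> 4 * n ^ 2 * Suc i"
    proof -
      have "n + 1 \<le> 2 * n" using n2 by simp
      also have "\<dots> \<le> n ^ 2" using n2 by (simp add: power2_eq_square)
      finally show ?thesis by simp
    qed
    finally have "Suc q * n ^ 4 \<le> 4 * n ^ 2 * Suc i * n ^ 4" by (rule mult_le_mono1)
    also have "\<dots> = 4 * (Suc i * n ^ 6)"
      using power_add[of n 2 4] by (simp only: mult_ac numeral_plus_numeral add_num_simps)
    also have "\<dots> \<le> 16 * 2 ^ n" using enter_rank_le[OF assms] by (simp add: i_def)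
    finally show ?thesis .
  qed
  ultimately show ?thesis by blast
qed

text \<open>The history is computed by recursion on time and entering is decidable, so the only
  unbounded quantifiers are those of \<open>produces\<close> itself.\<close>

lemma sig_produces:
  assumes ok: "\<And>T. cfun T \<Longrightarrow> dec (\<lambda>e. ok (T e))"
    and lo: "\<And>T. cfun T \<Longrightarrow> cfun (\<lambda>e. lo (T e))" and hi: "\<And>T. cfun T \<Longrightarrow> cfun (\<lambda>e. hi (T e))"
    and S: "\<And>T N. cfun T \<Longrightarrow> cfun N \<Longrightarrow> cfun (\<lambda>e. S (T e) (N e))"
  shows "sig (\<lambda>e. produces (e 0) (e 1))"
proof -
  have mass: "cfun (\<lambda>e. mass (H e) (T e) (N e) (X e))" if "cfun H" "cfun T" "cfun N" "cfun X" for H T N X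
    unfolding mass_def
    by (intro cfun_intros dec_intros lo hi S that cfun_ren[OF that(1)] cfun_ren[OF that(2)]
        cfun_ren[OF that(3)] cfun_ren[OF that(4)])
  have accepts: "dec (\<lambda>e. accepts (H e) (T e))" if "cfun H" "cfun T" for H T
    unfolding accepts_def
    by (intro cfun_intros dec_intros lo hi S ok mass that cfun_ren[OF that(1)] cfun_ren[OF that(2)])
  have hist: "cfun (\<lambda>e. hist (T e))" if "cfun T" for T
    unfolding hist_def by (intro cfun_rec cfun_intros accepts that)
  have enter: "dec (\<lambda>e. enter (T e) (N e))" if "cfun T" "cfun N" for T N
    unfolding enter_def acc_def by (intro dec_intros cfun_intros accepts mass hist lo hi S that)
  have rank: "cfun (\<lambda>e. rank (T e) (N e))" if "cfun T" "cfun N" for T N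
    unfolding rank_def by (intro cfun_intros enter that cfun_ren[OF that(1)] cfun_ren[OF that(2)])
  show ?thesis unfolding produces_def
    by (intro sig_intros cfun_intros rank sig_dec[OF enter] S)
qed

end

section \<open>Tuples whose axioms prove too much\<close>

lemma dec_comp2:
  assumes "cfun F" "cfun G" "dec (\<lambda>e. R (e 0) (e 1))" shows "dec (\<lambda>e. R (F e) (G e))"
  using sig_comp2[OF assms(1,2), of "\<lambda>x y e. R x y"] sig_comp2[OF assms(1,2), of "\<lambda>x y e. \<not> R x y"]
    assms(3) by (simp add: dec_def)

text \<open>A program of length less than \<open>n - c log n\<close> with \<open>c \<ge> 9\<close> has a code \<open>p\<close> with
  \<open>(p + 1) n\<^sup>8 \<le> 2\<^sup>n\<close>. As all quantifiers are bounded by standard numbers, they range over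
  standard numbers in every model.\<close>

lemma reduction_formula:
  assumes \<phi>: "sentence \<phi>" and \<delta>: "fv \<delta> \<subseteq> {0, 1}"
  obtains \<Psi> where "\<And>(M :: nat str) a b l h e. pa_model M \<Longrightarrow> 1 \<le> l \<Longrightarrow>
     msat M (case_nat (pa_model.std M a) (case_nat (pa_model.std M b)
       (case_nat (pa_model.std M l) (case_nat (pa_model.std M h) e)))) \<Psi> \<longleftrightarrow>
     ((\<forall>n p. l \<le> n \<and> n \<le> h \<and> Suc p * n ^ 8 \<le> Suc (beta a b n) \<longrightarrow>
        \<not> msat M (case_nat (pa_model.std M p) (case_nat (pa_model.std M (beta a b n)) (\<lambda>_. zer M))) \<delta>) \<longrightarrow>
      msat M (\<lambda>_. zer M) \<phi>)"
proof -
  let ?m = "\<lambda>e. Suc (Suc (e 2) * e 4)"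
  \<comment> \<open>The variables stand for p, x, n, a, b, l, h, in this order. The remainder x of a
    is expressed by a quotient q bounded by a, as only bounded quantifiers are allowed.\<close>
  have "del (\<lambda>e. e 5 \<le> e 2 \<and> (e 1 < ?m e \<and> (\<exists>q<Suc (e 3). e 3 = q * ?m e + e 1)) \<and>
      Suc (e 0) * (e 2 * e 2 * e 2 * e 2 * e 2 * e 2 * e 2 * e 2) \<le> Suc (e 1))"
    by (intro del_intros trm_intros)
  then obtain \<theta>\<^sub>0 where \<theta>\<^sub>0: "delta0 \<theta>\<^sub>0"
    "\<And>e. sat e \<theta>\<^sub>0 \<longleftrightarrow> e 5 \<le> e 2 \<and> (e 1 < ?m e \<and> (\<exists>q<Suc (e 3). e 3 = q * ?m e + e 1)) \<and>
      Suc (e 0) * (e 2 * e 2 * e 2 * e 2 * e 2 * e 2 * e 2 * e 2) \<le> Suc (e 1)"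
    unfolding del_def by metis
  have m: "(e 1 < ?m e \<and> (\<exists>q<Suc (e 3). e 3 = q * ?m e + e 1)) \<longleftrightarrow> e 1 = beta (e 3) (e 4) (e 2)" for e :: "nat \<Rightarrow> nat"
  proof
    assume "e 1 < ?m e \<and> (\<exists>q<Suc (e 3). e 3 = q * ?m e + e 1)"
    then obtain q where "e 1 < ?m e" "e 3 = q * ?m e + e 1" by blast
    then show "e 1 = beta (e 3) (e 4) (e 2)"
      unfolding beta_def by (metis mod_less mod_mult_self3)
  next
    assume "e 1 = beta (e 3) (e 4) (e 2)"
    then have "e 1 = e 3 mod ?m e" by (simp only: beta_def)
    moreover have "e 3 mod ?m e < ?m e" by (rule mod_less_divisor) simp
    moreover have "e 3 div ?m e < Suc (e 3)" by (simp only: less_Suc_eq_le div_le_dividend)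
    moreover have "e 3 = e 3 div ?m e * ?m e + e 3 mod ?m e" by (rule div_mult_mod_eq[symmetric])
    ultimately show "e 1 < ?m e \<and> (\<exists>q<Suc (e 3). e 3 = q * ?m e + e 1)" by metis
  qed
  have "x * x * x * x * x * x * x * x = x ^ 8" for x :: nat by (simp add: eval_nat_numeral mult.assoc)
  note \<theta>\<^sub>0_iff = \<theta>\<^sub>0(2)[unfolded m this]
  \<comment> \<open>Variables from 7 on become \<open>Zero\<close>: the tail of the assignment in
    \<open>M\<close> may be nonstandard, and \<open>delta0_absolute\<close> speaks of purely
    standard assignments.\<close>
  define \<theta> where "\<theta> = subst (\<lambda>i. if i < 7 then Var i else Zero) \<theta>\<^sub>0"
  have \<theta>: "delta0 \<theta>" "sat e \<theta> \<longleftrightarrow> e 5 \<le> e 2 \<and> e 1 = beta (e 3) (e 4) (e 2) \<and>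
      Suc (e 0) * e 2 ^ 8 \<le> Suc (e 1)" for e
    unfolding \<theta>_def sat_subst \<theta>\<^sub>0_iff by (simp_all add: delta0_subst \<theta>\<^sub>0(1))
  \<comment> \<open>The bounds n <= h, x <= a, p <= x lose nothing: \<open>beta a b n\<close> is a
    remainder of \<open>a\<close>, and p <= x follows from the inequality because n >= l >=
    1.\<close>
  define \<Psi> where "\<Psi> = Imp (All (Imp (Lt (Var 0) (Succ (Var 4))) (All (Imp (Lt (Var 0) (Succ (Var 2)))
    (All (Imp (Lt (Var 0) (Succ (Var 1))) (Imp \<theta> (Neg (inst2 \<delta> (Var 0) (Var 1)))))))))) \<phi>"
  show thesis
  proof (rule that[of \<Psi>])
    fix M :: "nat str" and a b l h :: nat and e assume "pa_model M" and l: "1 \<le> l"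
    then interpret pa_model M by simp
    let ?e = "case_nat (std a) (case_nat (std b) (case_nat (std l) (case_nat (std h) e)))"
    have \<theta>M: "msat M (case_nat (std p) (case_nat (std x) (case_nat (std n) ?e))) \<theta> \<longleftrightarrow>
        l \<le> n \<and> x = beta a b n \<and> Suc p * n ^ 8 \<le> Suc x" for p x n
    proof -
      let ?E = "case_nat p (case_nat x (case_nat n (case_nat a (case_nat b (case_nat l (case_nat h (\<lambda>_. 0)))))))"
      have "(\<lambda>i. mtval M (case_nat (std p) (case_nat (std x) (case_nat (std n) ?e)))
          (if i < 7 then Var i else Zero)) = (\<lambda>i. std (?E i))"
        by (auto simp: fun_eq_iff split: nat.split)
      then have "msat M (case_nat (std p) (case_nat (std x) (case_nat (std n) ?e))) \<theta> \<longleftrightarrow>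
          msat M (\<lambda>i. std (?E i)) \<theta>\<^sub>0" unfolding \<theta>_def msat_subst by simp
      also have "(\<lambda>i. std (?E i)) = (\<lambda>i. mtval M (\<lambda>i. std (?E i)) (if i < 7 then Var i else Zero))"
        by (auto simp: fun_eq_iff split: nat.split)
      then have "msat M (\<lambda>i. std (?E i)) \<theta>\<^sub>0 \<longleftrightarrow> msat M (\<lambda>i. std (?E i)) \<theta>"
        unfolding \<theta>_def msat_subst by simp
      finally show ?thesis by (simp add: delta0_absolute[OF \<theta>(1)] \<theta>(2) eval_nat_numeral)
    qed
    have \<phi>M: "msat M e' \<phi> \<longleftrightarrow> msat M (\<lambda>_. zer M) \<phi>" for e'
      by (rule msat_cong) (use \<phi> in \<open>simp add: sentence_def\<close>)
    have \<delta>M: "msat M (case_nat u (case_nat v (case_nat w e'))) \<delta> \<longleftrightarrow>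
        msat M (case_nat u (case_nat v (\<lambda>_. zer M))) \<delta>" for u v w e' by (rule msat_two[OF \<delta>])
    have less: "(\<forall>y. les M y (suc M (std k)) \<longrightarrow> P y) \<longleftrightarrow> (\<forall>y\<le>k. P (std y))" for k P
      using less_std[of _ "Suc k"] by (auto simp: less_Suc_eq_le)
    have "msat M ?e \<Psi> \<longleftrightarrow> ((\<forall>n\<le>h. \<forall>x\<le>a. \<forall>p\<le>x. l \<le> n \<and> x = beta a b n \<and> Suc p * n ^ 8 \<le> Suc x \<longrightarrow>
         \<not> msat M (case_nat (std p) (case_nat (std x) (\<lambda>_. zer M))) \<delta>) \<longrightarrow> msat M (\<lambda>_. zer M) \<phi>)"
      by (simp add: \<Psi>_def \<delta>M \<phi>M[of ?e] eval_nat_numeral less \<theta>M[unfolded eval_nat_numeral])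
    also have "\<dots> \<longleftrightarrow> ((\<forall>n p. l \<le> n \<and> n \<le> h \<and> Suc p * n ^ 8 \<le> Suc (beta a b n) \<longrightarrow>
        \<not> msat M (case_nat (std p) (case_nat (std (beta a b n)) (\<lambda>_. zer M))) \<delta>) \<longrightarrow> msat M (\<lambda>_. zer M) \<phi>)"
    proof -
      have "beta a b n \<le> a" for n by (simp add: beta_def)
      moreover have "p \<le> beta a b n" if "l \<le> n" "Suc p * n ^ 8 \<le> Suc (beta a b n)" for n p
      proof -
        have "Suc p * 1 \<le> Suc p * n ^ 8" using l that(1) by (intro mult_le_mono2) simp
        then show ?thesis using that(2) by simp
      qed
      ultimately show ?thesis by blast
    qed
    finally show "msat M ?e \<Psi> \<longleftrightarrow> ((\<forall>n p. l \<le> n \<and> n \<le> h \<and> Suc p * n ^ 8 \<le> Suc (beta a b n) \<longrightarrow>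
        \<not> msat M (case_nat (std p) (case_nat (std (beta a b n)) (\<lambda>_. zer M))) \<delta>) \<longrightarrow> msat M (\<lambda>_. zer M) \<phi>)" .
  qed
qed

text \<open>Choosing for each string one of its programs in \<open>M\<close> is injective by
  functionality, and the chosen programs lie below 2^(n+1) / n^8. The count concerns standard
  numbers and is done outside \<open>M\<close>.\<close>

lemma (in pa_model) card_low_complexity:
  fixes n :: nat
  assumes "represents \<delta> D" "n > 0"
  defines "X \<equiv> {x. Suc x < 2 ^ Suc n \<and> (\<exists>p. Suc p * n ^ 8 \<le> Suc x \<and>
     msat M (case_nat (std p) (case_nat (std x) (\<lambda>_. zer M))) \<delta>)}"
  shows "finite X" "card X * n ^ 8 \<le> 2 ^ Suc n"
proof -
  have "X \<subseteq> {..<2 ^ Suc n}" unfolding X_def by auto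
  then show "finite X" by (rule finite_subset) simp
  have "\<forall>x\<in>X. \<exists>p. Suc p * n ^ 8 \<le> Suc x \<and> msat M (case_nat (std p) (case_nat (std x) (\<lambda>_. zer M))) \<delta>"
    unfolding X_def by blast
  then obtain f where f: "\<And>x. x \<in> X \<Longrightarrow> Suc (f x) * n ^ 8 \<le> Suc x"
    "\<And>x. x \<in> X \<Longrightarrow> msat M (case_nat (std (f x)) (case_nat (std x) (\<lambda>_. zer M))) \<delta>" by metis
  have "inj_on f X"
  proof (rule inj_onI)
    fix x y assume "x \<in> X" "y \<in> X" "f x = f y"
    then have "std x = std y" using represents_functional[OF assms(1)] f(2) by metis
    then show "x = y" by simp
  qed
  moreover have "f ` X \<subseteq> {..<2 ^ Suc n div n ^ 8}"
  proof
    fix p assume "p \<in> f ` X"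
    then obtain x where "x \<in> X" "p = f x" by blast
    then have "Suc p * n ^ 8 \<le> 2 ^ Suc n" using f(1)[of x] by (auto simp: X_def)
    then show "p \<in> {..<2 ^ Suc n div n ^ 8}"
      using assms(2) by (simp add: less_eq_div_iff_mult_less_eq Suc_le_eq[symmetric])
  qed
  ultimately have "card X \<le> 2 ^ Suc n div n ^ 8" using card_inj_on_le[of f X "{..<2 ^ Suc n div n ^ 8}"] by simp
  then have "card X * n ^ 8 \<le> 2 ^ Suc n div n ^ 8 * n ^ 8" by (rule mult_le_mono1)
  also have "\<dots> \<le> 2 ^ Suc n" by (rule div_times_less_eq_dividend)
  finally show "card X * n ^ 8 \<le> 2 ^ Suc n" .
qed

text \<open>Rounding the real bound up costs a factor of at most 2, which is absorbed by one factor
  n >= 2. This is why 9 is needed for the exponent 8.\<close>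

lemma weak_axiom_bound:
  assumes c: "9 \<le> c" and n: "2 \<le> n" and p: "Suc p < 2 ^ nat \<lceil>real n - c * log 2 (real n)\<rceil>"
  shows "Suc p * n ^ 8 \<le> 2 ^ n"
proof -
  define t where "t = real n - c * log 2 (real n)"
  have "nat \<lceil>t\<rceil> \<noteq> 0" using p unfolding t_def[symmetric] by (cases "nat \<lceil>t\<rceil> = 0") simp_all
  then have k: "real (nat \<lceil>t\<rceil>) \<le> t + 1" by linarith
  have "real (Suc p) \<le> real (2 ^ nat \<lceil>t\<rceil>)"
    using p unfolding t_def[symmetric] by (subst of_nat_le_iff) simp
  then have "real (Suc p * n ^ 8) \<le> 2 ^ nat \<lceil>t\<rceil> * real n ^ 8"
    by (simp only: of_nat_mult of_nat_power of_nat_numeral) (intro mult_right_mono, simp_all)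
  also have "(2::real) ^ nat \<lceil>t\<rceil> = 2 powr real (nat \<lceil>t\<rceil>)" by (simp add: powr_realpow)
  also have "\<dots> \<le> 2 powr (t + 1)" using k by (intro powr_mono) auto
  also have "\<dots> = 2 * 2 ^ n / real n powr c"
  proof -
    have "2 powr (c * log 2 (real n)) = real n powr c"
      using n by (simp add: mult.commute[of c] flip: powr_powr)
    then show ?thesis unfolding t_def by (simp add: powr_add powr_diff powr_realpow)
  qed
  also have "\<dots> * real n ^ 8 \<le> 2 ^ n"
  proof -
    have "2 * real n ^ 8 \<le> real n * real n ^ 8" using n by (intro mult_right_mono) auto
    also have "\<dots> = real n ^ 9" by (simp add: eval_nat_numeral)
    also have "\<dots> = real n powr real 9" using n by (intro powr_realpow[symmetric]) simp
    also have "\<dots> \<le> real n powr c" using n c by (intro powr_mono) auto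
    finally show ?thesis using n by (simp add: field_simps)
  qed
  finally have "real (Suc p * n ^ 8) \<le> real (2 ^ n)" by (simp add: mult_right_mono)
  then show ?thesis by (simp only: of_nat_le_iff)
qed

theorem theorem10:
  fixes D :: "bool list \<Rightarrow> bool list option" and \<delta> :: fm and r :: "nat \<Rightarrow> bool list"
  assumes "partial_computable D" and "represents \<delta> D" and "provably_optimal \<delta>"
    and "\<And>n. length (r n) = n"
    and "\<exists>d::nat. \<forall>n. plain_complexity D (r n) + enat d \<ge> enat n"
  shows "\<exists>c::real. \<not> (\<forall>\<phi>. sentence \<phi> \<and> pi1 \<phi> \<and> true_in_N \<phi> \<longrightarrow>
           PA \<union> {complexity_ge \<delta> (r n) (real n - c * log 2 (real n)) | n. n \<ge> 2} \<turnstile> \<phi>)"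
proof -
  have \<delta>: "fv \<delta> \<subseteq> {0, 1}" using assms(2) by (simp add: represents_def)
  obtain \<phi> where \<phi>: "sentence \<phi>" "pi1 \<phi>" "true_in_N \<phi>" "\<not> PA \<turnstile> \<phi>"
    using pi1_incompleteness[OF assms(2,3)] by blast
  obtain d where d: "\<And>n. enat n \<le> plain_complexity D (r n) + enat d" using assms(5) by blast
  obtain \<Psi> where \<Psi>: "\<And>(M :: nat str) a b l h e. pa_model M \<Longrightarrow> 1 \<le> l \<Longrightarrow>
     msat M (case_nat (pa_model.std M a) (case_nat (pa_model.std M b)
       (case_nat (pa_model.std M l) (case_nat (pa_model.std M h) e)))) \<Psi> \<longleftrightarrow>
     ((\<forall>n p. l \<le> n \<and> n \<le> h \<and> Suc p * n ^ 8 \<le> Suc (beta a b n) \<longrightarrow>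
        \<not> msat M (case_nat (pa_model.std M p) (case_nat (pa_model.std M (beta a b n)) (\<lambda>_. zer M))) \<delta>) \<longrightarrow>
      msat M (\<lambda>_. zer M) \<phi>)"
    using reduction_formula[OF \<phi>(1) \<delta>] by blast
  \<comment> \<open>A number z codes a tuple by (a, b, l, h): the beta pair (a, b) lists the codes
    of its members for the lengths from l to h.\<close>
  define pa where "pa z = fst (prod_decode z)" for z
  define pb where "pb z = fst (prod_decode (snd (prod_decode z)))" for z
  define pl where "pl z = fst (prod_decode (snd (prod_decode (snd (prod_decode z)))))" for z
  define ph where "ph z = snd (prod_decode (snd (prod_decode (snd (prod_decode z)))))" for z
  define A where "A z \<longleftrightarrow> PA \<turnstile> at_nums \<Psi> (pa z) (pb z) (pl z) (ph z)" for z
  have "sig (\<lambda>e. A (e 0))"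
    unfolding A_def pa_def pb_def pl_def ph_def by (intro sig_at_nums cfun_intros)
  then obtain P where P: "dec (\<lambda>e. P (e 0) (\<lambda>i. e (Suc i)))" "\<And>e. A (e 0) \<longleftrightarrow> (\<exists>w. P w e)"
    using sig_normal by blast
  define Q where "Q w z \<longleftrightarrow> P w (\<lambda>_. z)" for w z
  have Q: "A z \<longleftrightarrow> (\<exists>w. Q w z)" for z unfolding Q_def using P(2)[of "\<lambda>_. z"] by simp
  have dec_Q: "dec (\<lambda>e. Q (W e) (Z e))" if "cfun W" "cfun Z" for W Z
  proof (rule dec_comp2[OF that])
    show "dec (\<lambda>e. Q (e 0) (e 1))"
      using P(1) sig_ren[of "\<lambda>e. P (e 0) (\<lambda>i. e (Suc i))" "case_nat 0 (\<lambda>_. 1)"]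
        sig_ren[of "\<lambda>e. \<not> P (e 0) (\<lambda>i. e (Suc i))" "case_nat 0 (\<lambda>_. 1)"]
      by (simp add: dec_def Q_def)
  qed
  \<comment> \<open>A time is a triple (i, w, z) with w certifying that z is bad. The first
    component is idle, so that each certified tuple arrives infinitely often, as \<open>hit\<close>
    requires.\<close>
  define wz where "wz t = fst (prod_decode (snd (prod_decode t)))" for t
  define dz where "dz t = snd (prod_decode (snd (prod_decode t)))" for t
  define lo where "lo t = pl (dz t)" for t
  define hi where "hi t = ph (dz t)" for t
  define S where "S t n = beta (pa (dz t)) (pb (dz t)) n" for t n
  \<comment> \<open>The last clause restricts the member of level n to codes of strings of length at
    most n; without it that member could lie outside the finite set \<open>X n\<close>.\<close>
  define ok where "ok t \<longleftrightarrow> Q (wz t) (dz t) \<and> 2 \<le> lo t \<and> lo t \<le> hi t \<and>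
    (\<forall>n<Suc (hi t). lo t \<le> n \<longrightarrow> Suc (S t n) < 2 ^ Suc n)" for t
  have snd_le: "snd (prod_decode z) \<le> z" for z
    using le_prod_encode_2[of "snd (prod_decode z)" "fst (prod_decode z)"] by simp
  interpret hitting ok lo hi S
  proof
    show "hi t \<le> t" for t
      unfolding hi_def ph_def dz_def by (intro order_trans[OF snd_le]) simp
    show "ok t \<Longrightarrow> 2 \<le> lo t \<and> lo t \<le> hi t" for t by (simp add: ok_def)
  qed
  have cS: "cfun (\<lambda>e. S (T e) (N e))" if "cfun T" "cfun N" for T N
    unfolding S_def pa_def pb_def dz_def by (intro cfun_beta cfun_intros that)
  have clo: "cfun (\<lambda>e. lo (T e))" and chi: "cfun (\<lambda>e. hi (T e))" if "cfun T" for T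
    unfolding lo_def hi_def pl_def ph_def dz_def by (intro cfun_intros that)+
  have "dec (\<lambda>e. ok (T e))" if "cfun T" for T
    unfolding ok_def wz_def dz_def
    by (intro dec_intros dec_Q cfun_intros clo chi cS that cfun_ren[OF that])
  \<comment> \<open>The enumeration depends only on \<phi> and \<delta>, so this \<open>c\<close> is
    fixed before the constant \<open>C\<close> of the axioms is chosen.\<close>
  from sig_produces[OF this clo chi cS] obtain c where c: "\<And>p y. produces (code p) y \<Longrightarrow>
      \<exists>x. produces (code p) (code x) \<and> plain_complexity D x \<le> enat (length p + c)"
    using optimal_relation[OF assms(2,3)] by blast

  have total: "total t \<le> 4" for t
  proof -
    obtain M :: "nat str" and e where M: "pa_model M" "\<not> msat M e \<phi>"
      using PA_complete'[of \<phi>] \<phi>(4) by blast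
    then interpret pa_model M by simp
    have n\<phi>: "\<not> msat M (\<lambda>_. zer M) \<phi>"
      using M(2) msat_cong[of \<phi> e "\<lambda>_. zer M" M] \<phi>(1) by (simp add: sentence_def)
    define X where "X n = {x. Suc x < 2 ^ Suc n \<and> (\<exists>p. Suc p * n ^ 8 \<le> Suc x \<and>
      msat M (case_nat (std p) (case_nat (std x) (\<lambda>_. zer M))) \<delta>)}" for n
    show ?thesis
    proof (rule total_le)
      fix t assume ok: "ok t"
      then have "A (dz t)" using Q by (auto simp: ok_def)
      then have "msat M (case_nat (std (pa (dz t))) (case_nat (std (pb (dz t)))
          (case_nat (std (lo t)) (case_nat (std (hi t)) e)))) \<Psi>"
        unfolding A_def prv_at_nums lo_def hi_def using M(1) by blast
      \<comment> \<open>Since \<phi> fails in \<open>M\<close>, the provable implication \<Psi> must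
        have a false premise, which yields a member with a short program in
        \<open>M\<close>.\<close>
      then obtain n p where "lo t \<le> n" "n \<le> hi t" "Suc p * n ^ 8 \<le> Suc (S t n)"
        "msat M (case_nat (std p) (case_nat (std (S t n)) (\<lambda>_. zer M))) \<delta>"
        using \<Psi>[OF M(1), of "lo t"] n\<phi> ok unfolding S_def ok_def by auto
      then show "\<exists>n. lo t \<le> n \<and> n \<le> hi t \<and> S t n \<in> X n"
        using ok unfolding X_def ok_def by (auto simp: less_Suc_eq_le)
    next
      show "finite (X n)" for n
        by (rule finite_subset[of _ "{..<2 ^ Suc n}"]) (auto simp: X_def)
      show "card (X n) * n ^ 8 \<le> 2 ^ Suc n" if "2 \<le> n" for n
        unfolding X_def using card_low_complexity[OF assms(2), of n] that by simp
    qed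
  qed

  \<comment> \<open>\<open>n1\<close> exceeds 2^(c+d+4), the bound on n^4 obtained at the end. In
    \<open>C\<close>, the 9 is for \<open>weak_axiom_bound\<close>, and \<open>C \<ge> n1\<close>
    makes the axioms below \<open>n1\<close> void.\<close>
  define n1 where "n1 = 2 ^ (c + d + 4) + (2 :: nat)"
  define C where "C = max 9 (real n1)"
  define ax where "ax n = complexity_ge \<delta> (r n) (real n - C * log 2 (real n))" for n
  show ?thesis
  proof (intro exI[of _ C] notI)
    assume "\<forall>\<phi>. sentence \<phi> \<and> pi1 \<phi> \<and> true_in_N \<phi> \<longrightarrow>
        PA \<union> {complexity_ge \<delta> (r n) (real n - C * log 2 (real n)) | n. n \<ge> 2} \<turnstile> \<phi>"
    then have "PA \<union> {ax n | n. n \<ge> 2} \<turnstile> \<phi>" unfolding ax_def using \<phi> by blast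
    then obtain F where F: "finite F" "F \<subseteq> PA \<union> {ax n | n. n \<ge> 2}" "F \<turnstile> \<phi>"
      using prv_compact by blast
    have "\<forall>f\<in>F. \<exists>n. f \<in> PA \<union> ax ` {2..n}" using F(2) by fastforce
    then obtain g where g: "\<And>f. f \<in> F \<Longrightarrow> f \<in> PA \<union> ax ` {2..g f}" by metis
    define N0 where "N0 = sum g F"
    have N0: "F \<subseteq> PA \<union> ax ` {2..N0}"
    proof
      fix f assume "f \<in> F"
      then have "g f \<le> N0" unfolding N0_def using F(1) by (intro member_le_sum) auto
      then have "ax ` {2..g f} \<subseteq> ax ` {2..N0}" by (intro image_mono) simp
      then show "f \<in> PA \<union> ax ` {2..N0}" using g[OF \<open>f \<in> F\<close>] by blast
    qed
    \<comment> \<open>The maximum ensures \<open>n1 \<le> N\<close>, as \<open>ok\<close> demands of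
      a tuple, even if the given proof uses short lengths only.\<close>
    define N where "N = max N0 n1"
    have prv_\<phi>: "PA \<union> ax ` {2..N} \<turnstile> \<phi>"
    proof (rule prv_mono[OF F(3)])
      have "ax ` {2..N0} \<subseteq> ax ` {2..N}" by (intro image_mono) (simp add: N_def)
      then show "F \<subseteq> PA \<union> ax ` {2..N}" using N0 by blast
    qed
    obtain a b where ab: "\<And>n. n \<le> N \<Longrightarrow> beta a b n = code (r n)"
      using beta_lemma[of N "\<lambda>n. code (r n)"] unfolding beta_def by blast
    \<comment> \<open>The tuple of the strings \<open>r n\<close> from \<open>n1\<close> to
      \<open>N\<close> is bad: in any model the premise of \<Psi> validates all axioms up to
      \<open>N\<close>, and these prove \<phi>.\<close>
    have "PA \<turnstile> at_nums \<Psi> a b n1 N" unfolding prv_at_nums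
    proof (intro allI impI)
      fix M :: "nat str" and e assume M: "pa_model M"
      then interpret pa_model M .
      have "msat M (\<lambda>_. zer M) \<phi>" if no: "\<forall>n p. n1 \<le> n \<and> n \<le> N \<and> Suc p * n ^ 8 \<le> Suc (beta a b n) \<longrightarrow>
        \<not> msat M (case_nat (std p) (case_nat (std (beta a b n)) (\<lambda>_. zer M))) \<delta>"
      proof -
        have "msat M e (ax n)" if n: "n \<in> {2..N}" for n e
          unfolding ax_def
        proof (rule complexity_ge_std[OF \<delta>])
          fix p assume p: "Suc p < 2 ^ nat \<lceil>real n - C * log 2 (real n)\<rceil>"
          \<comment> \<open>For n < n1 the threshold is at most 0, as log n >= 1 and n <= C, and no
            p satisfies p + 1 < 2^0.\<close>
          have "n1 \<le> n"
          proof (rule ccontr)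
            assume "\<not> n1 \<le> n"
            then have "real n \<le> C" by (simp add: C_def)
            moreover have "C * 1 \<le> C * log 2 (real n)" using n by (intro mult_left_mono) (auto simp: C_def)
            ultimately have "nat \<lceil>real n - C * log 2 (real n)\<rceil> = 0" by simp
            then show False using p by simp
          qed
          have "Suc p * n ^ 8 \<le> 2 ^ n"
            by (rule weak_axiom_bound[OF _ _ p]) (use n in \<open>auto simp: C_def\<close>)
          also have "2 ^ n \<le> Suc (code (r n))" using code_length[of "r n"] assms(4) by simp
          finally show "\<not> msat M (case_nat (std p) (case_nat (std (code (r n))) (\<lambda>_. zer M))) \<delta>"
            using no ab[of n] n \<open>n1 \<le> n\<close> by (metis atLeastAtMost_iff)
        qed
        then have "models M (PA \<union> ax ` {2..N})" using models_PA by (auto simp: models_def)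
        then show ?thesis by (rule msoundness[OF prv_\<phi>])
      qed
      then show "msat M (case_nat (std a) (case_nat (std b) (case_nat (std n1) (case_nat (std N) e)))) \<Psi>"
        by (subst \<Psi>[OF M]) (auto simp: n1_def)
    qed
    define z where "z = prod_encode (a, prod_encode (b, prod_encode (n1, N)))"
    have z: "pa z = a" "pb z = b" "pl z = n1" "ph z = N"
      by (simp_all add: z_def pa_def pb_def pl_def ph_def)
    then have "A z" using \<open>PA \<turnstile> at_nums \<Psi> a b n1 N\<close> by (simp add: A_def)
    then obtain w where w: "Q w z" using Q by blast
    define tm where "tm i = prod_encode (i, prod_encode (w, z))" for i
    have tm: "wz (tm i) = w" "dz (tm i) = z" for i by (simp_all add: tm_def wz_def dz_def)
    have "ok (tm i) \<and> lo (tm i) = n1 \<and> hi (tm i) = N \<and>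
        (\<forall>n. n1 \<le> n \<and> n \<le> N \<longrightarrow> S (tm i) n = code (r n))" for i
    proof -
      have "Suc (code (r n)) < 2 ^ Suc n" for n using code_length[of "r n"] assms(4)[of n] by metis
      then show ?thesis
        using w by (auto simp: ok_def lo_def hi_def S_def tm z ab n1_def N_def simp del: power_Suc)
    qed
    then have "range tm \<subseteq> {t. ok t \<and> lo t = n1 \<and> hi t = N \<and>
        (\<forall>n. n1 \<le> n \<and> n \<le> N \<longrightarrow> S t n = code (r n))}" by blast
    moreover have "infinite (range tm)" by (rule range_inj_infinite) (simp add: inj_def tm_def)
    ultimately have "infinite {t. ok t \<and> lo t = n1 \<and> hi t = N \<and>
        (\<forall>n. n1 \<le> n \<and> n \<le> N \<longrightarrow> S t n = code (r n))}" using finite_subset by blast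
    from hit[OF this] obtain n t where nt: "n1 \<le> n" "enter t n" "S t n = code (r n)" by blast
    obtain q where q: "produces q (code (r n))" "Suc q * n ^ 4 \<le> 16 * 2 ^ n"
      using produces_enter[OF total nt(2)] nt(3) by auto
    obtain p where p: "q = code p" using bij_code by (metis bij_pointE)
    obtain x where x: "produces (code p) (code x)" "plain_complexity D x \<le> enat (length p + c)"
      using c q(1) p by blast
    \<comment> \<open>\<open>optimal_relation\<close> promises just some output; uniqueness of
      outputs of \<open>produces\<close> identifies it with \<open>r n\<close>.\<close>
    have "code x = code (r n)" using produces_unique x(1) q(1) p by blast
    then have "x = r n" using bij_code by (metis bij_is_inj injD)
    then have "enat n \<le> enat (length p + c) + enat d"
      using d[of n] x(2) by (meson add_right_mono order_trans)
    then have "n \<le> length p + (c + d)" by simp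
    then have "(2::nat) ^ n \<le> 2 ^ length p * 2 ^ (c + d)"
      by (simp only: power_add[symmetric]) (intro power_increasing, auto)
    also have "\<dots> \<le> Suc q * 2 ^ (c + d)" using code_length[of p] p by (intro mult_le_mono1) simp
    \<comment> \<open>Multiplying by n^4 allows the size bound for q to be inserted; cancelling 2^n
      leaves n^4 <= 2^(c+d+4), where 16 contributes the 4.\<close>
    finally have "2 ^ n * n ^ 4 \<le> (Suc q * n ^ 4) * 2 ^ (c + d)"
      using mult_le_mono1[of _ _ "n ^ 4"] by (metis mult.assoc mult.commute)
    also have "\<dots> \<le> (16 * 2 ^ n) * 2 ^ (c + d)" using q(2) by (rule mult_le_mono1)
    also have "\<dots> = 2 ^ n * 2 ^ (c + d + 4)" by (simp add: power_add)
    finally have "n ^ 4 \<le> 2 ^ (c + d + 4)" by simp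
    also have "\<dots> < n" using nt(1) by (simp add: n1_def)
    finally show False using self_le_power[of n 4] nt(1) by (simp add: n1_def)
  qed
qed

end
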